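(* Let $\Gamma$ be a discrete group having only finitely many finite subgroups up to conjugacy. For any family $\mathcal{F}$ of finite subgroups of $\Gamma$, $$\dim_{\mathbb{Q}}G_{\mathcal{F}}(\mathbb{Z}[\Gamma])\otimes\mathbb{Q}\geq C_{\mathcal{F}}(\Gamma),$$ where $C_{\mathcal{F}}(\Gamma)$ denotes the number of distinct conjugacy classes of cyclic subgroups belonging to $\mathcal{F}$.
   Context: A family $\mathcal{F}$ of finite subgroups of $\Gamma$ is a non-empty collection of finite subgroups of $\Gamma$ closed under conjugation and under taking subgroups. For a finite group $H$, $G(\mathbb{Z}[H])$ is the Grothendieck group of finitely generated $\mathbb{Z}[H]$-modules (generators $[M]$, relations $[M]=[M']+[M'']$ for short exact sequences $0\to M'\to M\to M''\to0$). $G_{\mathcal{F}}(\mathbb{Z}[\Gamma])=\varprojlim_{H\in\mathcal{F}} G(\mathbb{Z}[H])$ consists of those $(x_H)\in\prod_{H\in\mathcal{F}}G(\mathbb{Z}[H])$ such that (1) $\mathrm{res}^K_H(x_K)=x_H$ whenever $H\subseteq K$ are in $\mathcal{F}$, and (2) $C_\gamma^*(x_K)=x_H$ whenever $K=\gamma H\gamma^{-1}$, where $C_\gamma^*:G(\mathbb{Z}[\gamma H\gamma^{-1}])\to G(\mathbb{Z}[H])$ is induced by the homomorphism $H\to\gamma H\gamma^{-1}$, $h\mapsto \gamma h\gamma^{-1}$. *)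

theory Defs
  imports
    "HOL-Algebra.Free_Abelian_Groups"
    "HOL-Library.Extended_Nat"
    "Jordan_Normal_Form.VS_Connect"
begin

section \<open>Left modules over a not necessarily commutative ring\<close>

text \<open>The library's locale for modules requires a commutative ring. The module record is reused;
  its ring-multiplicative fields \<open>mult\<close> and \<open>one\<close> play no role.\<close>

locale left_module = R?: ring R + M?: abelian_group M
  for R :: "('r, 'n) ring_scheme" (structure) and M :: "('r, 'm, 'x) module_scheme" (structure) +
  assumes smult_closed:
      "\<lbrakk>a \<in> carrier R; x \<in> carrier M\<rbrakk> \<Longrightarrow> a \<odot>\<^bsub>M\<^esub> x \<in> carrier M"
    and smult_l_distr:
      "\<lbrakk>a \<in> carrier R; b \<in> carrier R; x \<in> carrier M\<rbrakk> \<Longrightarrow>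
        (a \<oplus>\<^bsub>R\<^esub> b) \<odot>\<^bsub>M\<^esub> x = a \<odot>\<^bsub>M\<^esub> x \<oplus>\<^bsub>M\<^esub> b \<odot>\<^bsub>M\<^esub> x"
    and smult_r_distr:
      "\<lbrakk>a \<in> carrier R; x \<in> carrier M; y \<in> carrier M\<rbrakk> \<Longrightarrow>
        a \<odot>\<^bsub>M\<^esub> (x \<oplus>\<^bsub>M\<^esub> y) = a \<odot>\<^bsub>M\<^esub> x \<oplus>\<^bsub>M\<^esub> a \<odot>\<^bsub>M\<^esub> y"
    and smult_assoc1:
      "\<lbrakk>a \<in> carrier R; b \<in> carrier R; x \<in> carrier M\<rbrakk> \<Longrightarrow>
        (a \<otimes>\<^bsub>R\<^esub> b) \<odot>\<^bsub>M\<^esub> x = a \<odot>\<^bsub>M\<^esub> (b \<odot>\<^bsub>M\<^esub> x)"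
    and smult_one: "x \<in> carrier M \<Longrightarrow> \<one>\<^bsub>R\<^esub> \<odot>\<^bsub>M\<^esub> x = x"

definition fin_gen_module :: "('r, 'n) ring_scheme \<Rightarrow> ('r, 'm, 'x) module_scheme \<Rightarrow> bool" where
  "fin_gen_module R M \<longleftrightarrow>
     (\<exists>S. finite S \<and> S \<subseteq> carrier M \<and>
        (\<forall>x\<in>carrier M. \<exists>c\<in>S \<rightarrow> carrier R. x = (\<Oplus>\<^bsub>M\<^esub>s\<in>S. c s \<odot>\<^bsub>M\<^esub> s)))"

definition short_exact ::
  "('r, 'n) ring_scheme \<Rightarrow> ('r, 'm1) module \<Rightarrow> ('r, 'm2) module \<Rightarrow> ('r, 'm3) module \<Rightarrow> bool" where
  "short_exact R M' M M'' \<longleftrightarrow>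
     (\<exists>i\<in>module_hom R M' M. \<exists>p\<in>module_hom R M M''.
        inj_on i (carrier M') \<and>
        i ` carrier M' = {m \<in> carrier M. p m = \<zero>\<^bsub>M''\<^esub>} \<and>
        p ` carrier M = carrier M'')"


section \<open>The Grothendieck group of finitely generated modules\<close>

text \<open>Underlying sets of modules are taken to be subsets of \<^typ>\<open>nat\<close>. For a countable ring this
  loses nothing: a finitely generated module over it is countable, hence isomorphic to such a
  module (see \<open>fin_gen_module_nat_copy\<close> below). Isomorphic modules (in particular, module records
  that differ only outside the carrier) have equal classes, by the relation for
  \<open>0 \<rightarrow> 0 \<rightarrow> M \<rightarrow> N \<rightarrow> 0\<close>.\<close>

definition fg_modules :: "('r, 'n) ring_scheme \<Rightarrow> ('r, nat) module set" where
  "fg_modules R = {M. left_module R M \<and> fin_gen_module R M}"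

lemma fin_gen_module_nat_copy:
  fixes R :: "('r, 'n) ring_scheme" and M :: "('r, 'm) module"
  assumes M: "left_module R M" "fin_gen_module R M" and R: "countable (carrier R)"
  shows "\<exists>N\<in>fg_modules R. \<exists>f\<in>module_hom R M N. bij_betw f (carrier M) (carrier N)"
proof -
  interpret M: left_module R M by fact
  obtain S where S: "finite S" "S \<subseteq> carrier M"
    "\<And>x. x \<in> carrier M \<Longrightarrow> \<exists>c\<in>S \<rightarrow> carrier R. x = (\<Oplus>\<^bsub>M\<^esub>s\<in>S. c s \<odot>\<^bsub>M\<^esub> s)"
    using M(2) unfolding fin_gen_module_def by metis
  have "countable (carrier M)"
  proof (rule countable_subset)
    show "carrier M \<subseteq> (\<lambda>c. \<Oplus>\<^bsub>M\<^esub>s\<in>S. c s \<odot>\<^bsub>M\<^esub> s) ` (S \<rightarrow>\<^sub>E carrier R)"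
    proof
      fix x assume "x \<in> carrier M"
      then obtain c where c: "c \<in> S \<rightarrow> carrier R" "x = (\<Oplus>\<^bsub>M\<^esub>s\<in>S. c s \<odot>\<^bsub>M\<^esub> s)" using S(3) by blast
      have "(\<Oplus>\<^bsub>M\<^esub>s\<in>S. restrict c S s \<odot>\<^bsub>M\<^esub> s) = (\<Oplus>\<^bsub>M\<^esub>s\<in>S. c s \<odot>\<^bsub>M\<^esub> s)"
        using c(1) S(2) by (intro M.M.finsum_cong') (auto intro!: M.smult_closed)
      with c show "x \<in> (\<lambda>c. \<Oplus>\<^bsub>M\<^esub>s\<in>S. c s \<odot>\<^bsub>M\<^esub> s) ` (S \<rightarrow>\<^sub>E carrier R)"
        by (intro image_eqI[where x = "restrict c S"]) auto
    qed
    show "countable ((\<lambda>c. \<Oplus>\<^bsub>M\<^esub>s\<in>S. c s \<odot>\<^bsub>M\<^esub> s) ` (S \<rightarrow>\<^sub>E carrier R))"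
      using S(1) R by (intro countable_image) (induction S rule: finite_induct, auto simp: PiE_insert_eq)
  qed
  then obtain f :: "'m \<Rightarrow> nat" where f: "inj_on f (carrier M)"
    unfolding countable_def by blast
  define g where "g = inv_into (carrier M) f"
  have gf [simp]: "g (f x) = x" if "x \<in> carrier M" for x
    using f that by (simp add: g_def)
  define N :: "('r, nat) module" where
    "N = \<lparr>carrier = f ` carrier M, mult = undefined, one = undefined, zero = f \<zero>\<^bsub>M\<^esub>,
          add = (\<lambda>x y. f (g x \<oplus>\<^bsub>M\<^esub> g y)), smult = (\<lambda>r x. f (r \<odot>\<^bsub>M\<^esub> g x))\<rparr>"
  have ab: "abelian_group N"
  proof (rule abelian_groupI)
    fix x assume "x \<in> carrier N"
    then obtain a where a: "a \<in> carrier M" "x = f a" by (auto simp: N_def)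
    then show "\<exists>y\<in>carrier N. y \<oplus>\<^bsub>N\<^esub> x = \<zero>\<^bsub>N\<^esub>"
      by (auto simp: N_def M.M.l_neg intro!: bexI[where x = "\<ominus>\<^bsub>M\<^esub> a"])
  qed (auto simp: N_def M.M.a_ac)
  have N: "left_module R N"
    by (intro left_module.intro left_module_axioms.intro M.R.ring_axioms ab)
      (auto simp: N_def M.smult_closed M.smult_l_distr M.smult_r_distr M.smult_assoc1 M.smult_one)
  interpret N: left_module R N by fact
  have hom: "f \<in> module_hom R M N"
    by (auto simp: module_hom_def N_def)
  have sum: "f (\<Oplus>\<^bsub>M\<^esub>s\<in>T. c s \<odot>\<^bsub>M\<^esub> s) = (\<Oplus>\<^bsub>N\<^esub>x\<in>f ` T. c (g x) \<odot>\<^bsub>N\<^esub> x)"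
    if T: "T \<subseteq> S" and c: "c \<in> S \<rightarrow> carrier R" for T c
  proof -
    have "finite T" using T S(1) finite_subset by blast
    then show ?thesis using T
    proof (induction T)
      case empty
      have "\<zero>\<^bsub>N\<^esub> = f \<zero>\<^bsub>M\<^esub>" by (simp add: N_def)
      then show ?case by simp
    next
      case (insert t T)
      have mem: "t \<in> carrier M" "T \<subseteq> carrier M" "c t \<in> carrier R" "\<And>s. s \<in> T \<Longrightarrow> c s \<in> carrier R"
        using insert.prems S(2) c by auto
      have nt: "f t \<notin> f ` T"
        using insert.hyps mem f by (auto simp: inj_on_def)
      have NC: "carrier N = f ` carrier M" by (simp add: N_def)
      have cl: "(\<lambda>x. c (g x) \<odot>\<^bsub>N\<^esub> x) \<in> f ` T \<rightarrow> carrier N" "c (g (f t)) \<odot>\<^bsub>N\<^esub> f t \<in> carrier N"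
        using mem by (auto intro!: N.smult_closed simp: subset_iff) (auto simp: NC)
      have clM: "(\<lambda>s. c s \<odot>\<^bsub>M\<^esub> s) \<in> T \<rightarrow> carrier M" "c t \<odot>\<^bsub>M\<^esub> t \<in> carrier M"
        using mem by (auto intro!: M.smult_closed)
      have "f (\<Oplus>\<^bsub>M\<^esub>s\<in>insert t T. c s \<odot>\<^bsub>M\<^esub> s)
          = f (c t \<odot>\<^bsub>M\<^esub> t \<oplus>\<^bsub>M\<^esub> (\<Oplus>\<^bsub>M\<^esub>s\<in>T. c s \<odot>\<^bsub>M\<^esub> s))"
        using insert.hyps clM by (subst M.M.finsum_insert) auto
      also have "\<dots> = f (c t \<odot>\<^bsub>M\<^esub> t) \<oplus>\<^bsub>N\<^esub> f (\<Oplus>\<^bsub>M\<^esub>s\<in>T. c s \<odot>\<^bsub>M\<^esub> s)"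
        using hom clM M.M.finsum_closed[OF clM(1)] by (auto simp: module_hom_def)
      also have "f (c t \<odot>\<^bsub>M\<^esub> t) = c (g (f t)) \<odot>\<^bsub>N\<^esub> f t"
        using mem by (simp add: N_def)
      also have "f (\<Oplus>\<^bsub>M\<^esub>s\<in>T. c s \<odot>\<^bsub>M\<^esub> s) = (\<Oplus>\<^bsub>N\<^esub>x\<in>f ` T. c (g x) \<odot>\<^bsub>N\<^esub> x)"
        using insert by simp
      finally show ?case
        using insert.hyps nt cl by (simp add: N.M.finsum_insert)
    qed
  qed
  have "fin_gen_module R N"
    unfolding fin_gen_module_def
  proof (intro exI[where x = "f ` S"] conjI ballI)
    fix x assume "x \<in> carrier N"
    then obtain a where a: "a \<in> carrier M" "x = f a" by (auto simp: N_def)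
    then obtain c where c: "c \<in> S \<rightarrow> carrier R" "a = (\<Oplus>\<^bsub>M\<^esub>s\<in>S. c s \<odot>\<^bsub>M\<^esub> s)" using S(3) by blast
    show "\<exists>c\<in>f ` S \<rightarrow> carrier R. x = (\<Oplus>\<^bsub>N\<^esub>s\<in>f ` S. c s \<odot>\<^bsub>N\<^esub> s)"
      using a c sum[OF order_refl c(1)] S(2) by (intro bexI[where x = "\<lambda>x. c (g x)"]) (auto simp: subset_iff)
  qed (use S in \<open>auto simp: N_def\<close>)
  moreover have "bij_betw f (carrier M) (carrier N)"
    using f by (simp add: bij_betw_def N_def)
  ultimately show ?thesis
    using N hom unfolding fg_modules_def by blast
qed

definition G_relations :: "('r, 'n) ring_scheme \<Rightarrow> (('r, nat) module \<Rightarrow>\<^sub>0 int) set" where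
  "G_relations R =
     generate (free_Abelian_group (fg_modules R))
       {frag_of M - frag_of M' - frag_of M'' | M' M M''.
          M' \<in> fg_modules R \<and> M \<in> fg_modules R \<and> M'' \<in> fg_modules R \<and> short_exact R M' M M''}"

definition G_group :: "('r, 'n) ring_scheme \<Rightarrow> (('r, nat) module \<Rightarrow>\<^sub>0 int) set monoid" where
  "G_group R = free_Abelian_group (fg_modules R) Mod G_relations R"

definition restrict_scalars :: "('r \<Rightarrow> 'r) \<Rightarrow> ('r, 'm) module \<Rightarrow> ('r, 'm) module" where
  "restrict_scalars \<phi> M = M\<lparr>smult := (\<lambda>r m. \<phi> r \<odot>\<^bsub>M\<^esub> m)\<rparr>"

text \<open>For a ring homomorphism \<open>\<phi> : R \<rightarrow> S\<close> making \<open>S\<close> a finitely generated \<open>R\<close>-module, the map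
  \<open>G(S) \<rightarrow> G(R)\<close>, \<open>[M] \<mapsto> [\<phi>\<^sup>*M]\<close>. An element \<open>X\<close> of \<open>G(S)\<close> is a coset of the relation subgroup;
  it is sent to the coset of \<open>G_relations R\<close> containing the image of \<open>X\<close> under the additive
  extension of \<open>M \<mapsto> \<phi>\<^sup>*M\<close>.\<close>

definition G_restrict ::
  "('r, 'n) ring_scheme \<Rightarrow> ('r \<Rightarrow> 'r) \<Rightarrow> (('r, nat) module \<Rightarrow>\<^sub>0 int) set \<Rightarrow>
     (('r, nat) module \<Rightarrow>\<^sub>0 int) set" where
  "G_restrict R \<phi> X =
     G_relations R <#>\<^bsub>free_Abelian_group (fg_modules R)\<^esub>
       (frag_extend (\<lambda>M. frag_of (restrict_scalars \<phi> M)) ` X)"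


section \<open>Integral group rings\<close>

definition group_ring :: "('a, 'b) monoid_scheme \<Rightarrow> ('a \<Rightarrow>\<^sub>0 int) ring" where
  "group_ring G =
     \<lparr>carrier = carrier (free_Abelian_group (carrier G)),
      mult = (\<lambda>f g. frag_extend (\<lambda>x. frag_extend (\<lambda>y. frag_of (x \<otimes>\<^bsub>G\<^esub> y)) g) f),
      one = frag_of \<one>\<^bsub>G\<^esub>, zero = 0, add = (+)\<rparr>"

abbreviation sub_group_ring :: "('a, 'b) monoid_scheme \<Rightarrow> 'a set \<Rightarrow> ('a \<Rightarrow>\<^sub>0 int) ring" where
  "sub_group_ring \<Gamma> H \<equiv> group_ring (\<Gamma>\<lparr>carrier := H\<rparr>)"

text \<open>The map \<open>c\<^sup>* : G(\<int>[K]) \<rightarrow> G(\<int>[H])\<close> induced by a homomorphism \<open>c : H \<rightarrow> K\<close> between finite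
  subgroups of \<open>\<Gamma>\<close>; restriction is the case where \<open>c\<close> is an inclusion.\<close>

definition G_pullback ::
  "('a, 'b) monoid_scheme \<Rightarrow> 'a set \<Rightarrow> ('a \<Rightarrow> 'a) \<Rightarrow>
     (('a \<Rightarrow>\<^sub>0 int, nat) module \<Rightarrow>\<^sub>0 int) set \<Rightarrow> (('a \<Rightarrow>\<^sub>0 int, nat) module \<Rightarrow>\<^sub>0 int) set" where
  "G_pullback \<Gamma> H c = G_restrict (sub_group_ring \<Gamma> H) (frag_extend (\<lambda>h. frag_of (c h)))"

definition conj_by :: "('a, 'b) monoid_scheme \<Rightarrow> 'a \<Rightarrow> 'a \<Rightarrow> 'a" where
  "conj_by \<Gamma> \<gamma> h = \<gamma> \<otimes>\<^bsub>\<Gamma>\<^esub> h \<otimes>\<^bsub>\<Gamma>\<^esub> inv\<^bsub>\<Gamma>\<^esub> \<gamma>"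

definition conj_class :: "('a, 'b) monoid_scheme \<Rightarrow> 'a set \<Rightarrow> 'a set set" where
  "conj_class \<Gamma> H = {conj_by \<Gamma> \<gamma> ` H | \<gamma>. \<gamma> \<in> carrier \<Gamma>}"

definition finite_subgroups :: "('a, 'b) monoid_scheme \<Rightarrow> 'a set set" where
  "finite_subgroups \<Gamma> = {H. subgroup H \<Gamma> \<and> finite H}"

definition subgroup_family :: "('a, 'b) monoid_scheme \<Rightarrow> 'a set set \<Rightarrow> bool" where
  "subgroup_family \<Gamma> \<F> \<longleftrightarrow>
     \<F> \<noteq> {} \<and> \<F> \<subseteq> finite_subgroups \<Gamma> \<and>
     (\<forall>H\<in>\<F>. \<forall>\<gamma>\<in>carrier \<Gamma>. conj_by \<Gamma> \<gamma> ` H \<in> \<F>) \<and>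
     (\<forall>H\<in>\<F>. \<forall>L. subgroup L \<Gamma> \<and> L \<subseteq> H \<longrightarrow> L \<in> \<F>)"

definition G_family ::
  "('a, 'b) monoid_scheme \<Rightarrow> 'a set set \<Rightarrow>
     ('a set \<Rightarrow> (('a \<Rightarrow>\<^sub>0 int, nat) module \<Rightarrow>\<^sub>0 int) set) monoid" where
  "G_family \<Gamma> \<F> =
     (let P = product_group \<F> (\<lambda>H. G_group (sub_group_ring \<Gamma> H)) in
      P\<lparr>carrier := {x \<in> carrier P.
        (\<forall>H\<in>\<F>. \<forall>K\<in>\<F>. H \<subseteq> K \<longrightarrow> G_pullback \<Gamma> H (\<lambda>h. h) (x K) = x H) \<and>
        (\<forall>H\<in>\<F>. \<forall>K\<in>\<F>. \<forall>\<gamma>\<in>carrier \<Gamma>. K = conj_by \<Gamma> \<gamma> ` H \<longrightarrow>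
            G_pullback \<Gamma> H (conj_by \<Gamma> \<gamma>) (x K) = x H)}\<rparr>)"

definition num_cyclic_classes :: "'a monoid \<Rightarrow> 'a set set \<Rightarrow> nat" where
  "num_cyclic_classes \<Gamma> \<F> = card (conj_class \<Gamma> ` {C \<in> \<F>. cyclic_group (\<Gamma>\<lparr>carrier := C\<rparr>)})"


section \<open>Rationalization and dimension\<close>

text \<open>\<open>A \<otimes>\<^sub>\<int> \<rat>\<close> for an abelian group \<open>A\<close> written multiplicatively: the free abelian group on
  \<open>A \<times> \<rat>\<close> modulo biadditivity, where \<open>r \<cdot> (a \<otimes> q) = a \<otimes> r q\<close>.\<close>

definition tensor_rat_relations :: "('a, 'b) monoid_scheme \<Rightarrow> ('a \<times> rat \<Rightarrow>\<^sub>0 int) set" where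
  "tensor_rat_relations A =
     generate (free_Abelian_group (carrier A \<times> UNIV))
       ({frag_of (a \<otimes>\<^bsub>A\<^esub> b, q) - frag_of (a, q) - frag_of (b, q) | a b q.
           a \<in> carrier A \<and> b \<in> carrier A} \<union>
        {frag_of (a, p + q) - frag_of (a, p) - frag_of (a, q) | a p q. a \<in> carrier A})"

definition tensor_rat :: "('a, 'b) monoid_scheme \<Rightarrow> (rat, ('a \<times> rat \<Rightarrow>\<^sub>0 int) set) module" where
  "tensor_rat A =
     (let F = free_Abelian_group (carrier A \<times> UNIV); N = tensor_rat_relations A in
      \<lparr>carrier = rcosets\<^bsub>F\<^esub> N, mult = undefined, one = undefined,
       zero = N, add = (<#>\<^bsub>F\<^esub>),
       smult = (\<lambda>r X. N <#>\<^bsub>F\<^esub> (frag_extend (\<lambda>(a, q). frag_of (a, r * q)) ` X))\<rparr>)"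

text \<open>The library's \<open>vectorspace.dim\<close> is meaningful only in the finite-dimensional case.\<close>

definition ext_dim :: "('k, 'n) ring_scheme \<Rightarrow> ('k, 'v, 'x) module_scheme \<Rightarrow> enat" where
  "ext_dim K V = (if vectorspace.fin_dim K V then enat (vectorspace.dim K V) else \<infinity>)"

end

theory Submission
  imports Defs
begin

text \<open>
  For a cyclic \<open>C\<close> in \<open>\<F>\<close> there is an element of the Burnside ring of each \<open>H\<close> in \<open>\<F>\<close> whose number
  of fixed points under a subgroup \<open>E\<close> of \<open>H\<close> is a fixed positive integer if \<open>E\<close> is conjugate to \<open>C\<close> in
  \<open>\<Gamma>\<close> and \<open>0\<close> otherwise; the integer can be chosen independently of \<open>H\<close> because the orders of the
  members of \<open>\<F>\<close> are bounded. Fixed points determine classes of permutation modules and are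
  compatible with restriction and conjugation, so these elements give an element \<open>x\<^sup>C\<close> of the inverse limit. The
  function \<open>M \<mapsto> dim Hom\<^sub>E(M, \<rat>)\<close> is additive on \<open>G(\<int>[E])\<close> because \<open>\<rat>\<close> is injective and
  \<open>|E|\<close> is invertible in it, and it takes the value \<open>1\<close> on each \<open>\<int>[E/D]\<close>. Hence its value at the component
  \<open>x\<^sup>C\<^sub>E\<close> is a positive multiple of the number of \<open>e \<in> E\<close> such that \<open>e\<close> generates a
  conjugate of \<open>C\<close>. This is a triangular matrix when the cyclic subgroups are ordered by their order.
\<close>

section \<open>Rational functionals on free abelian groups\<close>

text \<open>The obstacle is to give elements of all the groups G(Z[H]) that agree under every
  inclusion and conjugation at once. Prescribing marks by one function t, constant on
  \<Gamma>-conjugacy classes of subgroups, settles this. To realise t without tables of marks,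
  solve: sum of u(D) over D containing E equals t(E), by Moebius inversion in the subgroup lattice
  of a finite group G. Since |D| times the number of E-fixed points of G/D counts the g with E^g
  inside D (E^g the conjugate of E by the inverse of g), the combination of all |D| u(D) [G/D] has
  mark sum_g t(E^g) = |G| t(E) at E. Scaling by N/|G|, with N a common multiple of all orders, makes
  the mark N t(E), which no longer depends on G. A second factor N is spent on writing a G-set as
  |G| [X] = sum over points x of |G_x| [G/G_x], which needs no orbit representatives. The same u
  governs the pairing: sum_D |D| u(D) = sum_g t(<g>), so a functional with value 1 on every Z[G/D]
  sees t on cyclic subgroups only. This is why the bound counts cyclic classes.\<close>

definition rat_extend :: "('b \<Rightarrow> rat) \<Rightarrow> ('b \<Rightarrow>\<^sub>0 int) \<Rightarrow> rat" where
  "rat_extend g u = (\<Sum>k\<in>Poly_Mapping.keys u. of_int (Poly_Mapping.lookup u k) * g k)"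

lemma rat_extend_superset:
  assumes "finite K" "Poly_Mapping.keys u \<subseteq> K"
  shows "rat_extend g u = (\<Sum>k\<in>K. of_int (Poly_Mapping.lookup u k) * g k)"
  unfolding rat_extend_def using assms
  by (intro sum.mono_neutral_left) (auto simp: in_keys_iff)

lemma rat_extend_0 [simp]: "rat_extend g 0 = 0"
  by (simp add: rat_extend_def)

lemma rat_extend_of [simp]: "rat_extend g (frag_of x) = g x"
  by (simp add: rat_extend_def)

lemma rat_extend_add: "rat_extend g (u + v) = rat_extend g u + rat_extend g v"
proof -
  let ?K = "Poly_Mapping.keys u \<union> Poly_Mapping.keys v"
  have "Poly_Mapping.keys (u + v) \<subseteq> ?K" by (rule keys_add)
  then show ?thesis
    by (simp add: rat_extend_superset[of ?K] lookup_add sum.distrib distrib_right)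
qed

lemma rat_extend_cmul: "rat_extend g (frag_cmul c u) = of_int c * rat_extend g u"
proof -
  have "Poly_Mapping.keys (frag_cmul c u) \<subseteq> Poly_Mapping.keys u" by (rule keys_cmul)
  then show ?thesis
    by (simp add: rat_extend_superset[of "Poly_Mapping.keys u"] sum_distrib_left mult.assoc)
qed

lemma rat_extend_minus: "rat_extend g (- u) = - rat_extend g u"
  using rat_extend_cmul[of g "-1" u] by simp

lemma rat_extend_diff: "rat_extend g (u - v) = rat_extend g u - rat_extend g v"
  using rat_extend_add[of g u "- v"] by (simp add: rat_extend_minus)

lemma rat_extend_sum: "rat_extend g (\<Sum>i\<in>I. f i) = (\<Sum>i\<in>I. rat_extend g (f i))"
  by (induction I rule: infinite_finite_induct) (auto simp: rat_extend_add)

lemma rat_extend_frag_extend: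
  "rat_extend g (frag_extend f u) = rat_extend (\<lambda>k. rat_extend g (f k)) u"
  by (simp add: frag_extend_def rat_extend_sum rat_extend_cmul) (simp add: rat_extend_def)

lemma rat_extend_cmult: "rat_extend (\<lambda>k. c * g k) u = c * rat_extend g u"
  by (simp add: rat_extend_def sum_distrib_left mult.left_commute)

text \<open>Differences absorb the remaining cases of \<open>generate\<close>: an inverse is
  \<open>0 - h\<close> and a sum is \<open>a - (0 - b)\<close>. The inclusion of \<open>Q\<close> in
  the carrier is what turns the group inverse of a generator into its negative.\<close>

lemma generate_free_Abelian_group_induct [consumes 2, case_names zero incl diff]:
  assumes "x \<in> generate (free_Abelian_group S) Q" "Q \<subseteq> carrier (free_Abelian_group S)"
    and "P 0" "\<And>q. q \<in> Q \<Longrightarrow> P q" "\<And>a b. P a \<Longrightarrow> P b \<Longrightarrow> P (a - b)"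
  shows "P x"
  using assms(1)
proof induction
  case one
  then show ?case using assms(3) by simp
next
  case (incl h)
  then show ?case by (rule assms(4))
next
  case (inv h)
  then have "Poly_Mapping.keys h \<subseteq> S" using subsetD[OF assms(2) inv] by simp
  then have "inv\<^bsub>free_Abelian_group S\<^esub> h = 0 - h" by simp
  then show ?case using assms(5)[OF assms(3) assms(4)[OF inv]] by (simp only:)
next
  case (eng a b)
  have "P (a - (0 - b))" by (intro assms(5) assms(3) eng.IH)
  then show ?case by simp
qed

section \<open>Cosets of a subgroup of a free abelian group\<close>

locale frag_subgroup =
  fixes S :: "'a set" and N :: "('a \<Rightarrow>\<^sub>0 int) set"
  assumes subgroup: "subgroup N (free_Abelian_group S)"
begin

lemma mem_keys: "n \<in> N \<Longrightarrow> Poly_Mapping.keys n \<subseteq> S"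
  using subsetD[OF subgroup.subset[OF subgroup], of n] by simp

lemma zero_mem [simp]: "0 \<in> N"
  using subgroup.one_closed[OF subgroup] by simp

lemma add_mem: "a \<in> N \<Longrightarrow> b \<in> N \<Longrightarrow> a + b \<in> N"
  using subgroup.m_closed[OF subgroup] by simp

lemma minus_mem: "a \<in> N \<Longrightarrow> - a \<in> N"
  using subgroup.m_inv_closed[OF subgroup, of a] mem_keys[of a] by simp

lemma diff_mem: "a \<in> N \<Longrightarrow> b \<in> N \<Longrightarrow> a - b \<in> N"
  using add_mem[of a "- b"] minus_mem by simp

lemma cmul_mem: "a \<in> N \<Longrightarrow> frag_cmul c a \<in> N"
  by (rule frag_closure_minus_cmul) (auto intro: diff_mem)

lemma sum_mem: "(\<And>i. i \<in> I \<Longrightarrow> f i \<in> N) \<Longrightarrow> (\<Sum>i\<in>I. f i) \<in> N"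
  by (induction I rule: infinite_finite_induct) (auto intro: add_mem)

lemma coset_eq: "N #>\<^bsub>free_Abelian_group S\<^esub> u = {n + u | n. n \<in> N}"
  by (auto simp: r_coset_def)

lemma mem_coset_iff: "x \<in> N #>\<^bsub>free_Abelian_group S\<^esub> u \<longleftrightarrow> x - u \<in> N"
  by (auto simp: coset_eq intro!: exI[of _ "x - u"])

lemma coset_eq_iff:
  "N #>\<^bsub>free_Abelian_group S\<^esub> u = N #>\<^bsub>free_Abelian_group S\<^esub> v \<longleftrightarrow> u - v \<in> N"
proof
  assume "N #>\<^bsub>free_Abelian_group S\<^esub> u = N #>\<^bsub>free_Abelian_group S\<^esub> v"
  then show "u - v \<in> N"
    using mem_coset_iff[of u u] mem_coset_iff[of u v] by simp
next
  assume uv: "u - v \<in> N"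
  show "N #>\<^bsub>free_Abelian_group S\<^esub> u = N #>\<^bsub>free_Abelian_group S\<^esub> v"
  proof (intro Set.set_eqI)
    fix x
    have "x - u \<in> N \<longleftrightarrow> x - v \<in> N"
      using add_mem[OF _ uv, of "x - u"] diff_mem[OF _ uv, of "x - v"] by auto
    then show "x \<in> N #>\<^bsub>free_Abelian_group S\<^esub> u \<longleftrightarrow> x \<in> N #>\<^bsub>free_Abelian_group S\<^esub> v"
      by (simp add: mem_coset_iff)
  qed
qed

lemma coset_mult:
  "(N #>\<^bsub>free_Abelian_group S\<^esub> u) <#>\<^bsub>free_Abelian_group S\<^esub> (N #>\<^bsub>free_Abelian_group S\<^esub> v)
     = N #>\<^bsub>free_Abelian_group S\<^esub> (u + v)"
proof (intro Set.set_eqI iffI)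
  fix x assume "x \<in> (N #>\<^bsub>free_Abelian_group S\<^esub> u) <#>\<^bsub>free_Abelian_group S\<^esub> (N #>\<^bsub>free_Abelian_group S\<^esub> v)"
  then obtain a b where ab: "a - u \<in> N" "b - v \<in> N" "x = a + b"
    by (auto simp: set_mult_def mem_coset_iff)
  show "x \<in> N #>\<^bsub>free_Abelian_group S\<^esub> (u + v)"
    using add_mem[OF ab(1,2)] ab(3) by (simp add: mem_coset_iff algebra_simps)
next
  fix x assume "x \<in> N #>\<^bsub>free_Abelian_group S\<^esub> (u + v)"
  then have "x - v \<in> N #>\<^bsub>free_Abelian_group S\<^esub> u" "v \<in> N #>\<^bsub>free_Abelian_group S\<^esub> v"
    by (simp_all add: mem_coset_iff algebra_simps)
  then show "x \<in> (N #>\<^bsub>free_Abelian_group S\<^esub> u) <#>\<^bsub>free_Abelian_group S\<^esub> (N #>\<^bsub>free_Abelian_group S\<^esub> v)"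
    unfolding set_mult_def by (force intro: bexI[of _ "x - v"] bexI[of _ v])
qed

lemma coset_zero: "N #>\<^bsub>free_Abelian_group S\<^esub> 0 = N"
  by (auto simp: coset_eq)

text \<open>The image of a coset under an additive map is in general only part of a coset, and
  multiplying by \<open>N\<close> fills it up. Both \<open>G_restrict\<close> and the scalar
  multiplication of \<open>tensor_rat\<close> have this shape, so this one computation evaluates
  them on representatives.\<close>

lemma image_coset:
  assumes "\<And>a b. \<phi> (a + b) = \<phi> a + \<phi> b" "\<And>m. m \<in> M \<Longrightarrow> \<phi> m \<in> N" "0 \<in> M" "\<phi> 0 = 0"
  shows "N <#>\<^bsub>free_Abelian_group S\<^esub> (\<phi> ` (M #>\<^bsub>free_Abelian_group T\<^esub> u)) = N #>\<^bsub>free_Abelian_group S\<^esub> \<phi> u"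
proof (intro Set.set_eqI iffI)
  fix x assume "x \<in> N <#>\<^bsub>free_Abelian_group S\<^esub> (\<phi> ` (M #>\<^bsub>free_Abelian_group T\<^esub> u))"
  then obtain n m where nm: "n \<in> N" "m \<in> M" "x = n + \<phi> (m + u)"
    by (auto simp: set_mult_def r_coset_def)
  show "x \<in> N #>\<^bsub>free_Abelian_group S\<^esub> \<phi> u"
    using add_mem[OF nm(1) assms(2)[OF nm(2)]] by (simp add: mem_coset_iff nm(3) assms(1) algebra_simps)
next
  fix x assume "x \<in> N #>\<^bsub>free_Abelian_group S\<^esub> \<phi> u"
  then have "x - \<phi> u \<in> N" by (simp add: mem_coset_iff)
  moreover have "u \<in> M #>\<^bsub>free_Abelian_group T\<^esub> u" using assms(3) by (force simp: r_coset_def)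
  ultimately show "x \<in> N <#>\<^bsub>free_Abelian_group S\<^esub> (\<phi> ` (M #>\<^bsub>free_Abelian_group T\<^esub> u))"
    unfolding set_mult_def by (force intro: bexI[of _ "x - \<phi> u"])
qed

end

lemma frag_subgroup_generate:
  assumes "Q \<subseteq> carrier (free_Abelian_group S)"
  shows "frag_subgroup S (generate (free_Abelian_group S) Q)"
  by (intro frag_subgroup.intro group.generate_is_subgroup[OF group_free_Abelian_group assms])


section \<open>A lower bound for the dimension of a rationalization\<close>

text \<open>Closure under multiplication is what places the biadditivity relations inside the free
  group on pairs, so that they generate a subgroup of it.\<close>

locale tensor_rat_space =
  fixes A :: "('a, 'b) monoid_scheme" (structure)
  assumes A_closed: "x \<in> carrier A \<Longrightarrow> y \<in> carrier A \<Longrightarrow> x \<otimes> y \<in> carrier A"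
begin

abbreviation "F \<equiv> free_Abelian_group (carrier A \<times> (UNIV :: rat set))"
abbreviation "N \<equiv> tensor_rat_relations A"

definition scale :: "rat \<Rightarrow> ('a \<times> rat \<Rightarrow>\<^sub>0 int) \<Rightarrow> ('a \<times> rat \<Rightarrow>\<^sub>0 int)" where
  "scale r = frag_extend (\<lambda>(a, q). frag_of (a, r * q))"

lemma relations_carrier:
  "{frag_of (a \<otimes> b, q) - frag_of (a, q) - frag_of (b, q) | a b q.
       a \<in> carrier A \<and> b \<in> carrier A} \<union>
   {frag_of (a, p + q) - frag_of (a, p) - frag_of (a, q) | a p q. a \<in> carrier A} \<subseteq> carrier F"
  by (auto simp: A_closed dest!: subsetD[OF keys_diff])

sublocale N: frag_subgroup "carrier A \<times> UNIV" N
  unfolding tensor_rat_relations_def by (rule frag_subgroup_generate[OF relations_carrier])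

lemma relation_add: "a \<in> carrier A \<Longrightarrow> frag_of (a, p + q) - frag_of (a, p) - frag_of (a, q) \<in> N"
  unfolding tensor_rat_relations_def by (intro generate.incl) blast

lemma scale_add: "scale r (u + v) = scale r u + scale r v"
  by (simp add: scale_def frag_extend_add)

lemma scale_relations:
  assumes "n \<in> N" shows "scale r n \<in> N"
  using assms relations_carrier unfolding tensor_rat_relations_def
proof (induction rule: generate_free_Abelian_group_induct)
  case (incl u)
  have "frag_of (a \<otimes> b, r * q) - frag_of (a, r * q) - frag_of (b, r * q) \<in> N"
    if "a \<in> carrier A" "b \<in> carrier A" for a b q
    using that unfolding tensor_rat_relations_def by (intro generate.incl) blast
  moreover have "frag_of (a, r * (p + q)) - frag_of (a, r * p) - frag_of (a, r * q) \<in> N"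
    if "a \<in> carrier A" for a p q
    using relation_add[OF that] by (simp add: distrib_left)
  ultimately show ?case
    using incl by (auto simp: scale_def frag_extend_diff tensor_rat_relations_def)
next
  case zero
  then show ?case
    using N.zero_mem by (simp add: scale_def tensor_rat_relations_def)
next
  case (diff a b)
  then show ?case
    using N.diff_mem[of "scale r a" "scale r b"]
    by (simp add: scale_def frag_extend_diff tensor_rat_relations_def)
qed

lemma scale_carrier: "u \<in> carrier F \<Longrightarrow> scale r u \<in> carrier F"
  using keys_frag_extend[of "\<lambda>(a, q). frag_of (a, r * q)" u] by (fastforce simp: scale_def)

abbreviation cos where "cos u \<equiv> N #>\<^bsub>F\<^esub> u"

lemma carrier_tensor_rat: "carrier (tensor_rat A) = cos ` carrier F"
  by (auto simp: tensor_rat_def Let_def RCOSETS_def)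

lemma add_tensor_rat: "cos u \<oplus>\<^bsub>tensor_rat A\<^esub> cos v = cos (u + v)"
  by (simp add: tensor_rat_def Let_def N.coset_mult)

lemma zero_tensor_rat: "\<zero>\<^bsub>tensor_rat A\<^esub> = N"
  by (simp add: tensor_rat_def Let_def)

lemma smult_tensor_rat: "r \<odot>\<^bsub>tensor_rat A\<^esub> cos u = cos (scale r u)"
proof -
  have "r \<odot>\<^bsub>tensor_rat A\<^esub> cos u = N <#>\<^bsub>F\<^esub> (scale r ` cos u)"
    by (simp add: tensor_rat_def Let_def scale_def)
  also have "\<dots> = cos (scale r u)"
    by (rule N.image_coset) (auto simp: scale_add scale_relations, simp add: scale_def)
  finally show ?thesis .
qed

text \<open>Distributivity over a sum of scalars is the one module axiom that holds only modulo the
  relations; the other axioms on scalars hold already for representatives.\<close>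

lemma scale_sum_relation:
  "Poly_Mapping.keys u \<subseteq> carrier A \<times> UNIV \<Longrightarrow> scale (r + s) u - scale r u - scale s u \<in> N"
proof (induction u rule: frag_induction)
  case (one x)
  then show ?case
    using relation_add[of "fst x" "r * snd x" "s * snd x"]
    by (cases x) (auto simp: scale_def distrib_right)
next
  case (diff a b)
  have "scale (r + s) (a - b) - scale r (a - b) - scale s (a - b)
     = (scale (r + s) a - scale r a - scale s a) - (scale (r + s) b - scale r b - scale s b)"
    by (simp add: scale_def frag_extend_diff)
  with diff show ?case using N.diff_mem by presburger
qed (simp add: scale_def)

lemma scale_scale: "scale r (scale s u) = scale (r * s) u"
proof -
  have "Poly_Mapping.keys u \<subseteq> UNIV" by simp
  then show ?thesis
    by (induction u rule: frag_induction) (auto simp: scale_def frag_extend_diff mult.assoc)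
qed

lemma scale_one: "scale 1 u = u"
proof -
  have "Poly_Mapping.keys u \<subseteq> UNIV" by simp
  then show ?thesis
    by (induction u rule: frag_induction) (auto simp: scale_def frag_extend_diff)
qed

lemma vectorspace_tensor_rat: "vectorspace (class_ring :: rat ring) (tensor_rat A)"
proof -
  have zero: "\<zero>\<^bsub>tensor_rat A\<^esub> = cos 0"
    by (simp add: zero_tensor_rat N.coset_zero)
  have cos: "cos u \<in> carrier (tensor_rat A)" if "Poly_Mapping.keys u \<subseteq> carrier A \<times> UNIV" for u
    using that by (auto simp: carrier_tensor_rat)
  have ab: "abelian_group (tensor_rat A)"
  proof (rule abelian_groupI)
    fix x assume "x \<in> carrier (tensor_rat A)"
    then obtain u where "u \<in> carrier F" "x = cos u" by (auto simp: carrier_tensor_rat)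
    then show "\<exists>y\<in>carrier (tensor_rat A). y \<oplus>\<^bsub>tensor_rat A\<^esub> x = \<zero>\<^bsub>tensor_rat A\<^esub>"
      by (intro bexI[where x = "cos (- u)"]) (auto simp: add_tensor_rat zero intro!: cos)
  next
    fix x y assume "x \<in> carrier (tensor_rat A)" "y \<in> carrier (tensor_rat A)"
    then show "x \<oplus>\<^bsub>tensor_rat A\<^esub> y \<in> carrier (tensor_rat A)"
      using keys_add by (fastforce simp: add_tensor_rat carrier_tensor_rat intro!: imageI)
  qed (auto simp: carrier_tensor_rat add_tensor_rat zero ac_simps)
  have "module (class_ring :: rat ring) (tensor_rat A)"
  proof (rule moduleI[OF _ ab])
    show "cring (class_ring :: rat ring)" by (rule class_cring.is_cring)
  next
    fix a and x assume "x \<in> carrier (tensor_rat A)"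
    then show "a \<odot>\<^bsub>tensor_rat A\<^esub> x \<in> carrier (tensor_rat A)"
      using scale_carrier by (auto simp: carrier_tensor_rat smult_tensor_rat)
  next
    fix a b x assume "x \<in> carrier (tensor_rat A)"
    then obtain u where u: "u \<in> carrier F" "x = cos u" by (auto simp: carrier_tensor_rat)
    have "scale (a + b) u - (scale a u + scale b u) \<in> N"
      using scale_sum_relation[of u a b] u by (simp add: algebra_simps)
    then show "(a \<oplus>\<^bsub>class_ring\<^esub> b) \<odot>\<^bsub>tensor_rat A\<^esub> x =
       a \<odot>\<^bsub>tensor_rat A\<^esub> x \<oplus>\<^bsub>tensor_rat A\<^esub> b \<odot>\<^bsub>tensor_rat A\<^esub> x"
      by (simp add: u smult_tensor_rat add_tensor_rat N.coset_eq_iff)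
  next
    fix a x y assume "x \<in> carrier (tensor_rat A)" "y \<in> carrier (tensor_rat A)"
    then show "a \<odot>\<^bsub>tensor_rat A\<^esub> (x \<oplus>\<^bsub>tensor_rat A\<^esub> y) =
       a \<odot>\<^bsub>tensor_rat A\<^esub> x \<oplus>\<^bsub>tensor_rat A\<^esub> a \<odot>\<^bsub>tensor_rat A\<^esub> y"
      by (auto simp: carrier_tensor_rat smult_tensor_rat add_tensor_rat scale_add)
  next
    fix a b x assume "x \<in> carrier (tensor_rat A)"
    then show "(a \<otimes>\<^bsub>class_ring\<^esub> b) \<odot>\<^bsub>tensor_rat A\<^esub> x = a \<odot>\<^bsub>tensor_rat A\<^esub> (b \<odot>\<^bsub>tensor_rat A\<^esub> x)"
      by (auto simp: carrier_tensor_rat smult_tensor_rat scale_scale)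
  next
    fix x assume "x \<in> carrier (tensor_rat A)"
    then show "\<one>\<^bsub>class_ring\<^esub> \<odot>\<^bsub>tensor_rat A\<^esub> x = x"
      by (auto simp: carrier_tensor_rat smult_tensor_rat scale_one)
  qed
  then show ?thesis
    by (intro vectorspace.intro class_field.field_axioms)
qed

text \<open>The linear extension \<open>a \<otimes> q \<mapsto> q \<psi>(a)\<close>, evaluated at any representative of a coset.\<close>

definition linear_extension :: "('a \<Rightarrow> rat) \<Rightarrow> ('a \<times> rat \<Rightarrow>\<^sub>0 int) set \<Rightarrow> rat" where
  "linear_extension \<psi> X = rat_extend (\<lambda>(a, q). q * \<psi> a) (SOME u. u \<in> X)"

context
  fixes \<psi> :: "'a \<Rightarrow> rat"
  assumes \<psi>: "\<And>x y. x \<in> carrier A \<Longrightarrow> y \<in> carrier A \<Longrightarrow> \<psi> (x \<otimes> y) = \<psi> x + \<psi> y"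
begin

lemma rat_extend_tensor_relations:
  assumes "n \<in> N" shows "rat_extend (\<lambda>(a, q). q * \<psi> a) n = 0"
  using assms relations_carrier unfolding tensor_rat_relations_def
proof (induction rule: generate_free_Abelian_group_induct)
  case (incl n)
  then show ?case
    by (elim UnE CollectE exE conjE; hypsubst) (simp_all add: rat_extend_diff rat_extend_add \<psi> algebra_simps)
qed (auto simp: rat_extend_diff)

lemma linear_extension_coset:
  "linear_extension \<psi> (cos u) = rat_extend (\<lambda>(a, q). q * \<psi> a) u"
proof -
  have "u \<in> cos u" using N.zero_mem by (force simp: N.coset_eq)
  then have "(SOME v. v \<in> cos u) \<in> cos u" by (rule someI)
  then obtain n where "n \<in> N" "(SOME v. v \<in> cos u) = n + u"
    by (auto simp: N.coset_eq)
  then show ?thesis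
    by (simp add: linear_extension_def rat_extend_add rat_extend_tensor_relations)
qed

lemma linear_extension_smult:
  "x \<in> carrier (tensor_rat A) \<Longrightarrow> linear_extension \<psi> (r \<odot>\<^bsub>tensor_rat A\<^esub> x) = r * linear_extension \<psi> x"
  by (auto simp: carrier_tensor_rat linear_extension_coset smult_tensor_rat scale_def
      rat_extend_frag_extend case_prod_unfold mult.assoc simp flip: rat_extend_cmult)

lemma linear_extension_finsum:
  assumes "finite J" "\<And>j. j \<in> J \<Longrightarrow> f j \<in> carrier (tensor_rat A)"
  shows "linear_extension \<psi> (\<Oplus>\<^bsub>tensor_rat A\<^esub>j\<in>J. f j) = (\<Sum>j\<in>J. linear_extension \<psi> (f j))"
  using assms
proof (induction J)
  case empty
  interpret V: vectorspace "class_ring :: rat ring" "tensor_rat A" by (rule vectorspace_tensor_rat)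
  show ?case
    using linear_extension_coset[of 0] by (simp add: zero_tensor_rat N.coset_zero)
next
  case (insert j J)
  interpret V: vectorspace "class_ring :: rat ring" "tensor_rat A" by (rule vectorspace_tensor_rat)
  have add: "linear_extension \<psi> (x \<oplus>\<^bsub>tensor_rat A\<^esub> y) = linear_extension \<psi> x + linear_extension \<psi> y"
    if "x \<in> carrier (tensor_rat A)" "y \<in> carrier (tensor_rat A)" for x y
    using that by (auto simp: carrier_tensor_rat linear_extension_coset add_tensor_rat rat_extend_add)
  have "(\<Oplus>\<^bsub>tensor_rat A\<^esub>k\<in>insert j J. f k) = f j \<oplus>\<^bsub>tensor_rat A\<^esub> (\<Oplus>\<^bsub>tensor_rat A\<^esub>k\<in>J. f k)"
    using insert by (intro V.M.finsum_insert) auto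
  moreover have "(\<Oplus>\<^bsub>tensor_rat A\<^esub>k\<in>J. f k) \<in> carrier (tensor_rat A)"
    using insert by (intro V.M.finsum_closed) auto
  ultimately show ?case using insert by (simp add: add)
qed

end

end

text \<open>The tensors of \<open>b i\<close> with 1 are independent because the matrix of the
  values \<open>\<psi> i (b j)\<close> is triangular with nonzero diagonal. Ties in
  \<open>rk\<close> are allowed: distinct indices of equal rank have entry 0 in both directions. In
  infinite dimension \<open>ext_dim\<close> is infinite and the bound is immediate.\<close>

theorem ext_dim_tensor_rat_ge:
  fixes A :: "('a, 'b) monoid_scheme" (structure)
    and b :: "'i \<Rightarrow> 'a" and \<psi> :: "'i \<Rightarrow> 'a \<Rightarrow> rat" and rk :: "'i \<Rightarrow> nat"
  assumes closed: "\<And>x y. x \<in> carrier A \<Longrightarrow> y \<in> carrier A \<Longrightarrow> x \<otimes> y \<in> carrier A"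
    and I: "finite I" and b: "\<And>i. i \<in> I \<Longrightarrow> b i \<in> carrier A"
    and \<psi>: "\<And>i x y. i \<in> I \<Longrightarrow> x \<in> carrier A \<Longrightarrow> y \<in> carrier A \<Longrightarrow> \<psi> i (x \<otimes> y) = \<psi> i x + \<psi> i y"
    and diag: "\<And>i. i \<in> I \<Longrightarrow> \<psi> i (b i) \<noteq> 0"
    and triangular: "\<And>i j. i \<in> I \<Longrightarrow> j \<in> I \<Longrightarrow> i \<noteq> j \<Longrightarrow> rk i \<le> rk j \<Longrightarrow> \<psi> i (b j) = 0"
  shows "ext_dim (class_ring :: rat ring) (tensor_rat A) \<ge> enat (card I)"
proof -
  interpret tensor_rat_space A by unfold_locales (rule closed)
  interpret V: vectorspace "class_ring :: rat ring" "tensor_rat A" by (rule vectorspace_tensor_rat)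
  define e where "e i = cos (frag_of (b i, 1))" for i
  have e: "e i \<in> carrier (tensor_rat A)" if "i \<in> I" for i
    using b that by (auto simp: e_def carrier_tensor_rat)
  have val: "linear_extension (\<psi> i) (e j) = \<psi> i (b j)" if "i \<in> I" "j \<in> I" for i j
    using that by (simp add: e_def linear_extension_coset \<psi>)
  have inj: "inj_on e I"
  proof (rule inj_onI)
    fix i j assume ij: "i \<in> I" "j \<in> I" "e i = e j"
    have "\<psi> k (b i) = \<psi> k (b j)" if "k \<in> I" for k
      using val[of k i] val[of k j] ij that by simp
    \<comment> \<open>Whichever inequality holds, for distinct \<open>i\<close> and \<open>j\<close>
      an off-diagonal entry that vanishes would equal a diagonal entry, since the columns of
      \<open>i\<close> and \<open>j\<close> coincide.\<close>
    moreover have "rk i \<le> rk j \<or> rk j \<le> rk i" by linarith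
    ultimately show "i = j"
      using triangular[of i j] triangular[of j i] diag[of i] diag[of j] ij(1,2) by auto
  qed
  have "V.lin_indpt (e ` I)"
  proof (rule V.finite_lin_indpt2)
    fix a assume a: "V.lincomb a (e ` I) = \<zero>\<^bsub>tensor_rat A\<^esub>"
    have eq: "(\<Sum>j\<in>I. a (e j) * \<psi> i (b j)) = 0" if i: "i \<in> I" for i
    proof -
      have "0 = linear_extension (\<psi> i) (V.lincomb a (e ` I))"
        using \<psi>[OF i] linear_extension_coset[of "\<psi> i" 0] a
        by (simp add: zero_tensor_rat N.coset_zero)
      also have "\<dots> = (\<Sum>v\<in>e ` I. linear_extension (\<psi> i) (a v \<odot>\<^bsub>tensor_rat A\<^esub> v))"
        unfolding V.lincomb_def using e I \<psi>[OF i] by (intro linear_extension_finsum) auto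
      also have "\<dots> = (\<Sum>v\<in>e ` I. a v * linear_extension (\<psi> i) v)"
        using e \<psi>[OF i] linear_extension_smult by (intro sum.cong) auto
      also have "\<dots> = (\<Sum>j\<in>I. a (e j) * linear_extension (\<psi> i) (e j))"
        by (simp add: sum.reindex[OF inj])
      also have "\<dots> = (\<Sum>j\<in>I. a (e j) * \<psi> i (b j))"
        using i by (intro sum.cong) (auto simp: val)
      finally show ?thesis by simp
    qed
    \<comment> \<open>Row \<open>i\<close> of the system, by induction on the rank: coefficients of
      smaller rank are already 0, entries of equal or larger rank vanish off the diagonal, and only
      the diagonal term is left.\<close>
    have "a (e i) = 0" if "i \<in> I" for i
      using that
    proof (induction "rk i" arbitrary: i rule: less_induct)
      case less
      have "(\<Sum>j\<in>I. a (e j) * \<psi> i (b j)) = (\<Sum>j\<in>{i}. a (e j) * \<psi> i (b j))"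
      proof (rule sum.mono_neutral_right)
        show "\<forall>j\<in>I - {i}. a (e j) * \<psi> i (b j) = 0"
        proof
          fix j assume j: "j \<in> I - {i}"
          show "a (e j) * \<psi> i (b j) = 0"
          proof (cases "rk j < rk i")
            case True
            then show ?thesis using less.hyps j by simp
          next
            case False
            then show ?thesis using triangular[of i j] j less.prems by auto
          qed
        qed
      qed (use less I in auto)
      then show ?case using eq[OF less.prems] diag[OF less.prems] by simp
    qed
    then show "\<forall>v\<in>e ` I. a v = \<zero>\<^bsub>class_ring\<^esub>" by simp
  qed (use I e in auto)
  then have "card I \<le> V.dim" if "V.fin_dim"
    using V.li_le_dim(2)[OF that, of "e ` I"] e by (auto simp: card_image[OF inj])
  then show ?thesis by (simp add: ext_dim_def)
qed

section \<open>Extension of rational-valued homomorphisms\<close>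

text \<open>One step of the proof that the divisible group of rationals is injective: choose a value
  \<open>q\<close> for \<open>m\<close> that is consistent with the powers of \<open>m\<close>
  already in \<open>A\<close>, and extend to the subgroup generated by \<open>A\<close> and
  \<open>m\<close>.\<close>

lemma (in comm_group) rat_hom_extend_insert:
  fixes g :: "'a \<Rightarrow> rat"
  assumes A: "subgroup A G" and g: "\<And>a b. a \<in> A \<Longrightarrow> b \<in> A \<Longrightarrow> g (a \<otimes> b) = g a + g b"
    and m: "m \<in> carrier G"
  shows "\<exists>B h. subgroup B G \<and> insert m A \<subseteq> B \<and>
    (\<forall>a\<in>B. \<forall>b\<in>B. h (a \<otimes> b) = h a + h b) \<and> (\<forall>a\<in>A. h a = (g a :: rat))"
proof -
  interpret A: subgroup A G by fact
  have g1: "g \<one> = 0" using g[of \<one> \<one>] by simp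
  have g_inv: "g (inv a) = - g a" if "a \<in> A" for a
    using g[of a "inv a"] that g1 by simp
  have g_pow: "g (a [^] (n :: int)) = of_int n * g a" if a: "a \<in> A" for a n
  proof -
    have mem: "a [^] (k :: nat) \<in> A" for k using a by (induction k) auto
    have nat: "g (a [^] (k :: nat)) = of_nat k * g a" for k
      using a g1 mem by (induction k) (auto simp: g algebra_simps)
    show ?thesis
    proof (cases n)
      case (nonneg k)
      then show ?thesis by (simp add: int_pow_int nat)
    next
      case (neg k)
      then have "a [^] n = inv (a [^] (Suc k))"
        using a by (simp only: int_pow_neg int_pow_int A.mem_carrier)
      then have "g (a [^] n) = - g (a [^] (Suc k))"
        using g_inv[OF mem] by (simp only:)
      then show ?thesis unfolding nat neg by (simp add: algebra_simps)
    qed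
  qed
  text \<open>\<open>q\<close> is forced if a nonzero power of \<open>m\<close> lies in \<open>A\<close>, and arbitrary otherwise.\<close>
  obtain q :: rat where q: "\<And>j :: int. m [^] j \<in> A \<Longrightarrow> g (m [^] j) = of_int j * q"
  proof (cases "\<exists>n :: int. n \<noteq> 0 \<and> m [^] n \<in> A")
    case True
    then obtain n :: int where n: "n \<noteq> 0" "m [^] n \<in> A" by blast
    have "g (m [^] j) = of_int j * (g (m [^] n) / of_int n)" if "m [^] j \<in> A" for j :: int
    proof -
      have "of_int n * g (m [^] j) = g (m [^] (j * n))"
        using g_pow[OF that, of n] m by (simp add: int_pow_pow)
      also have "\<dots> = of_int j * g (m [^] n)"
        using g_pow[OF n(2), of j] m by (simp add: int_pow_pow mult.commute)
      finally show ?thesis using n by (simp add: field_simps)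
    qed
    then show ?thesis by (rule that)
  next
    case False
    then have "g (m [^] j) = of_int j * 0" if "m [^] j \<in> A" for j :: int
      using that g1 by (cases "j = 0") auto
    then show ?thesis by (rule that)
  qed
  define B where "B = {a \<otimes> m [^] (k :: int) | a k. a \<in> A}"
  define h where "h x = (SOME r. \<exists>a k. a \<in> A \<and> x = a \<otimes> m [^] (k :: int) \<and> r = g a + of_int k * q)" for x
  have h: "h (a \<otimes> m [^] k) = g a + of_int k * q" if a: "a \<in> A" for a and k :: int
  proof -
    have "\<exists>r a' k'. a' \<in> A \<and> a \<otimes> m [^] k = a' \<otimes> m [^] (k' :: int) \<and> r = g a' + of_int k' * q"
      using a by blast
    from someI_ex[OF this] obtain a' and k' :: int
      where a': "a' \<in> A" "a \<otimes> m [^] k = a' \<otimes> m [^] k'" "h (a \<otimes> m [^] k) = g a' + of_int k' * q"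
      unfolding h_def by blast
    \<comment> \<open>Two representations of one element differ by a power of \<open>m\<close> that
      lies in \<open>A\<close>. There the defining property of \<open>q\<close> forces equal values,
      so \<open>h\<close> does not depend on the representation picked by
      \<open>SOME\<close>.\<close>
    have "m [^] (k' - k) = inv a' \<otimes> a"
    proof -
      have "a' \<otimes> m [^] (k' - k) = a"
        using a' m a by (simp add: int_pow_diff m_assoc[symmetric]) (simp add: m_assoc flip: a'(2))
      then show ?thesis using a a' m by (metis A.mem_carrier inv_solve_left int_pow_closed)
    qed
    moreover from this have "g (m [^] (k' - k)) = of_int (k' - k) * q"
      using a a' by (intro q) auto
    ultimately have "g a - g a' = of_int (k' - k) * q"
      using a a' by (simp add: g g_inv)
    then show ?thesis using a' by (simp add: algebra_simps)
  qed
  have mul: "(a \<otimes> m [^] k) \<otimes> (b \<otimes> m [^] l) = (a \<otimes> b) \<otimes> m [^] (k + l)"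
    if "a \<in> A" "b \<in> A" for a b and k l :: int
    using that m by (simp add: int_pow_mult m_ac)
  have "subgroup B G"
  proof (rule subgroupI)
    show "B \<subseteq> carrier G" using m by (auto simp: B_def)
    show "B \<noteq> {}" using A.one_closed unfolding B_def by blast
    fix x assume "x \<in> B"
    then obtain a and k :: int where x: "a \<in> A" "x = a \<otimes> m [^] k" by (auto simp: B_def)
    then have "inv x = inv a \<otimes> m [^] (- k)"
      using m by (simp add: inv_mult int_pow_neg)
    then show "inv x \<in> B" using x by (auto simp: B_def)
  next
    fix x y assume "x \<in> B" "y \<in> B"
    then show "x \<otimes> y \<in> B" unfolding B_def using mul by (smt (verit) A.m_closed mem_Collect_eq)
  qed
  moreover have "insert m A \<subseteq> B"
  proof -
    have "m = \<one> \<otimes> m [^] (1 :: int)" and "a = a \<otimes> m [^] (0 :: int)" if "a \<in> A" for a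
      using m that by auto
    then show ?thesis unfolding B_def
      using m A.one_closed by (smt (verit, best) A.subset int_pow_1 insert_subset l_one mem_Collect_eq subsetI)
  qed
  moreover have "\<forall>a\<in>B. \<forall>b\<in>B. h (a \<otimes> b) = h a + h b"
    by (auto simp: B_def mul h g algebra_simps)
  moreover have "\<forall>a\<in>A. h a = g a"
    using h[of _ 0] by auto
  ultimately show ?thesis by blast
qed

text \<open>Adjoining one element at a time takes the place of Zorn's lemma. When \<open>T\<close>
  generates the group, the subgroup \<open>B\<close> is everything.\<close>

lemma (in comm_group) rat_hom_extend:
  fixes g :: "'a \<Rightarrow> rat"
  assumes "finite T" "T \<subseteq> carrier G" "subgroup A G"
    and "\<And>a b. a \<in> A \<Longrightarrow> b \<in> A \<Longrightarrow> g (a \<otimes> b) = g a + g b"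
  shows "\<exists>B h. subgroup B G \<and> A \<union> T \<subseteq> B \<and>
    (\<forall>a\<in>B. \<forall>b\<in>B. h (a \<otimes> b) = h a + h b) \<and> (\<forall>a\<in>A. h a = (g a :: rat))"
  using assms(1,2)
proof (induction T)
  case empty
  then show ?case using assms(3,4) by (intro exI[of _ A] exI[of _ g]) auto
next
  case (insert m T)
  then obtain B h where B: "subgroup B G" "A \<union> T \<subseteq> B" "\<forall>a\<in>B. \<forall>b\<in>B. h (a \<otimes> b) = h a + h b"
    "\<forall>a\<in>A. h a = g a" by auto
  from rat_hom_extend_insert[OF B(1), of h m] B(3) insert.prems
  obtain C h' where "subgroup C G" "insert m B \<subseteq> C" "\<forall>a\<in>C. \<forall>b\<in>C. h' (a \<otimes> b) = h' a + h' b"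
    "\<forall>a\<in>B. h' a = h a" by auto
  then show ?case using B by (intro exI[of _ C] exI[of _ h']) auto
qed

section \<open>Modules over integral group rings\<close>

context left_module
begin

lemma smult_l_null: "x \<in> carrier M \<Longrightarrow> \<zero>\<^bsub>R\<^esub> \<odot>\<^bsub>M\<^esub> x = \<zero>\<^bsub>M\<^esub>"
  using smult_l_distr[of "\<zero>\<^bsub>R\<^esub>" "\<zero>\<^bsub>R\<^esub>" x] smult_closed[of "\<zero>\<^bsub>R\<^esub>" x]
  by (metis M.add.r_cancel_one' R.l_zero R.zero_closed)

lemma smult_r_null: "a \<in> carrier R \<Longrightarrow> a \<odot>\<^bsub>M\<^esub> \<zero>\<^bsub>M\<^esub> = \<zero>\<^bsub>M\<^esub>"
  using smult_r_distr[of a "\<zero>\<^bsub>M\<^esub>" "\<zero>\<^bsub>M\<^esub>"] smult_closed[of a "\<zero>\<^bsub>M\<^esub>"]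
  by (metis M.add.r_cancel_one' M.l_zero M.zero_closed)

lemma finsum_smult_add:
  assumes "finite S" "S \<subseteq> carrier M" "c \<in> S \<rightarrow> carrier R" "d \<in> S \<rightarrow> carrier R"
  shows "(\<Oplus>\<^bsub>M\<^esub>s\<in>S. (c s \<oplus>\<^bsub>R\<^esub> d s) \<odot>\<^bsub>M\<^esub> s) = (\<Oplus>\<^bsub>M\<^esub>s\<in>S. c s \<odot>\<^bsub>M\<^esub> s) \<oplus>\<^bsub>M\<^esub> (\<Oplus>\<^bsub>M\<^esub>s\<in>S. d s \<odot>\<^bsub>M\<^esub> s)"
proof -
  have "(\<Oplus>\<^bsub>M\<^esub>s\<in>S. (c s \<oplus>\<^bsub>R\<^esub> d s) \<odot>\<^bsub>M\<^esub> s) = (\<Oplus>\<^bsub>M\<^esub>s\<in>S. c s \<odot>\<^bsub>M\<^esub> s \<oplus>\<^bsub>M\<^esub> d s \<odot>\<^bsub>M\<^esub> s)"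
    using assms by (intro M.finsum_cong') (auto simp: smult_l_distr Pi_iff subset_iff intro!: smult_closed M.add.m_closed)
  also have "\<dots> = (\<Oplus>\<^bsub>M\<^esub>s\<in>S. c s \<odot>\<^bsub>M\<^esub> s) \<oplus>\<^bsub>M\<^esub> (\<Oplus>\<^bsub>M\<^esub>s\<in>S. d s \<odot>\<^bsub>M\<^esub> s)"
    using assms by (intro M.finsum_addf) (auto simp: Pi_iff subset_iff intro!: smult_closed)
  finally show ?thesis .
qed

end

text \<open>Finite generation of the additive group as a monoid; only the additive structure enters, so
  this is insensitive to a restriction of scalars.\<close>

definition fg_additive :: "('r, 'm, 'x) module_scheme \<Rightarrow> bool" where
  "fg_additive M \<longleftrightarrow> (\<exists>S. finite S \<and> S \<subseteq> carrier M \<and>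
     (\<forall>A. \<zero>\<^bsub>M\<^esub> \<in> A \<and> (\<forall>x\<in>S. \<forall>y\<in>A \<inter> carrier M. x \<oplus>\<^bsub>M\<^esub> y \<in> A) \<longrightarrow> carrier M \<subseteq> A))"

lemma (in left_module) fg_additive_imp_fin_gen:
  assumes "fg_additive M" shows "fin_gen_module R M"
proof -
  obtain S where S: "finite S" "S \<subseteq> carrier M"
    "\<And>A. \<zero>\<^bsub>M\<^esub> \<in> A \<Longrightarrow> (\<And>x y. x \<in> S \<Longrightarrow> y \<in> A \<Longrightarrow> y \<in> carrier M \<Longrightarrow> x \<oplus>\<^bsub>M\<^esub> y \<in> A) \<Longrightarrow> carrier M \<subseteq> A"
    using assms unfolding fg_additive_def by (metis IntE)
  have "carrier M \<subseteq> {\<Oplus>\<^bsub>M\<^esub>s\<in>S. c s \<odot>\<^bsub>M\<^esub> s | c. c \<in> S \<rightarrow> carrier R}"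
  proof (rule S(3))
    have "\<zero>\<^bsub>M\<^esub> = (\<Oplus>\<^bsub>M\<^esub>s\<in>S. \<zero>\<^bsub>R\<^esub> \<odot>\<^bsub>M\<^esub> s)"
    proof -
      have "(\<Oplus>\<^bsub>M\<^esub>s\<in>S. \<zero>\<^bsub>R\<^esub> \<odot>\<^bsub>M\<^esub> s) = (\<Oplus>\<^bsub>M\<^esub>s\<in>S. \<zero>\<^bsub>M\<^esub>)"
        using S(2) by (intro M.finsum_cong') (auto simp: smult_l_null)
      then show ?thesis by simp
    qed
    then show "\<zero>\<^bsub>M\<^esub> \<in> {\<Oplus>\<^bsub>M\<^esub>s\<in>S. c s \<odot>\<^bsub>M\<^esub> s | c. c \<in> S \<rightarrow> carrier R}"
      by (intro CollectI exI[of _ "\<lambda>_. \<zero>\<^bsub>R\<^esub>"]) auto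
  next
    fix x y assume x: "x \<in> S" and "y \<in> {\<Oplus>\<^bsub>M\<^esub>s\<in>S. c s \<odot>\<^bsub>M\<^esub> s | c. c \<in> S \<rightarrow> carrier R}"
    then obtain c where c: "c \<in> S \<rightarrow> carrier R" "y = (\<Oplus>\<^bsub>M\<^esub>s\<in>S. c s \<odot>\<^bsub>M\<^esub> s)" by blast
    let ?d = "\<lambda>s. if s = x then \<one>\<^bsub>R\<^esub> else \<zero>\<^bsub>R\<^esub>"
    have "(\<Oplus>\<^bsub>M\<^esub>s\<in>S. ?d s \<odot>\<^bsub>M\<^esub> s) = (\<Oplus>\<^bsub>M\<^esub>s\<in>S. if x = s then s else \<zero>\<^bsub>M\<^esub>)"
      using S(2) by (intro M.finsum_cong') (auto simp: smult_l_null smult_one subset_iff)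
    also have "\<dots> = x" using S x by (intro M.finsum_singleton) auto
    finally have "x \<oplus>\<^bsub>M\<^esub> y = (\<Oplus>\<^bsub>M\<^esub>s\<in>S. (?d s \<oplus>\<^bsub>R\<^esub> c s) \<odot>\<^bsub>M\<^esub> s)"
      using finsum_smult_add[of S ?d c] S c by auto
    then show "x \<oplus>\<^bsub>M\<^esub> y \<in> {\<Oplus>\<^bsub>M\<^esub>s\<in>S. c s \<odot>\<^bsub>M\<^esub> s | c. c \<in> S \<rightarrow> carrier R}"
      using c by (intro CollectI exI[of _ "\<lambda>s. ?d s \<oplus>\<^bsub>R\<^esub> c s"]) auto
  qed
  then show ?thesis unfolding fin_gen_module_def using S(1,2) by (intro exI[of _ S]) blast
qed

section \<open>Integral group rings and additive generation of their modules\<close>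

lemma carrier_group_ring [simp]: "carrier (group_ring G) = {u. Poly_Mapping.keys u \<subseteq> carrier G}"
  by (auto simp: group_ring_def)

lemma group_ring_simps [simp]:
  "u \<oplus>\<^bsub>group_ring G\<^esub> v = u + v" "\<zero>\<^bsub>group_ring G\<^esub> = 0" "\<one>\<^bsub>group_ring G\<^esub> = frag_of \<one>\<^bsub>G\<^esub>"
  "u \<otimes>\<^bsub>group_ring G\<^esub> v = frag_extend (\<lambda>x. frag_extend (\<lambda>y. frag_of (x \<otimes>\<^bsub>G\<^esub> y)) v) u"
  by (simp_all add: group_ring_def)

lemma frag_extend_add_fun: "frag_extend (\<lambda>x. f x + g x) u = frag_extend f u + frag_extend g u"
  by (simp add: frag_extend_def frag_cmul_distrib2 sum.distrib)

lemma keys_frag_extend_subset: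
  assumes "\<And>x. x \<in> Poly_Mapping.keys u \<Longrightarrow> Poly_Mapping.keys (f x) \<subseteq> S"
  shows "Poly_Mapping.keys (frag_extend f u) \<subseteq> S"
  using keys_frag_extend[of f u] assms by blast

text \<open>Four separate operations are allowed so that the lemma covers both the associativity of
  a group ring and the law (rs)u = r(su) of a permutation module. It reduces to basis elements
  because both sides are trilinear.\<close>

lemma frag_extend_bilinear_assoc:
  assumes "\<And>x y z. x \<in> Poly_Mapping.keys u \<Longrightarrow> y \<in> Poly_Mapping.keys v \<Longrightarrow> z \<in> Poly_Mapping.keys w \<Longrightarrow>
     q (p x y) z = r x (s y z)"
  shows "frag_extend (\<lambda>g. frag_extend (\<lambda>z. frag_of (q g z)) w)
           (frag_extend (\<lambda>x. frag_extend (\<lambda>y. frag_of (p x y)) v) u) =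
         frag_extend (\<lambda>x. frag_extend (\<lambda>g. frag_of (r x g))
           (frag_extend (\<lambda>y. frag_extend (\<lambda>z. frag_of (s y z)) w) v)) u"
proof -
  have z: "frag_extend (\<lambda>z. frag_of (q (p x y) z)) w =
      frag_extend (\<lambda>g. frag_of (r x g)) (frag_extend (\<lambda>z. frag_of (s y z)) w)"
    if "x \<in> Poly_Mapping.keys u" "y \<in> Poly_Mapping.keys v" for x y
    using frag_extend_compose[of "\<lambda>g. frag_of (r x g)" "s y" w] that assms
    by (auto simp: o_def intro!: frag_extend_eq)
  have y: "frag_extend (\<lambda>g. frag_extend (\<lambda>z. frag_of (q g z)) w) (frag_extend (\<lambda>y. frag_of (p x y)) v) =
      frag_extend (\<lambda>g. frag_of (r x g)) (frag_extend (\<lambda>y. frag_extend (\<lambda>z. frag_of (s y z)) w) v)"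
    if x: "x \<in> Poly_Mapping.keys u" for x
    using frag_extend_compose[of "\<lambda>g. frag_extend (\<lambda>z. frag_of (q g z)) w" "p x" v] z[OF x]
    by (simp add: frag_extend_def[of _ v] o_def frag_extend_sum frag_extend_cmul)
  show ?thesis
    using y by (simp add: frag_extend_def[of _ u] frag_extend_sum o_def frag_extend_cmul)
qed

lemma frag_extend_frag_of: "frag_extend frag_of u = u"
  using frag_expansion by metis

lemma ring_group_ring:
  assumes "group G" shows "ring (group_ring G)"
proof -
  interpret group G by fact
  have mult: "Poly_Mapping.keys (u \<otimes>\<^bsub>group_ring G\<^esub> v) \<subseteq> carrier G"
    if "Poly_Mapping.keys u \<subseteq> carrier G" "Poly_Mapping.keys v \<subseteq> carrier G" for u v
    using that unfolding group_ring_simps by (intro keys_frag_extend_subset) (auto intro!: m_closed)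
  have unit: "frag_extend (\<lambda>x. frag_of (x \<otimes>\<^bsub>G\<^esub> \<one>\<^bsub>G\<^esub>)) u = u" "frag_extend (\<lambda>x. frag_of (\<one>\<^bsub>G\<^esub> \<otimes>\<^bsub>G\<^esub> x)) u = u"
    if "Poly_Mapping.keys u \<subseteq> carrier G" for u
    using that frag_extend_eq[of u "\<lambda>x. frag_of (x \<otimes>\<^bsub>G\<^esub> \<one>\<^bsub>G\<^esub>)" frag_of]
      frag_extend_eq[of u "\<lambda>x. frag_of (\<one>\<^bsub>G\<^esub> \<otimes>\<^bsub>G\<^esub> x)" frag_of] by (auto simp: frag_extend_frag_of subset_iff)
  have add: "Poly_Mapping.keys (u + v) \<subseteq> carrier G"
    if "Poly_Mapping.keys u \<subseteq> carrier G" "Poly_Mapping.keys v \<subseteq> carrier G" for u v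
    using that keys_add[of u v] by blast
  show ?thesis
  proof (rule ringI)
    show "abelian_group (group_ring G)"
    proof (rule abelian_groupI)
      fix u assume "u \<in> carrier (group_ring G)"
      then show "\<exists>v\<in>carrier (group_ring G). v \<oplus>\<^bsub>group_ring G\<^esub> u = \<zero>\<^bsub>group_ring G\<^esub>"
        by (intro bexI[of _ "- u"]) auto
    qed (auto simp: add ac_simps)
    show "Group.monoid (group_ring G)"
    proof (rule Group.monoidI)
      fix u v w assume "u \<in> carrier (group_ring G)" "v \<in> carrier (group_ring G)" "w \<in> carrier (group_ring G)"
      then show "u \<otimes>\<^bsub>group_ring G\<^esub> v \<otimes>\<^bsub>group_ring G\<^esub> w = u \<otimes>\<^bsub>group_ring G\<^esub> (v \<otimes>\<^bsub>group_ring G\<^esub> w)"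
        unfolding group_ring_simps by (intro frag_extend_bilinear_assoc) (auto intro!: m_assoc)
    qed (use mult unit in \<open>auto simp del: group_ring_simps(4)\<close>, auto)
  qed (auto simp: frag_extend_add frag_extend_add_fun)
qed

lemma countable_group_ring:
  assumes "finite (carrier G)" shows "countable (carrier (group_ring G))"
proof -
  have "inj_on (\<lambda>u. restrict (Poly_Mapping.lookup u) (carrier G)) (carrier (group_ring G))"
  proof (rule inj_onI)
    fix u v assume uv: "u \<in> carrier (group_ring G)" "v \<in> carrier (group_ring G)"
      "restrict (Poly_Mapping.lookup u) (carrier G) = restrict (Poly_Mapping.lookup v) (carrier G)"
    show "u = v"
    proof (rule poly_mapping_eqI)
      fix k show "Poly_Mapping.lookup u k = Poly_Mapping.lookup v k"
      proof (cases "k \<in> carrier G")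
        case True
        then show ?thesis using fun_cong[OF uv(3), of k] by simp
      next
        case False
        then have "k \<notin> Poly_Mapping.keys u" "k \<notin> Poly_Mapping.keys v" using uv by auto
        then show ?thesis by (simp add: in_keys_iff)
      qed
    qed
  qed
  moreover have "(\<lambda>u. restrict (Poly_Mapping.lookup u) (carrier G)) ` carrier (group_ring G)
      \<subseteq> carrier G \<rightarrow>\<^sub>E (UNIV :: int set)" by auto
  moreover have "countable (carrier G \<rightarrow>\<^sub>E (UNIV :: int set))"
    using assms by (induction rule: finite_induct) (auto simp: PiE_insert_eq)
  ultimately show ?thesis
    by (meson countable_image_inj_on countable_subset)
qed

text \<open>Here the finiteness of the group enters: the elements \<open>g s\<close> and their
  negatives, for \<open>g\<close> in the group and \<open>s\<close> a module generator, are finitely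
  many and generate additively. Both signs are listed because \<open>fg_additive\<close> only allows
  sums of generators.\<close>

lemma fin_gen_imp_fg_additive:
  assumes G: "group G" "finite (carrier G)" and M: "left_module (group_ring G) M" "fin_gen_module (group_ring G) M"
  shows "fg_additive M"
proof -
  interpret M: left_module "group_ring G" M by fact
  obtain S where "finite S \<and> S \<subseteq> carrier M \<and>
      (\<forall>x\<in>carrier M. \<exists>c\<in>S \<rightarrow> carrier (group_ring G). x = (\<Oplus>\<^bsub>M\<^esub>s\<in>S. c s \<odot>\<^bsub>M\<^esub> s))"
    using M(2) unfolding fin_gen_module_def by (elim exE)
  then have S: "finite S" "S \<subseteq> carrier M"
    "\<And>x. x \<in> carrier M \<Longrightarrow> \<exists>c\<in>S \<rightarrow> carrier (group_ring G). x = (\<Oplus>\<^bsub>M\<^esub>s\<in>S. c s \<odot>\<^bsub>M\<^esub> s)"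
    by auto
  define T where "T = (\<lambda>(g, s). frag_of g \<odot>\<^bsub>M\<^esub> s) ` (carrier G \<times> S) \<union>
     (\<lambda>(g, s). (- frag_of g) \<odot>\<^bsub>M\<^esub> s) ` (carrier G \<times> S)"
  show ?thesis unfolding fg_additive_def
  proof (intro exI[of _ T] conjI allI impI; (elim conjE)?)
    show "finite T" using S G by (simp add: T_def)
    show TM: "T \<subseteq> carrier M" using S(2) by (auto simp: T_def subset_iff intro!: M.smult_closed)
    fix A assume A: "\<zero>\<^bsub>M\<^esub> \<in> A" "\<forall>x\<in>T. \<forall>y\<in>A \<inter> carrier M. x \<oplus>\<^bsub>M\<^esub> y \<in> A"
    \<comment> \<open>The claim treats \<open>u\<close> and \<open>- u\<close> together, since the
      induction over formal sums has a difference step and needs the negative of the second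
      term.\<close>
    have smult_mem: "\<forall>y\<in>A \<inter> carrier M. u \<odot>\<^bsub>M\<^esub> s \<oplus>\<^bsub>M\<^esub> y \<in> A \<and> (- u) \<odot>\<^bsub>M\<^esub> s \<oplus>\<^bsub>M\<^esub> y \<in> A"
      if u: "Poly_Mapping.keys u \<subseteq> carrier G" and s: "s \<in> S" for u s
    proof -
      have "Poly_Mapping.keys u \<subseteq> carrier G \<and> (\<forall>y\<in>A \<inter> carrier M. u \<odot>\<^bsub>M\<^esub> s \<oplus>\<^bsub>M\<^esub> y \<in> A \<and> (- u) \<odot>\<^bsub>M\<^esub> s \<oplus>\<^bsub>M\<^esub> y \<in> A)"
        using u
      proof (induction u rule: frag_induction)
        case zero
        then show ?case using M.smult_l_null[of s] s S(2) by auto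
      next
        case (one g)
        then show ?case using A(2) s by (auto simp: T_def)
      next
        case (diff a b)
        have s': "s \<in> carrier M" using s S(2) by blast
        have split: "(c + d) \<odot>\<^bsub>M\<^esub> s \<oplus>\<^bsub>M\<^esub> y = c \<odot>\<^bsub>M\<^esub> s \<oplus>\<^bsub>M\<^esub> (d \<odot>\<^bsub>M\<^esub> s \<oplus>\<^bsub>M\<^esub> y)"
          "d \<odot>\<^bsub>M\<^esub> s \<oplus>\<^bsub>M\<^esub> y \<in> carrier M"
          if "Poly_Mapping.keys c \<subseteq> carrier G" "Poly_Mapping.keys d \<subseteq> carrier G" "y \<in> carrier M" for c d y
          using M.smult_l_distr[of c d s] M.smult_closed[of c s] M.smult_closed[of d s] that s'
          by (auto simp: M.M.a_assoc)
        have "(a - b) \<odot>\<^bsub>M\<^esub> s \<oplus>\<^bsub>M\<^esub> y \<in> A" "(- (a - b)) \<odot>\<^bsub>M\<^esub> s \<oplus>\<^bsub>M\<^esub> y \<in> A" if "y \<in> A \<inter> carrier M" for y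
          using split[of a "- b" y] split[of "- a" b y] diff that by auto
        moreover have "Poly_Mapping.keys (a - b) \<subseteq> carrier G"
          using diff keys_diff[of a b] by blast
        ultimately show ?case by blast
      qed
      then show ?thesis by blast
    qed
    have fs: "(\<Oplus>\<^bsub>M\<^esub>s\<in>S'. c s \<odot>\<^bsub>M\<^esub> s) \<in> A \<inter> carrier M"
      if "S' \<subseteq> S" "c \<in> S \<rightarrow> carrier (group_ring G)" for S' c
    proof -
      have "finite S'" using that S(1) finite_subset by blast
      then show ?thesis using that
      proof (induction S')
        case empty
        then show ?case using A by simp
      next
        case (insert s S')
        have "(\<Oplus>\<^bsub>M\<^esub>s\<in>insert s S'. c s \<odot>\<^bsub>M\<^esub> s) = c s \<odot>\<^bsub>M\<^esub> s \<oplus>\<^bsub>M\<^esub> (\<Oplus>\<^bsub>M\<^esub>s\<in>S'. c s \<odot>\<^bsub>M\<^esub> s)"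
          using insert S(2) by (intro M.M.finsum_insert) (auto intro!: M.smult_closed)
        moreover have "c s \<odot>\<^bsub>M\<^esub> s \<in> carrier M"
          using insert S(2) by (intro M.smult_closed) auto
        moreover have "Poly_Mapping.keys (c s) \<subseteq> carrier G" using insert by auto
        ultimately show ?case using insert smult_mem[of "c s" s] by auto
      qed
    qed
    show "carrier M \<subseteq> A"
    proof
      fix x assume "x \<in> carrier M"
      then obtain c where "c \<in> S \<rightarrow> carrier (group_ring G)" "x = (\<Oplus>\<^bsub>M\<^esub>s\<in>S. c s \<odot>\<^bsub>M\<^esub> s)"
        using S(3) by blast
      then show "x \<in> A" using fs[of S c] by simp
    qed
  qed
qed

definition fg_module :: "('r, 'n) ring_scheme \<Rightarrow> ('r, 'm, 'x) module_scheme \<Rightarrow> bool" where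
  "fg_module R M \<longleftrightarrow> left_module R M \<and> fin_gen_module R M"

lemma fg_moduleI: "left_module R M \<Longrightarrow> fg_additive M \<Longrightarrow> fg_module R M"
  by (simp add: fg_module_def left_module.fg_additive_imp_fin_gen)

lemma fg_modules_iff: "M \<in> fg_modules R \<longleftrightarrow> fg_module R M"
  by (simp add: fg_modules_def fg_module_def)


section \<open>Restriction of scalars\<close>

lemma restrict_scalars_simps [simp]:
  "carrier (restrict_scalars \<phi> M) = carrier M" "\<zero>\<^bsub>restrict_scalars \<phi> M\<^esub> = \<zero>\<^bsub>M\<^esub>"
  "x \<oplus>\<^bsub>restrict_scalars \<phi> M\<^esub> y = x \<oplus>\<^bsub>M\<^esub> y" "r \<odot>\<^bsub>restrict_scalars \<phi> M\<^esub> x = \<phi> r \<odot>\<^bsub>M\<^esub> x"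
  by (simp_all add: restrict_scalars_def)

lemma left_module_restrict_scalars:
  fixes M :: "('r, 'm) module"
  assumes "left_module S M" "ring R" "\<phi> \<in> Ring.ring_hom R S"
  shows "left_module R (restrict_scalars \<phi> M)"
proof -
  interpret M: left_module S M by fact
  have "abelian_group (restrict_scalars \<phi> M)"
  proof (rule abelian_groupI)
    fix x assume "x \<in> carrier (restrict_scalars \<phi> M)"
    then show "\<exists>y\<in>carrier (restrict_scalars \<phi> M). y \<oplus>\<^bsub>restrict_scalars \<phi> M\<^esub> x = \<zero>\<^bsub>restrict_scalars \<phi> M\<^esub>"
      by (intro bexI[of _ "\<ominus>\<^bsub>M\<^esub> x"]) (auto simp: M.M.l_neg)
  qed (auto simp: M.M.a_ac)
  then show ?thesis
    using assms ring_hom_closed[OF assms(3)]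
    by (intro left_module.intro left_module_axioms.intro)
      (auto simp: ring_hom_add ring_hom_mult ring_hom_one M.smult_closed M.smult_l_distr
        M.smult_r_distr M.smult_assoc1 M.smult_one)
qed

lemma fg_additive_restrict_scalars: "fg_additive (restrict_scalars \<phi> M) \<longleftrightarrow> fg_additive M"
  by (simp add: fg_additive_def)

lemma group_ring_hom:
  assumes "group H" "group K" "c \<in> hom H K"
  shows "frag_extend (\<lambda>h. frag_of (c h)) \<in> Ring.ring_hom (group_ring H) (group_ring K)"
proof (rule ring_hom_memI)
  fix u assume "u \<in> carrier (group_ring H)"
  then show "frag_extend (\<lambda>h. frag_of (c h)) u \<in> carrier (group_ring K)"
    using hom_in_carrier[OF assms(3)] by (auto intro!: keys_frag_extend_subset)
next
  fix u v assume uv: "u \<in> carrier (group_ring H)" "v \<in> carrier (group_ring H)"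
  let ?\<phi> = "frag_extend (\<lambda>h. frag_of (c h))"
  have *: "?\<phi> (frag_extend (\<lambda>y. frag_of (x \<otimes>\<^bsub>H\<^esub> y)) v) = frag_extend (\<lambda>y. frag_of (c x \<otimes>\<^bsub>K\<^esub> y)) (?\<phi> v)"
    if "x \<in> carrier H" for x
    using frag_extend_compose[of "\<lambda>h. frag_of (c h)" "\<lambda>y. x \<otimes>\<^bsub>H\<^esub> y" v]
      frag_extend_compose[of "\<lambda>y. frag_of (c x \<otimes>\<^bsub>K\<^esub> y)" c v] that uv hom_mult[OF assms(3)]
    by (auto simp: o_def subset_iff intro!: frag_extend_eq)
  have "?\<phi> (u \<otimes>\<^bsub>group_ring H\<^esub> v) = frag_extend (\<lambda>x. ?\<phi> (frag_extend (\<lambda>y. frag_of (x \<otimes>\<^bsub>H\<^esub> y)) v)) u"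
    by (simp add: frag_extend_def[of _ u] frag_extend_sum frag_extend_cmul o_def)
  also have "\<dots> = frag_extend (\<lambda>x. frag_extend (\<lambda>y. frag_of (c x \<otimes>\<^bsub>K\<^esub> y)) (?\<phi> v)) u"
    using uv * by (intro frag_extend_eq) (auto simp: subset_iff)
  also have "\<dots> = ?\<phi> u \<otimes>\<^bsub>group_ring K\<^esub> ?\<phi> v"
    using frag_extend_compose[of "\<lambda>x. frag_extend (\<lambda>y. frag_of (x \<otimes>\<^bsub>K\<^esub> y)) (?\<phi> v)" c u]
    by (simp add: o_def)
  finally show "?\<phi> (u \<otimes>\<^bsub>group_ring H\<^esub> v) = ?\<phi> u \<otimes>\<^bsub>group_ring K\<^esub> ?\<phi> v" .
next
  show "frag_extend (\<lambda>h. frag_of (c h)) \<one>\<^bsub>group_ring H\<^esub> = \<one>\<^bsub>group_ring K\<^esub>"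
    using hom_one[OF assms(3,1,2)] by simp
qed (auto simp: frag_extend_add)

text \<open>Finite generation is passed through the additive group: finiteness of \<open>K\<close>
  gives additive generation, which does not see the scalars and yields finite generation over the
  group ring of \<open>H\<close>.\<close>

lemma fg_module_restrict_scalars:
  fixes M :: "('a \<Rightarrow>\<^sub>0 int, 'm) module"
  assumes "group H" "group K" "finite (carrier K)" "c \<in> hom H K" "fg_module (group_ring K) M"
  shows "fg_module (group_ring H) (restrict_scalars (frag_extend (\<lambda>h. frag_of (c h))) M)"
  using assms unfolding fg_module_def[of _ M]
  by (intro fg_moduleI left_module_restrict_scalars[of "group_ring K"] ring_group_ring group_ring_hom)
    (auto simp: fg_additive_restrict_scalars intro: fin_gen_imp_fg_additive)

lemma module_hom_restrict_scalars:
  fixes A :: "('r, 'm) module" and B :: "('r, 'k) module"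
  assumes "f \<in> module_hom S A B" "\<phi> \<in> Ring.ring_hom R S"
  shows "f \<in> module_hom R (restrict_scalars \<phi> A) (restrict_scalars \<phi> B)"
  using assms(1) ring_hom_closed[OF assms(2)] by (simp add: module_hom_def)

lemma short_exact_restrict_scalars:
  fixes A :: "('r, 'm1) module" and B :: "('r, 'm2) module" and C :: "('r, 'm3) module"
  assumes "short_exact S A B C" "\<phi> \<in> Ring.ring_hom R S"
  shows "short_exact R (restrict_scalars \<phi> A) (restrict_scalars \<phi> B) (restrict_scalars \<phi> C)"
proof -
  obtain i p where "i \<in> module_hom S A B" "p \<in> module_hom S B C" "inj_on i (carrier A)"
    "i ` carrier A = {m \<in> carrier B. p m = \<zero>\<^bsub>C\<^esub>}" "p ` carrier B = carrier C"
    using assms(1) unfolding short_exact_def by (elim bexE conjE)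
  then show ?thesis
    unfolding short_exact_def restrict_scalars_simps
    by (intro bexI[of _ i] bexI[of _ p] conjI module_hom_restrict_scalars[OF _ assms(2)])
qed

section \<open>The rank of the invariant rational functionals\<close>

text \<open>Independent sets of \<open>V\<close> are mapped injectively to independent sets of
  \<open>W\<close>, so their size is at most \<open>W.dim\<close>. Hence a maximal independent set
  exists, and it spans.\<close>

lemma (in linear_map) inj_fin_dim:
  assumes W: "W.fin_dim" and inj: "inj_on T (carrier V)"
  shows "V.fin_dim"
proof -
  have fin: "card A \<le> W.dim" if A: "finite A" "A \<subseteq> carrier V" "V.module.lin_indpt A" for A
  proof -
    have "W.module.lin_indpt (T ` A)"
    proof (rule W.module.finite_lin_indpt2)
      fix a assume a: "a \<in> T ` A \<rightarrow> carrier K" and lc: "W.module.lincomb a (T ` A) = \<zero>\<^bsub>W\<^esub>"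
      have "W.module.lincomb a (T ` A) = T (V.module.lincomb (a \<circ> T) A)"
        using A a by (intro lincomb_linear_image[OF inj]) auto
      moreover have aT: "a \<circ> T \<in> A \<rightarrow> carrier K" using a by auto
      moreover from aT have "V.module.lincomb (a \<circ> T) A \<in> carrier V"
        using A by (intro V.module.lincomb_closed) auto
      ultimately have "V.module.lincomb (a \<circ> T) A = \<zero>\<^bsub>V\<^esub>"
        using lc inj f0_is_0 by (auto simp: inj_on_def)
      then have "a \<circ> T \<in> A \<rightarrow> {\<zero>\<^bsub>K\<^esub>}"
        using A aT by (intro V.not_lindepD[OF A(3)]) auto
      then show "\<forall>v\<in>T ` A. a v = \<zero>\<^bsub>K\<^esub>" by auto
    qed (use A in auto)
    then have "card (T ` A) \<le> W.dim" using A by (intro W.li_le_dim(2)[OF W]) auto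
    moreover have "card (T ` A) = card A" using A inj by (intro card_image) (auto intro: inj_on_subset)
    ultimately show ?thesis by simp
  qed
  have bound: "finite A \<and> card A \<le> W.dim" if A: "A \<subseteq> carrier V \<and> V.module.lin_indpt A" for A
  proof -
    have "finite A"
    proof (rule ccontr)
      assume "infinite A"
      then obtain B where B: "B \<subseteq> A" "finite B" "card B = Suc W.dim"
        using infinite_arbitrarily_large by blast
      then have "card B \<le> W.dim"
        using A V.module.subset_li_is_li[of A B] by (intro fin) auto
      then show False using B by simp
    qed
    then show ?thesis using fin A by blast
  qed
  moreover have "{} \<subseteq> carrier V \<and> V.module.lin_indpt {}"
    by (auto simp: V.module.lin_dep_def)
  ultimately obtain A where A: "finite A" "maximal A (\<lambda>S. S \<subseteq> carrier V \<and> V.module.lin_indpt S)"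
    using maximal_exists[of "\<lambda>S. S \<subseteq> carrier V \<and> V.module.lin_indpt S" W.dim "{}"] by blast
  from V.max_li_is_gen[OF A(2)] A show ?thesis
    unfolding V.fin_dim_def maximal_def by blast
qed

text \<open>This is Hom over Z[G] from M to Q with trivial action on Q. Functions are set to 0
  outside the carrier so that equality of functionals is equality of functions.\<close>

definition inv_functionals ::
  "('a, 'b) monoid_scheme \<Rightarrow> ('a \<Rightarrow>\<^sub>0 int, 'm, 'x) module_scheme \<Rightarrow> (rat, 'm \<Rightarrow> rat) module" where
  "inv_functionals G M =
     \<lparr>carrier = {f. (\<forall>x. x \<notin> carrier M \<longrightarrow> f x = 0) \<and>
        (\<forall>x\<in>carrier M. \<forall>y\<in>carrier M. f (x \<oplus>\<^bsub>M\<^esub> y) = f x + f y) \<and>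
        (\<forall>g\<in>carrier G. \<forall>x\<in>carrier M. f (frag_of g \<odot>\<^bsub>M\<^esub> x) = f x)},
      mult = undefined, one = undefined, zero = (\<lambda>x. 0), add = (\<lambda>f g x. f x + g x),
      smult = (\<lambda>r f x. r * f x)\<rparr>"

lemma inv_functionals_simps [simp]:
  "\<zero>\<^bsub>inv_functionals G M\<^esub> = (\<lambda>x. 0)"
  "f \<oplus>\<^bsub>inv_functionals G M\<^esub> g = (\<lambda>x. f x + g x)"
  "r \<odot>\<^bsub>inv_functionals G M\<^esub> f = (\<lambda>x. r * f x)"
  by (simp_all add: inv_functionals_def)

lemma mem_inv_functionals:
  "f \<in> carrier (inv_functionals G M) \<longleftrightarrow> (\<forall>x. x \<notin> carrier M \<longrightarrow> f x = 0) \<and>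
     (\<forall>x\<in>carrier M. \<forall>y\<in>carrier M. f (x \<oplus>\<^bsub>M\<^esub> y) = f x + f y) \<and>
     (\<forall>g\<in>carrier G. \<forall>x\<in>carrier M. f (frag_of g \<odot>\<^bsub>M\<^esub> x) = f x)"
  by (simp add: inv_functionals_def)

lemma vectorspace_inv_functionals: "vectorspace (class_ring :: rat ring) (inv_functionals G M)"
proof (rule vs_criteria[OF class_field.field_axioms])
  show "\<forall>f\<in>carrier (inv_functionals G M). \<exists>g\<in>carrier (inv_functionals G M).
      f \<oplus>\<^bsub>inv_functionals G M\<^esub> g = \<zero>\<^bsub>inv_functionals G M\<^esub>"
  proof
    fix f assume "f \<in> carrier (inv_functionals G M)"
    then show "\<exists>g\<in>carrier (inv_functionals G M). f \<oplus>\<^bsub>inv_functionals G M\<^esub> g = \<zero>\<^bsub>inv_functionals G M\<^esub>"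
      by (intro bexI[of _ "\<lambda>x. - f x"]) (auto simp: mem_inv_functionals)
  qed
qed (auto simp: mem_inv_functionals fun_eq_iff algebra_simps)

lemma linear_map_inv_functionals:
  assumes "\<And>f. f \<in> carrier (inv_functionals G M) \<Longrightarrow> T f \<in> carrier (inv_functionals G' N)"
    and "\<And>f g. T (\<lambda>x. f x + g x) = (\<lambda>x. T f x + T g x)" and "\<And>r f. T (\<lambda>x. r * f x) = (\<lambda>x. r * T f x)"
  shows "linear_map (class_ring :: rat ring) (inv_functionals G M) (inv_functionals G' N) T"
  using assms
  by (intro linear_map.intro mod_hom.intro mod_hom_axioms.intro vectorspace_inv_functionals
      vectorspace.axioms(1)[OF vectorspace_inv_functionals]) (auto simp: module_hom_def)

definition inv_rank :: "('a, 'b) monoid_scheme \<Rightarrow> ('a \<Rightarrow>\<^sub>0 int, 'm, 'x) module_scheme \<Rightarrow> nat" where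
  "inv_rank G M = vectorspace.dim (class_ring :: rat ring) (inv_functionals G M)"

text \<open>Evaluation at finitely many additive generators embeds the space into a space of
  rational vectors: the set where two functionals agree contains zero and is closed under adding a
  generator.\<close>

lemma inv_functionals_fin_dim:
  assumes M: "fg_additive M" "abelian_group M"
  shows "vectorspace.fin_dim (class_ring :: rat ring) (inv_functionals G M)"
proof -
  interpret M: abelian_group M by fact
  interpret V: vectorspace "class_ring :: rat ring" "inv_functionals G M"
    by (rule vectorspace_inv_functionals)
  obtain S where S: "finite S" "S \<subseteq> carrier M"
    "\<forall>A. \<zero>\<^bsub>M\<^esub> \<in> A \<and> (\<forall>x\<in>S. \<forall>y\<in>A \<inter> carrier M. x \<oplus>\<^bsub>M\<^esub> y \<in> A) \<longrightarrow> carrier M \<subseteq> A"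
    using M(1) unfolding fg_additive_def by (elim exE conjE)
  obtain s where s: "bij_betw s {..<card S} S"
    using S(1) ex_bij_betw_nat_finite[of S] by (auto simp: atLeast0LessThan)
  define T where "T f = vec (card S) (\<lambda>i. f (s i))" for f :: "_ \<Rightarrow> rat"
  interpret W: vec_space "TYPE(rat)" "card S" .
  interpret T: linear_map "class_ring :: rat ring" "inv_functionals G M" "module_vec TYPE(rat) (card S)" T
    by (intro linear_map.intro mod_hom.intro mod_hom_axioms.intro V.vectorspace_axioms
        vec_vs V.module_axioms vectorspace.axioms(1)[OF vec_vs])
      (auto simp: module_hom_def T_def module_vec_def)
  have "inj_on T (carrier (inv_functionals G M))"
  proof (rule inj_onI)
    fix f g assume fg: "f \<in> carrier (inv_functionals G M)" "g \<in> carrier (inv_functionals G M)" "T f = T g"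
    have "f (s i) = g (s i)" if "i < card S" for i
      using fg(3) that by (auto simp: T_def vec_eq_iff)
    then have eqS: "f x = g x" if "x \<in> S" for x
      using s that by (metis bij_betw_imp_surj_on imageE lessThan_iff)
    have zero: "h \<zero>\<^bsub>M\<^esub> = 0" if "h \<in> carrier (inv_functionals G M)" for h
    proof -
      have "h (\<zero>\<^bsub>M\<^esub> \<oplus>\<^bsub>M\<^esub> \<zero>\<^bsub>M\<^esub>) = h \<zero>\<^bsub>M\<^esub> + h \<zero>\<^bsub>M\<^esub>"
        using that unfolding mem_inv_functionals by blast
      then show ?thesis by simp
    qed
    have "carrier M \<subseteq> {x. f x = g x}"
    proof (rule S(3)[rule_format], intro conjI)
      show "\<forall>x\<in>S. \<forall>y\<in>{x. f x = g x} \<inter> carrier M. x \<oplus>\<^bsub>M\<^esub> y \<in> {x. f x = g x}"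
        using fg(1,2) eqS S(2) by (auto simp: mem_inv_functionals subset_iff)
    qed (simp add: zero fg(1,2))
    then have "f x = g x" if "x \<in> carrier M" for x using that by auto
    moreover have "f x = g x" if "x \<notin> carrier M" for x
      using fg(1,2) that by (simp add: mem_inv_functionals)
    ultimately show "f = g" by (intro ext) (rule case_split)
  qed
  then show ?thesis by (intro T.inj_fin_dim W.fin_dim)
qed

text \<open>Extend additively, using that the rationals are divisible, and then average over the
  group. On the image of \<open>A\<close> the average changes nothing because \<open>f\<close> is
  invariant.\<close>

lemma inv_functional_extend:
  assumes G: "group G" "finite (carrier G)" and B: "left_module (group_ring G) B" "fg_additive B"
    and A: "left_module (group_ring G) A"
    and i: "i \<in> module_hom (group_ring G) A B" "inj_on i (carrier A)"
    and f: "f \<in> carrier (inv_functionals G A)"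
  shows "\<exists>F\<in>carrier (inv_functionals G B). \<forall>x\<in>carrier A. F (i x) = f x"
proof -
  interpret G: group G by fact
  interpret A: left_module "group_ring G" A by fact
  interpret B: left_module "group_ring G" B by fact
  have i_closed: "i x \<in> carrier B" if "x \<in> carrier A" for x using i that by (auto simp: module_hom_def)
  have i_add: "i (x \<oplus>\<^bsub>A\<^esub> y) = i x \<oplus>\<^bsub>B\<^esub> i y" if "x \<in> carrier A" "y \<in> carrier A" for x y
    using i that by (auto simp: module_hom_def)
  have i_smult: "i (frag_of g \<odot>\<^bsub>A\<^esub> x) = frag_of g \<odot>\<^bsub>B\<^esub> i x" if "x \<in> carrier A" "g \<in> carrier G" for x g
    using i that by (auto simp: module_hom_def)
  obtain S where S: "finite S" "S \<subseteq> carrier B"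
    "\<forall>A. \<zero>\<^bsub>B\<^esub> \<in> A \<and> (\<forall>x\<in>S. \<forall>y\<in>A \<inter> carrier B. x \<oplus>\<^bsub>B\<^esub> y \<in> A) \<longrightarrow> carrier B \<subseteq> A"
    using B(2) unfolding fg_additive_def by (elim exE conjE)
  interpret H: group_hom "add_monoid A" "add_monoid B" i
    using i_add i_closed by unfold_locales (auto simp: hom_def)
  have "comm_group (add_monoid B)" by (rule B.M.a_comm_group)
  moreover have "subgroup (i ` carrier A) (add_monoid B)"
    using H.img_is_subgroup by simp
  moreover have "f (inv_into (carrier A) i (a \<oplus>\<^bsub>B\<^esub> b)) =
      f (inv_into (carrier A) i a) + f (inv_into (carrier A) i b)"
    if "a \<in> i ` carrier A" "b \<in> i ` carrier A" for a b
    using that i(2) f by (auto simp: mem_inv_functionals simp flip: i_add)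
  ultimately have "\<exists>C h. subgroup C (add_monoid B) \<and> i ` carrier A \<union> S \<subseteq> C \<and>
      (\<forall>a\<in>C. \<forall>b\<in>C. h (a \<otimes>\<^bsub>add_monoid B\<^esub> b) = h a + h b) \<and>
      (\<forall>a\<in>i ` carrier A. h a = f (inv_into (carrier A) i a))"
    using S(1,2) by (intro comm_group.rat_hom_extend) simp_all
  then obtain C and h :: "_ \<Rightarrow> rat" where C: "subgroup C (add_monoid B)" "i ` carrier A \<union> S \<subseteq> C"
    and hC: "\<forall>a\<in>C. \<forall>b\<in>C. h (a \<otimes>\<^bsub>add_monoid B\<^esub> b) = h a + h b"
    and hi: "\<forall>a\<in>i ` carrier A. h a = f (inv_into (carrier A) i a)"
    by (elim exE conjE)
  \<comment> \<open>\<open>C\<close> is a subgroup containing the additive generators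
    \<open>S\<close>, so the extension is defined on all of \<open>B\<close>.\<close>
  have "carrier B \<subseteq> C"
  proof (rule S(3)[rule_format], intro conjI)
    show "\<zero>\<^bsub>B\<^esub> \<in> C" using subgroup.one_closed[OF C(1)] by simp
    show "\<forall>x\<in>S. \<forall>y\<in>C \<inter> carrier B. x \<oplus>\<^bsub>B\<^esub> y \<in> C"
      using subgroup.m_closed[OF C(1)] C(2) by auto
  qed
  then have h_add: "h (a \<oplus>\<^bsub>B\<^esub> b) = h a + h b" if "a \<in> carrier B" "b \<in> carrier B" for a b
    using bspec[OF bspec[OF hC], of a b] that by (simp add: subset_iff)
  have h_i: "h (i x) = f x" if "x \<in> carrier A" for x
    using hi i(2) that by simp
  define n where "n = (of_nat (card (carrier G)) :: rat)"
  have n: "n \<noteq> 0" using G by (auto simp: n_def)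
  \<comment> \<open>The average over the group, with division by its order; the value outside the
    carrier follows the convention of \<open>inv_functionals\<close>.\<close>
  define F where "F x = (if x \<in> carrier B then (\<Sum>g\<in>carrier G. h (frag_of g \<odot>\<^bsub>B\<^esub> x)) / n else 0)" for x
  have closed: "frag_of g \<odot>\<^bsub>B\<^esub> x \<in> carrier B" if "g \<in> carrier G" "x \<in> carrier B" for g x
    using that by (intro B.smult_closed) auto
  have "F \<in> carrier (inv_functionals G B)"
    unfolding mem_inv_functionals
  proof (intro conjI ballI allI impI)
    fix x y assume xy: "x \<in> carrier B" "y \<in> carrier B"
    have "h (frag_of g \<odot>\<^bsub>B\<^esub> (x \<oplus>\<^bsub>B\<^esub> y)) = h (frag_of g \<odot>\<^bsub>B\<^esub> x) + h (frag_of g \<odot>\<^bsub>B\<^esub> y)"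
      if "g \<in> carrier G" for g
      using xy that closed B.smult_r_distr[of "frag_of g" x y] by (simp add: h_add)
    then show "F (x \<oplus>\<^bsub>B\<^esub> y) = F x + F y"
      using xy by (simp add: F_def sum.distrib add_divide_distrib)
  next
    fix k x assume kx: "k \<in> carrier G" "x \<in> carrier B"
    have "(\<Sum>g\<in>carrier G. h (frag_of g \<odot>\<^bsub>B\<^esub> (frag_of k \<odot>\<^bsub>B\<^esub> x))) =
        (\<Sum>g\<in>carrier G. h (frag_of (g \<otimes>\<^bsub>G\<^esub> k) \<odot>\<^bsub>B\<^esub> x))"
      using kx B.smult_assoc1[of "frag_of g" "frag_of k" x for g] by (intro sum.cong) auto
    also have "\<dots> = (\<Sum>g\<in>carrier G. h (frag_of g \<odot>\<^bsub>B\<^esub> x))"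
      using kx by (intro sum.reindex_bij_witness[of _ "\<lambda>g. g \<otimes>\<^bsub>G\<^esub> inv\<^bsub>G\<^esub> k" "\<lambda>g. g \<otimes>\<^bsub>G\<^esub> k"])
        (auto simp: G.m_assoc)
    finally show "F (frag_of k \<odot>\<^bsub>B\<^esub> x) = F x"
      using kx closed by (simp add: F_def)
  qed (simp add: F_def)
  moreover have "F (i x) = f x" if x: "x \<in> carrier A" for x
  proof -
    have "h (frag_of g \<odot>\<^bsub>B\<^esub> i x) = f x" if g: "g \<in> carrier G" for g
    proof -
      have "h (frag_of g \<odot>\<^bsub>B\<^esub> i x) = f (frag_of g \<odot>\<^bsub>A\<^esub> x)"
        using h_i[of "frag_of g \<odot>\<^bsub>A\<^esub> x"] A.smult_closed[of "frag_of g" x] g x by (simp add: i_smult)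
      then show ?thesis using f g x by (simp add: mem_inv_functionals)
    qed
    then show ?thesis using n x i_closed by (simp add: F_def n_def)
  qed
  ultimately show ?thesis by blast
qed

text \<open>Applying Hom_G(-, Q) gives a short exact sequence in the opposite direction. Restriction
  \<open>T\<close> along \<open>i\<close> is surjective by \<open>inv_functional_extend\<close>, its
  kernel is the image of the injective map \<open>S\<close> induced by \<open>p\<close>, and
  rank-nullity adds the dimensions.\<close>

theorem inv_rank_short_exact:
  assumes G: "group G" "finite (carrier G)"
    and mods: "left_module (group_ring G) A" "left_module (group_ring G) B" "left_module (group_ring G) C"
    and fg: "fg_additive B" and ex: "short_exact (group_ring G) A B C"
  shows "inv_rank G B = inv_rank G A + inv_rank G C"
proof -
  interpret A: left_module "group_ring G" A by fact
  interpret B: left_module "group_ring G" B by fact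
  interpret C: left_module "group_ring G" C by fact
  obtain i p where i: "i \<in> module_hom (group_ring G) A B" and p: "p \<in> module_hom (group_ring G) B C"
    and inj: "inj_on i (carrier A)" and exact: "i ` carrier A = {m \<in> carrier B. p m = \<zero>\<^bsub>C\<^esub>}"
    and surj: "p ` carrier B = carrier C"
    using ex unfolding short_exact_def by (elim bexE conjE)
  have i': "i x \<in> carrier B" "i (x \<oplus>\<^bsub>A\<^esub> y) = i x \<oplus>\<^bsub>B\<^esub> i y" "p (i x) = \<zero>\<^bsub>C\<^esub>"
    if "x \<in> carrier A" "y \<in> carrier A" for x y
    using i that exact by (auto simp: module_hom_def)
  have i_smult: "i (frag_of g \<odot>\<^bsub>A\<^esub> x) = frag_of g \<odot>\<^bsub>B\<^esub> i x" if "x \<in> carrier A" "g \<in> carrier G" for x g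
    using i that by (auto simp: module_hom_def)
  have p': "p x \<in> carrier C" "p (x \<oplus>\<^bsub>B\<^esub> y) = p x \<oplus>\<^bsub>C\<^esub> p y" if "x \<in> carrier B" "y \<in> carrier B" for x y
    using p that by (auto simp: module_hom_def)
  have p_smult: "p (frag_of g \<odot>\<^bsub>B\<^esub> x) = frag_of g \<odot>\<^bsub>C\<^esub> p x" if "x \<in> carrier B" "g \<in> carrier G" for x g
    using p that by (auto simp: module_hom_def)
  have cl: "frag_of g \<odot>\<^bsub>A\<^esub> x \<in> carrier A" if "g \<in> carrier G" "x \<in> carrier A" for g x
    using that by (intro A.smult_closed) auto
  have clB: "frag_of g \<odot>\<^bsub>B\<^esub> x \<in> carrier B" if "g \<in> carrier G" "x \<in> carrier B" for g x
    using that by (intro B.smult_closed) auto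
  define T where "T f = (\<lambda>x. if x \<in> carrier A then f (i x) else 0)" for f :: "_ \<Rightarrow> rat"
  define S where "S h = (\<lambda>x. if x \<in> carrier B then h (p x) else 0)" for h :: "_ \<Rightarrow> rat"
  interpret T: linear_map "class_ring :: rat ring" "inv_functionals G B" "inv_functionals G A" T
    by (rule linear_map_inv_functionals)
      (auto simp: T_def mem_inv_functionals i' i_smult cl fun_eq_iff)
  interpret S: linear_map "class_ring :: rat ring" "inv_functionals G C" "inv_functionals G B" S
    by (rule linear_map_inv_functionals)
      (auto simp: S_def mem_inv_functionals p' p_smult clB fun_eq_iff)
  have fdB: "T.V.fin_dim"
    using inv_functionals_fin_dim[OF fg B.M.abelian_group_axioms] .
  have injS: "inj_on S (carrier (inv_functionals G C))"
  proof (rule inj_onI)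
    fix h k assume hk: "h \<in> carrier (inv_functionals G C)" "k \<in> carrier (inv_functionals G C)" "S h = S k"
    show "h = k"
    proof
      fix y show "h y = k y"
      proof (cases "y \<in> carrier C")
        case True
        then obtain x where "x \<in> carrier B" "y = p x" using surj by blast
        then show ?thesis using fun_cong[OF hk(3), of x] by (simp add: S_def)
      next
        case False
        then show ?thesis using hk by (simp add: mem_inv_functionals)
      qed
    qed
  qed
  have fdC: "S.V.fin_dim" using S.inj_fin_dim fdB injS by simp
  have imT: "T.imT = carrier (inv_functionals G A)"
  proof
    show "T.imT \<subseteq> carrier (inv_functionals G A)" by (auto simp: T.im_def)
    show "carrier (inv_functionals G A) \<subseteq> T.imT"
    proof
      fix f assume f: "f \<in> carrier (inv_functionals G A)"
      from inv_functional_extend[OF G mods(2) fg mods(1) i inj f]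
      obtain F where F: "F \<in> carrier (inv_functionals G B)" "\<And>x. x \<in> carrier A \<Longrightarrow> F (i x) = f x" by blast
      have "T F = f" using F f by (auto simp: T_def mem_inv_functionals fun_eq_iff)
      then show "f \<in> T.imT" using F by (auto simp: T.im_def)
    qed
  qed
  have imS: "S ` carrier (inv_functionals G C) = T.kerT"
  proof (intro equalityI subsetI)
    fix f assume "f \<in> S ` carrier (inv_functionals G C)"
    then obtain h where h: "h \<in> carrier (inv_functionals G C)" "f = S h" by blast
    have "h \<zero>\<^bsub>C\<^esub> = 0"
    proof -
      have "h (\<zero>\<^bsub>C\<^esub> \<oplus>\<^bsub>C\<^esub> \<zero>\<^bsub>C\<^esub>) = h \<zero>\<^bsub>C\<^esub> + h \<zero>\<^bsub>C\<^esub>"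
        using h(1) C.M.zero_closed unfolding mem_inv_functionals by blast
      then show ?thesis by simp
    qed
    then have "T f = (\<lambda>x. 0)" using i' by (auto simp: T_def S_def h(2) fun_eq_iff)
    then show "f \<in> T.kerT" using h S.T_im by (simp add: T.ker_def)
  next
    fix f assume "f \<in> T.kerT"
    then have f: "f \<in> carrier (inv_functionals G B)" "T f = (\<lambda>x. 0)" by (auto simp: T.ker_def)
    have fi: "f (i x) = 0" if "x \<in> carrier A" for x
      using fun_cong[OF f(2), of x] that by (simp add: T_def)
    have f0: "f x = 0" if "x \<in> carrier B" "p x = \<zero>\<^bsub>C\<^esub>" for x
    proof -
      have "x \<in> i ` carrier A" using that exact by blast
      then show ?thesis using fi by blast
    qed
    have fB: "f (x \<oplus>\<^bsub>B\<^esub> y) = f x + f y" if "x \<in> carrier B" "y \<in> carrier B" for x y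
      using f that by (simp add: mem_inv_functionals)
    \<comment> \<open>A functional that kills the kernel of \<open>p\<close> is constant on the
      fibres of \<open>p\<close>: the difference of two points of a fibre lies in that kernel. Hence
      it descends to \<open>C\<close>.\<close>
    have eq: "f x = f y" if xy: "x \<in> carrier B" "y \<in> carrier B" "p x = p y" for x y
    proof -
      have "p (\<ominus>\<^bsub>B\<^esub> y \<oplus>\<^bsub>B\<^esub> x) = p (\<ominus>\<^bsub>B\<^esub> y \<oplus>\<^bsub>B\<^esub> y)"
        using xy p'[of "\<ominus>\<^bsub>B\<^esub> y"] by simp
      also have "\<dots> = \<zero>\<^bsub>C\<^esub>"
        using p'[of "\<zero>\<^bsub>B\<^esub>" "\<zero>\<^bsub>B\<^esub>"] xy by (simp add: B.M.l_neg)
      finally have "f (\<ominus>\<^bsub>B\<^esub> y \<oplus>\<^bsub>B\<^esub> x) = 0" using xy by (intro f0) auto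
      moreover have "f (\<ominus>\<^bsub>B\<^esub> y \<oplus>\<^bsub>B\<^esub> y) = 0"
        using xy p'[of "\<zero>\<^bsub>B\<^esub>" "\<zero>\<^bsub>B\<^esub>"] fB[of "\<zero>\<^bsub>B\<^esub>" "\<zero>\<^bsub>B\<^esub>"] by (simp add: B.M.l_neg)
      ultimately show ?thesis
        using fB[of "\<ominus>\<^bsub>B\<^esub> y" x] fB[of "\<ominus>\<^bsub>B\<^esub> y" y] xy by simp
    qed
    define h where "h y = (if y \<in> carrier C then f (inv_into (carrier B) p y) else 0)" for y
    have hp: "h (p x) = f x" if "x \<in> carrier B" for x
    proof -
      have "inv_into (carrier B) p (p x) \<in> carrier B" "p (inv_into (carrier B) p (p x)) = p x"
        using that by (auto intro: inv_into_into f_inv_into_f)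
      then show ?thesis
        using eq[of "inv_into (carrier B) p (p x)" x] that p'(1)[of x x] by (simp add: h_def)
    qed
    have "h \<in> carrier (inv_functionals G C)"
      unfolding mem_inv_functionals
    proof (intro conjI ballI allI impI)
      fix y z assume "y \<in> carrier C" "z \<in> carrier C"
      then obtain x w where "x \<in> carrier B" "y = p x" "w \<in> carrier B" "z = p w" using surj by blast
      then show "h (y \<oplus>\<^bsub>C\<^esub> z) = h y + h z"
        using hp[of "x \<oplus>\<^bsub>B\<^esub> w"] by (simp add: hp p' fB)
    next
      fix g y assume "g \<in> carrier G" "y \<in> carrier C"
      moreover then obtain x where "x \<in> carrier B" "y = p x" using surj by blast
      ultimately show "h (frag_of g \<odot>\<^bsub>C\<^esub> y) = h y"
        using hp[of "frag_of g \<odot>\<^bsub>B\<^esub> x"] f(1) by (simp add: hp p_smult clB mem_inv_functionals)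
    qed (simp add: h_def)
    moreover have "S h = f" using f(1) by (auto simp: S_def hp mem_inv_functionals fun_eq_iff)
    ultimately show "f \<in> S ` carrier (inv_functionals G C)" by blast
  qed
  \<comment> \<open>\<open>S\<close> is now read as a bijective linear map onto the kernel of
    \<open>T\<close>, which turns the nullity of \<open>T\<close> into the rank of
    \<open>C\<close>.\<close>
  have vs_ker: "vectorspace (class_ring :: rat ring) (T.V.vs T.kerT)"
    by (intro T.V.subspace_is_vs T.kerT_is_subspace)
  have "linear_map (class_ring :: rat ring) (inv_functionals G C) (T.V.vs T.kerT) S"
    using vs_ker S.f_hom imS S.V.vectorspace_axioms
    by (intro linear_map.intro mod_hom.intro mod_hom_axioms.intro)
      (auto simp: module_hom_def vectorspace_def)
  from linear_map.dim_eq[OF this fdC injS] imS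
  have "vectorspace.dim (class_ring :: rat ring) (T.V.vs T.kerT) = inv_rank G C"
    by (simp add: inv_rank_def)
  moreover have "T.W.vs T.imT = inv_functionals G A" unfolding imT by simp
  ultimately show ?thesis
    using T.rank_nullity[OF fdB] by (simp add: inv_rank_def)
qed

section \<open>Classes of modules of arbitrary type\<close>

lemma module_hom_inv_into:
  assumes A: "left_module R A" and f: "f \<in> module_hom R A B" "bij_betw f (carrier A) (carrier B)"
  shows "inv_into (carrier A) f \<in> module_hom R B A"
proof -
  interpret A: left_module R A by fact
  have surj: "f ` carrier A = carrier B" and inj: "inj_on f (carrier A)"
    using f(2) by (auto simp: bij_betw_def)
  have cl: "inv_into (carrier A) f y \<in> carrier A" "f (inv_into (carrier A) f y) = y"
    if "y \<in> carrier B" for y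
    using that surj by (auto intro: inv_into_into f_inv_into_f)
  have eq: "inv_into (carrier A) f y = x" if "x \<in> carrier A" "f x = y" for x y
    using that inj by auto
  show ?thesis
    unfolding module_hom_def
  proof (intro CollectI conjI allI impI; (elim conjE)?)
    show "inv_into (carrier A) f \<in> carrier B \<rightarrow> carrier A" using cl by blast
    fix y z assume yz: "y \<in> carrier B" "z \<in> carrier B"
    show "inv_into (carrier A) f (y \<oplus>\<^bsub>B\<^esub> z) = inv_into (carrier A) f y \<oplus>\<^bsub>A\<^esub> inv_into (carrier A) f z"
      using f(1) cl[OF yz(1)] cl[OF yz(2)] by (intro eq) (auto simp: module_hom_def)
  next
    fix r y assume ry: "r \<in> carrier R" "y \<in> carrier B"
    show "inv_into (carrier A) f (r \<odot>\<^bsub>B\<^esub> y) = r \<odot>\<^bsub>A\<^esub> inv_into (carrier A) f y"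
      using f(1) cl[OF ry(2)] ry(1) by (intro eq) (auto simp: module_hom_def intro: A.smult_closed)
  qed
qed

lemma module_hom_comp:
  "f \<in> module_hom R A B \<Longrightarrow> g \<in> module_hom R B C \<Longrightarrow> g \<circ> f \<in> module_hom R A C"
  by (simp add: module_hom_def Pi_iff)

definition module_iso :: "('r, 'n) ring_scheme \<Rightarrow> ('r, 'm1) module \<Rightarrow> ('r, 'm2) module \<Rightarrow> bool" where
  "module_iso R A B \<longleftrightarrow> (\<exists>f\<in>module_hom R A B. bij_betw f (carrier A) (carrier B))"

lemma module_iso_sym:
  assumes "left_module R A" "module_iso R A B" shows "module_iso R B A"
proof -
  obtain f where "f \<in> module_hom R A B" "bij_betw f (carrier A) (carrier B)"
    using assms(2) unfolding module_iso_def by (elim bexE)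
  then show ?thesis
    unfolding module_iso_def
    by (intro bexI[of _ "inv_into (carrier A) f"] module_hom_inv_into[OF assms(1)] bij_betw_inv_into)
qed

lemma module_iso_trans:
  assumes "module_iso R A B" "module_iso R B C" shows "module_iso R A C"
proof -
  obtain f where "f \<in> module_hom R A B" "bij_betw f (carrier A) (carrier B)"
    using assms(1) unfolding module_iso_def by (elim bexE)
  moreover obtain g where "g \<in> module_hom R B C" "bij_betw g (carrier B) (carrier C)"
    using assms(2) unfolding module_iso_def by (elim bexE)
  ultimately show ?thesis
    unfolding module_iso_def by (intro bexI[of _ "g \<circ> f"] module_hom_comp bij_betw_trans)
qed

lemma module_iso_restrict_scalars:
  assumes "module_iso S A B" "\<phi> \<in> Ring.ring_hom R S"
  shows "module_iso R (restrict_scalars \<phi> A) (restrict_scalars \<phi> B)"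
proof -
  obtain f where "f \<in> module_hom S A B" "bij_betw f (carrier A) (carrier B)"
    using assms(1) unfolding module_iso_def by (elim bexE)
  then show ?thesis
    unfolding module_iso_def restrict_scalars_simps
    by (intro bexI[of _ f] module_hom_restrict_scalars[OF _ assms(2)])
qed

lemma short_exact_iso:
  assumes A: "left_module R A" and B: "left_module R B" and C: "left_module R C" "left_module R C'"
    and iso: "module_iso R A A'" "module_iso R B B'" "module_iso R C C'" and ex: "short_exact R A B C"
  shows "short_exact R A' B' C'"
proof -
  interpret C: left_module R C by fact
  interpret C': left_module R C' by fact
  obtain \<alpha> where \<alpha>: "\<alpha> \<in> module_hom R A' A" "bij_betw \<alpha> (carrier A') (carrier A)"
    using module_iso_sym[OF A iso(1)] unfolding module_iso_def by (elim bexE)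
  obtain \<beta> where \<beta>: "\<beta> \<in> module_hom R B B'" "bij_betw \<beta> (carrier B) (carrier B')"
    using iso(2) unfolding module_iso_def by (elim bexE)
  obtain \<gamma> where \<gamma>: "\<gamma> \<in> module_hom R C C'" "bij_betw \<gamma> (carrier C) (carrier C')"
    using iso(3) unfolding module_iso_def by (elim bexE)
  obtain i p where i: "i \<in> module_hom R A B" "inj_on i (carrier A)"
    and p: "p \<in> module_hom R B C" "p ` carrier B = carrier C"
    and exact: "i ` carrier A = {m \<in> carrier B. p m = \<zero>\<^bsub>C\<^esub>}"
    using ex unfolding short_exact_def by (elim bexE conjE)
  let ?b = "inv_into (carrier B) \<beta>"
  have b: "?b \<in> module_hom R B' B" "bij_betw ?b (carrier B') (carrier B)"
    using module_hom_inv_into[OF B \<beta>] bij_betw_inv_into[OF \<beta>(2)] by auto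
  have b\<beta>: "?b (\<beta> x) = x" if "x \<in> carrier B" for x
    using \<beta>(2) that by (simp add: bij_betw_def)
  have \<beta>b: "\<beta> (?b y) = y" "?b y \<in> carrier B" if "y \<in> carrier B'" for y
    using \<beta>(2) that by (auto simp: bij_betw_def f_inv_into_f inv_into_into)
  have "\<gamma> \<zero>\<^bsub>C\<^esub> \<oplus>\<^bsub>C'\<^esub> \<gamma> \<zero>\<^bsub>C\<^esub> = \<gamma> \<zero>\<^bsub>C\<^esub>" "\<gamma> \<zero>\<^bsub>C\<^esub> \<in> carrier C'"
    using \<gamma>(1) module_hom_add[OF \<gamma>(1), of "\<zero>\<^bsub>C\<^esub>" "\<zero>\<^bsub>C\<^esub>"] by (auto simp: module_hom_def)
  then have \<gamma>0: "\<gamma> \<zero>\<^bsub>C\<^esub> = \<zero>\<^bsub>C'\<^esub>" by simp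
  have \<gamma>0_iff: "\<gamma> c = \<zero>\<^bsub>C'\<^esub> \<longleftrightarrow> c = \<zero>\<^bsub>C\<^esub>" if "c \<in> carrier C" for c
    using \<gamma>(2) \<gamma>0 that by (metis C.M.zero_closed bij_betw_def inj_onD)
  have p_closed: "p x \<in> carrier C" if "x \<in> carrier B" for x using p(2) that by blast
  show ?thesis
    unfolding short_exact_def
  proof (intro bexI[of _ "\<beta> \<circ> (i \<circ> \<alpha>)"] bexI[of _ "\<gamma> \<circ> (p \<circ> ?b)"] conjI)
    show "\<beta> \<circ> (i \<circ> \<alpha>) \<in> module_hom R A' B'"
      by (rule module_hom_comp[OF module_hom_comp[OF \<alpha>(1) i(1)] \<beta>(1)])
    show "\<gamma> \<circ> (p \<circ> ?b) \<in> module_hom R B' C'"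
      by (rule module_hom_comp[OF module_hom_comp[OF b(1) p(1)] \<gamma>(1)])
    have "inj_on (i \<circ> \<alpha>) (carrier A')" using \<alpha>(2) i(2) by (simp add: bij_betw_def comp_inj_on)
    moreover have "(i \<circ> \<alpha>) ` carrier A' \<subseteq> carrier B"
      using \<alpha>(2) exact by (simp only: bij_betw_def image_comp[symmetric]) auto
    ultimately show "inj_on (\<beta> \<circ> (i \<circ> \<alpha>)) (carrier A')"
      using \<beta>(2) comp_inj_on[of "i \<circ> \<alpha>" "carrier A'" \<beta>] inj_on_subset[of \<beta> "carrier B"]
      by (simp add: bij_betw_def)
    have "(\<beta> \<circ> (i \<circ> \<alpha>)) ` carrier A' = \<beta> ` {m \<in> carrier B. p m = \<zero>\<^bsub>C\<^esub>}"
      by (simp only: image_comp[symmetric] exact bij_betw_imp_surj_on[OF \<alpha>(2)])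
    also have "\<dots> = {m \<in> carrier B'. (\<gamma> \<circ> (p \<circ> ?b)) m = \<zero>\<^bsub>C'\<^esub>}"
    proof (intro equalityI subsetI)
      fix y assume "y \<in> \<beta> ` {m \<in> carrier B. p m = \<zero>\<^bsub>C\<^esub>}"
      then obtain x where "x \<in> carrier B" "p x = \<zero>\<^bsub>C\<^esub>" "y = \<beta> x" by auto
      then show "y \<in> {m \<in> carrier B'. (\<gamma> \<circ> (p \<circ> ?b)) m = \<zero>\<^bsub>C'\<^esub>}"
        using \<beta>(2) by (auto simp: b\<beta> \<gamma>0 bij_betw_def)
    next
      fix y assume "y \<in> {m \<in> carrier B'. (\<gamma> \<circ> (p \<circ> ?b)) m = \<zero>\<^bsub>C'\<^esub>}"
      then have y: "y \<in> carrier B'" "\<gamma> (p (?b y)) = \<zero>\<^bsub>C'\<^esub>" by auto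
      then have "?b y \<in> {m \<in> carrier B. p m = \<zero>\<^bsub>C\<^esub>}"
        using \<beta>b[of y] p_closed \<gamma>0_iff[of "p (?b y)"] by auto
      then show "y \<in> \<beta> ` {m \<in> carrier B. p m = \<zero>\<^bsub>C\<^esub>}"
        using \<beta>b[OF y(1)] by (intro image_eqI[of _ _ "?b y"]) auto
    qed
    finally show "(\<beta> \<circ> (i \<circ> \<alpha>)) ` carrier A' = {m \<in> carrier B'. (\<gamma> \<circ> (p \<circ> ?b)) m = \<zero>\<^bsub>C'\<^esub>}" .
    show "(\<gamma> \<circ> (p \<circ> ?b)) ` carrier B' = carrier C'"
      by (simp only: image_comp[symmetric] p(2) bij_betw_imp_surj_on[OF b(2)] bij_betw_imp_surj_on[OF \<gamma>(2)])
  qed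
qed

text \<open>The zero module is built on the underlying type of \<open>A\<close>, so that the
  sequence 0, 0, A, B, 0 is available for modules on any type.\<close>

lemma left_module_zero_submodule:
  fixes A :: "('r, 'm) module"
  assumes "left_module R A" shows "left_module R (A\<lparr>carrier := {\<zero>\<^bsub>A\<^esub>}\<rparr>)"
proof -
  interpret A: left_module R A by fact
  have "abelian_group (A\<lparr>carrier := {\<zero>\<^bsub>A\<^esub>}\<rparr>)"
    by (rule abelian_groupI) auto
  then show ?thesis
    by (intro left_module.intro left_module_axioms.intro A.R.ring_axioms)
      (auto simp: A.smult_r_null)
qed

lemma fg_additive_zero_submodule: "fg_additive (A\<lparr>carrier := {\<zero>\<^bsub>A\<^esub>}\<rparr>)"
  by (auto simp: fg_additive_def intro!: exI[of _ "{}"])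

lemma short_exact_zero_iso:
  fixes A :: "('r, 'm) module"
  assumes A: "left_module R A" and B: "left_module R B" and iso: "module_iso R A B"
  shows "short_exact R (A\<lparr>carrier := {\<zero>\<^bsub>A\<^esub>}\<rparr>) A B"
proof -
  interpret A: left_module R A by fact
  interpret B: left_module R B by fact
  obtain f where f: "f \<in> module_hom R A B" "bij_betw f (carrier A) (carrier B)"
    using iso unfolding module_iso_def by (elim bexE)
  have "f \<zero>\<^bsub>A\<^esub> \<oplus>\<^bsub>B\<^esub> f \<zero>\<^bsub>A\<^esub> = f \<zero>\<^bsub>A\<^esub>" "f \<zero>\<^bsub>A\<^esub> \<in> carrier B"
    using f(1) module_hom_add[OF f(1), of "\<zero>\<^bsub>A\<^esub>" "\<zero>\<^bsub>A\<^esub>"] by (auto simp: module_hom_def)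
  then have f0: "f \<zero>\<^bsub>A\<^esub> = \<zero>\<^bsub>B\<^esub>" by simp
  have f0_iff: "f x = \<zero>\<^bsub>B\<^esub> \<longleftrightarrow> x = \<zero>\<^bsub>A\<^esub>" if "x \<in> carrier A" for x
    using f(2) f0 that by (metis A.M.zero_closed bij_betw_def inj_onD)
  show ?thesis
    unfolding short_exact_def
  proof (intro bexI[of _ "\<lambda>x. x"] bexI[of _ f] conjI)
    show "(\<lambda>x. x) ` carrier (A\<lparr>carrier := {\<zero>\<^bsub>A\<^esub>}\<rparr>) = {m \<in> carrier A. f m = \<zero>\<^bsub>B\<^esub>}"
      using f0_iff by auto
    show "f ` carrier A = carrier B" using f(2) by (simp add: bij_betw_def)
  qed (use f in \<open>auto simp: module_hom_def\<close>)
qed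

lemma module_iso_refl: "module_iso R A A"
  unfolding module_iso_def by (intro bexI[of _ "\<lambda>x. x"]) (auto simp: module_hom_def bij_betw_def)

interpretation G_relations: frag_subgroup "fg_modules R" "G_relations R" for R
  unfolding G_relations_def
  by (rule frag_subgroup_generate) (auto dest!: subsetD[OF keys_diff])

lemma G_relations_short_exact:
  "A \<in> fg_modules R \<Longrightarrow> B \<in> fg_modules R \<Longrightarrow> C \<in> fg_modules R \<Longrightarrow> short_exact R A B C \<Longrightarrow>
    frag_of B - frag_of A - frag_of C \<in> G_relations R"
  unfolding G_relations_def by (intro generate.incl) blast

text \<open>With Z the zero module, the sequence Z, A, B gives [A] = [Z] + [B] and the sequence Z,
  Z, Z gives [Z] = 0; the difference of the two relations is the claim.\<close>

lemma G_relations_iso: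
  assumes "A \<in> fg_modules R" "B \<in> fg_modules R" "module_iso R A B"
  shows "frag_of A - frag_of B \<in> G_relations R"
proof -
  let ?Z = "A\<lparr>carrier := {\<zero>\<^bsub>A\<^esub>}\<rparr>"
  have A: "left_module R A" and B: "left_module R B"
    using assms(1,2) by (auto simp: fg_modules_iff fg_module_def)
  have Z: "left_module R ?Z" by (rule left_module_zero_submodule[OF A])
  have Z': "?Z \<in> fg_modules R"
    using Z by (simp add: fg_modules_iff fg_moduleI fg_additive_zero_submodule)
  have "frag_of ?Z - frag_of ?Z - frag_of ?Z \<in> G_relations R"
    using short_exact_zero_iso[OF Z Z module_iso_refl] Z' by (intro G_relations_short_exact) auto
  moreover have "frag_of A - frag_of ?Z - frag_of B \<in> G_relations R"
    using short_exact_zero_iso[OF A B assms(3)] Z' assms by (intro G_relations_short_exact) auto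
  ultimately show ?thesis
    using G_relations.diff_mem[of "frag_of A - frag_of ?Z - frag_of B" R "frag_of ?Z - frag_of ?Z - frag_of ?Z"]
    by simp
qed

text \<open>The group \<open>G_group R\<close> is built from modules on the naturals only, whereas
  permutation modules live on formal sums. They enter through a chosen isomorphic copy; by
  \<open>nat_copy_iso\<close> its class does not depend on the choice.\<close>

definition nat_copy :: "('r, 'n) ring_scheme \<Rightarrow> ('r, 'm) module \<Rightarrow> ('r, nat) module" where
  "nat_copy R M = (SOME N. N \<in> fg_modules R \<and> module_iso R M N)"

lemma nat_copy:
  assumes "fg_module R M" "countable (carrier R)"
  shows "nat_copy R M \<in> fg_modules R" "module_iso R M (nat_copy R M)"
proof -
  from assms have "left_module R M" "fin_gen_module R M" by (simp_all add: fg_module_def)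
  from fin_gen_module_nat_copy[OF this assms(2)]
  have "\<exists>N. N \<in> fg_modules R \<and> module_iso R M N"
    by (simp only: Bex_def module_iso_def)
  then have "nat_copy R M \<in> fg_modules R \<and> module_iso R M (nat_copy R M)"
    unfolding nat_copy_def by (rule someI_ex)
  then show "nat_copy R M \<in> fg_modules R" "module_iso R M (nat_copy R M)" by auto
qed

lemma nat_copy_iso:
  assumes "fg_module R M" "countable (carrier R)" "N \<in> fg_modules R" "module_iso R M N"
  shows "frag_of (nat_copy R M) - frag_of N \<in> G_relations R"
proof (rule G_relations_iso)
  show "nat_copy R M \<in> fg_modules R" using nat_copy[OF assms(1,2)] by simp
  show "module_iso R (nat_copy R M) N"
    using assms(1) by (intro module_iso_trans[OF module_iso_sym[OF _ nat_copy(2)[OF assms(1,2)]] assms(4)])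
      (simp add: fg_module_def)
qed (rule assms)

lemma nat_copy_cong:
  assumes "fg_module R A" "fg_module R B" "countable (carrier R)" "module_iso R A B"
  shows "frag_of (nat_copy R A) - frag_of (nat_copy R B) \<in> G_relations R"
  by (rule nat_copy_iso[OF assms(1,3) nat_copy(1)[OF assms(2,3)]
        module_iso_trans[OF assms(4) nat_copy(2)[OF assms(2,3)]]])

lemma nat_copy_short_exact:
  assumes "fg_module R A" "fg_module R B" "fg_module R C" "countable (carrier R)" "short_exact R A B C"
  shows "frag_of (nat_copy R B) - frag_of (nat_copy R A) - frag_of (nat_copy R C) \<in> G_relations R"
proof (rule G_relations_short_exact)
  show "short_exact R (nat_copy R A) (nat_copy R B) (nat_copy R C)"
    using assms(1-3) nat_copy(1)[OF assms(3,4)]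
    by (intro short_exact_iso[OF _ _ _ _ nat_copy(2)[OF assms(1,4)] nat_copy(2)[OF assms(2,4)]
          nat_copy(2)[OF assms(3,4)] assms(5)]) (simp_all add: fg_module_def fg_modules_iff)
qed (fact nat_copy(1)[OF assms(1,4)] nat_copy(1)[OF assms(2,4)] nat_copy(1)[OF assms(3,4)])+

text \<open>Follows from additivity on the sequence 0, A, B, once additivity on 0, 0, 0 has shown
  that the zero module has rank 0.\<close>

lemma inv_rank_iso:
  assumes G: "group G" "finite (carrier G)" and A: "fg_module (group_ring G) A" and B: "left_module (group_ring G) B"
    and iso: "module_iso (group_ring G) A B"
  shows "inv_rank G A = inv_rank G B"
proof -
  let ?Z = "A\<lparr>carrier := {\<zero>\<^bsub>A\<^esub>}\<rparr>"
  have A': "left_module (group_ring G) A" "fg_additive A"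
    using A fin_gen_imp_fg_additive[OF G] by (auto simp: fg_module_def)
  have Z: "left_module (group_ring G) ?Z" by (rule left_module_zero_submodule[OF A'(1)])
  have "inv_rank G ?Z = inv_rank G ?Z + inv_rank G ?Z"
    using short_exact_zero_iso[OF Z Z module_iso_refl] Z
    by (intro inv_rank_short_exact[OF G]) (auto simp: fg_additive_zero_submodule)
  moreover have "inv_rank G A = inv_rank G ?Z + inv_rank G B"
    by (intro inv_rank_short_exact[OF G Z A'(1) B A'(2)] short_exact_zero_iso A'(1) B iso)
  ultimately show ?thesis by simp
qed

text \<open>This makes the rank a well-defined additive function on the Grothendieck group, so it
  may be read off any representative of a coset.\<close>

lemma rat_extend_inv_rank_relations:
  assumes G: "group G" "finite (carrier G)" and u: "u \<in> G_relations (group_ring G)"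
  shows "rat_extend (\<lambda>M. of_nat (inv_rank G M)) u = 0"
proof -
  let ?S = "fg_modules (group_ring G)"
  let ?Q = "{frag_of M - frag_of M' - frag_of M'' | M' M M''. M' \<in> ?S \<and> M \<in> ?S \<and> M'' \<in> ?S \<and>
     short_exact (group_ring G) M' M M''}"
  have "?Q \<subseteq> carrier (free_Abelian_group ?S)"
    by (auto dest!: subsetD[OF keys_diff])
  with u show ?thesis unfolding G_relations_def
  proof (induction rule: generate_free_Abelian_group_induct)
    case (incl q)
    then obtain A B C where q: "q = frag_of B - frag_of A - frag_of C" "A \<in> ?S" "B \<in> ?S" "C \<in> ?S"
      and "short_exact (group_ring G) A B C"
      by (elim CollectE exE conjE)
    then have "inv_rank G B = inv_rank G A + inv_rank G C"
      by (intro inv_rank_short_exact[OF G]) (auto simp: fg_modules_iff fg_module_def fin_gen_imp_fg_additive[OF G])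
    then show ?case by (simp add: q(1) rat_extend_diff)
  qed (auto simp: rat_extend_diff)
qed


section \<open>Pullback along a homomorphism of finite groups\<close>

text \<open>Inclusions and conjugations are both instances of \<open>c\<close>, so the two
  conditions that define the inverse limit are handled by one argument.\<close>

locale finite_group_hom = H: group H + K: group K for H :: "('a, 'b) monoid_scheme" and K :: "('a, 'c) monoid_scheme" +
  fixes c :: "'a \<Rightarrow> 'a"
  assumes finite_H: "finite (carrier H)" and finite_K: "finite (carrier K)" and c_hom: "c \<in> hom H K"
begin

definition \<phi> :: "('a \<Rightarrow>\<^sub>0 int) \<Rightarrow> ('a \<Rightarrow>\<^sub>0 int)" where "\<phi> = frag_extend (\<lambda>h. frag_of (c h))"

definition pull :: "(('a \<Rightarrow>\<^sub>0 int, nat) module \<Rightarrow>\<^sub>0 int) \<Rightarrow> (('a \<Rightarrow>\<^sub>0 int, nat) module \<Rightarrow>\<^sub>0 int)" where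
  "pull = frag_extend (\<lambda>M. frag_of (restrict_scalars \<phi> M))"

lemma \<phi>_hom: "\<phi> \<in> Ring.ring_hom (group_ring H) (group_ring K)"
  unfolding \<phi>_def by (intro group_ring_hom H.is_group K.is_group c_hom)

lemma fg_restrict:
  fixes M :: "('a \<Rightarrow>\<^sub>0 int, 'm) module"
  shows "fg_module (group_ring K) M \<Longrightarrow> fg_module (group_ring H) (restrict_scalars \<phi> M)"
  unfolding \<phi>_def by (rule fg_module_restrict_scalars[OF H.is_group K.is_group finite_K c_hom])

lemma pull_add: "pull (u + v) = pull u + pull v"
  by (simp add: pull_def frag_extend_add)

lemma pull_diff: "pull (u - v) = pull u - pull v"
  by (simp add: pull_def frag_extend_diff)

lemma pull_relations:
  assumes "u \<in> G_relations (group_ring K)" shows "pull u \<in> G_relations (group_ring H)"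
proof -
  let ?S = "fg_modules (group_ring K)"
  let ?Q = "{frag_of M - frag_of M' - frag_of M'' | M' M M''. M' \<in> ?S \<and> M \<in> ?S \<and> M'' \<in> ?S \<and>
     short_exact (group_ring K) M' M M''}"
  have "?Q \<subseteq> carrier (free_Abelian_group ?S)"
    by (auto dest!: subsetD[OF keys_diff])
  with assms show ?thesis unfolding G_relations_def[of "group_ring K"]
  proof (induction rule: generate_free_Abelian_group_induct)
    case (incl q)
    then obtain A B C where q: "q = frag_of B - frag_of A - frag_of C" "A \<in> ?S" "B \<in> ?S" "C \<in> ?S"
      and ex: "short_exact (group_ring K) A B C"
      by (elim CollectE exE conjE)
    have "frag_of (restrict_scalars \<phi> B) - frag_of (restrict_scalars \<phi> A) - frag_of (restrict_scalars \<phi> C)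
        \<in> G_relations (group_ring H)"
      using q(2-4) by (intro G_relations_short_exact short_exact_restrict_scalars[OF ex \<phi>_hom])
        (auto simp: fg_modules_iff fg_restrict)
    then show ?case by (simp add: q(1) pull_def frag_extend_diff)
  next
    case (diff a b)
    then show ?case by (simp add: pull_diff G_relations.diff_mem)
  qed (simp add: pull_def)
qed

lemma G_restrict_coset:
  "G_restrict (group_ring H) \<phi> (G_relations (group_ring K) #>\<^bsub>free_Abelian_group (fg_modules (group_ring K))\<^esub> u)
     = G_relations (group_ring H) #>\<^bsub>free_Abelian_group (fg_modules (group_ring H))\<^esub> pull u"
proof -
  have "G_relations (group_ring H) <#>\<^bsub>free_Abelian_group (fg_modules (group_ring H))\<^esub>
      (pull ` (G_relations (group_ring K) #>\<^bsub>free_Abelian_group (fg_modules (group_ring K))\<^esub> u))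
     = G_relations (group_ring H) #>\<^bsub>free_Abelian_group (fg_modules (group_ring H))\<^esub> pull u"
    by (rule G_relations.image_coset) (auto simp: pull_add pull_relations, simp add: pull_def)
  then show ?thesis unfolding G_restrict_def pull_def .
qed

text \<open>Choosing a copy and restricting scalars need not commute, but the two results are
  isomorphic modules and so have the same class.\<close>

lemma pull_nat_copy:
  fixes M :: "('a \<Rightarrow>\<^sub>0 int, 'm) module"
  assumes "fg_module (group_ring K) M"
  shows "pull (frag_of (nat_copy (group_ring K) M)) -
     frag_of (nat_copy (group_ring H) (restrict_scalars \<phi> M)) \<in> G_relations (group_ring H)"
proof -
  note ctH = countable_group_ring[OF finite_H] and ctK = countable_group_ring[OF finite_K]
  note cp = nat_copy[OF assms ctK]
  have "frag_of (nat_copy (group_ring H) (restrict_scalars \<phi> M)) -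
      frag_of (restrict_scalars \<phi> (nat_copy (group_ring K) M)) \<in> G_relations (group_ring H)"
    using cp by (intro nat_copy_iso fg_restrict assms ctH module_iso_restrict_scalars[OF _ \<phi>_hom])
      (auto simp: fg_modules_iff fg_restrict)
  from G_relations.minus_mem[OF this] show ?thesis by (simp add: pull_def)
qed

end

section \<open>Permutation modules\<close>

definition perm_module :: "'x set \<Rightarrow> ('a \<Rightarrow> 'x \<Rightarrow> 'x) \<Rightarrow> ('a \<Rightarrow>\<^sub>0 int, 'x \<Rightarrow>\<^sub>0 int) module" where
  "perm_module X act =
     \<lparr>carrier = {u. Poly_Mapping.keys u \<subseteq> X}, mult = undefined, one = undefined, zero = 0, add = (+),
      smult = (\<lambda>r u. frag_extend (\<lambda>g. frag_extend (\<lambda>x. frag_of (act g x)) u) r)\<rparr>"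

lemma perm_module_simps [simp]:
  "carrier (perm_module X act) = {u. Poly_Mapping.keys u \<subseteq> X}"
  "\<zero>\<^bsub>perm_module X act\<^esub> = 0" "u \<oplus>\<^bsub>perm_module X act\<^esub> v = u + v"
  "r \<odot>\<^bsub>perm_module X act\<^esub> u = frag_extend (\<lambda>g. frag_extend (\<lambda>x. frag_of (act g x)) u) r"
  by (simp_all add: perm_module_def)

lemma restrict_scalars_perm_module:
  "restrict_scalars (frag_extend (\<lambda>h. frag_of (c h))) (perm_module X act) = perm_module X (\<lambda>h. act (c h))"
  using frag_extend_compose[of "\<lambda>g. frag_extend (\<lambda>x. frag_of (act g x)) u" c for u]
  by (simp add: restrict_scalars_def perm_module_def o_def)

lemma lookup_frag_extend_if:
  "Poly_Mapping.lookup (frag_extend (\<lambda>x. if x \<in> Z then frag_of x else 0) u) k =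
     (if k \<in> Z then Poly_Mapping.lookup u k else 0)"
proof -
  have "Poly_Mapping.keys u \<subseteq> UNIV" by simp
  then show ?thesis
    by (induction u rule: frag_induction) (auto simp: frag_extend_diff lookup_minus)
qed

locale finite_action = group G for G :: "('a, 'b) monoid_scheme" (structure) +
  fixes X :: "'x set" and act :: "'a \<Rightarrow> 'x \<Rightarrow> 'x"
  assumes finite_carrier: "finite (carrier G)" and finite_X: "finite X"
    and act_closed: "g \<in> carrier G \<Longrightarrow> x \<in> X \<Longrightarrow> act g x \<in> X"
    and act_one: "x \<in> X \<Longrightarrow> act \<one> x = x"
    and act_mult: "g \<in> carrier G \<Longrightarrow> h \<in> carrier G \<Longrightarrow> x \<in> X \<Longrightarrow> act (g \<otimes> h) x = act g (act h x)"
begin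

lemma act_inv: "g \<in> carrier G \<Longrightarrow> x \<in> X \<Longrightarrow> act (inv g) (act g x) = x"
  using act_mult[of "inv g" g x] by (simp add: act_one)

lemma act_inv': "g \<in> carrier G \<Longrightarrow> x \<in> X \<Longrightarrow> act g (act (inv g) x) = x"
  using act_mult[of g "inv g" x] by (simp add: act_one)

lemma left_module_perm: "left_module (group_ring G) (perm_module X act)"
proof -
  have add: "Poly_Mapping.keys (u + v) \<subseteq> X" if "Poly_Mapping.keys u \<subseteq> X" "Poly_Mapping.keys v \<subseteq> X" for u v
    using that keys_add[of u v] by blast
  have "abelian_group (perm_module X act)"
  proof (rule abelian_groupI)
    fix u assume "u \<in> carrier (perm_module X act)"
    then show "\<exists>v\<in>carrier (perm_module X act). v \<oplus>\<^bsub>perm_module X act\<^esub> u = \<zero>\<^bsub>perm_module X act\<^esub>"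
      by (intro bexI[of _ "- u"]) auto
  qed (auto simp: add ac_simps)
  moreover have "Poly_Mapping.keys (frag_extend (\<lambda>g. frag_extend (\<lambda>x. frag_of (act g x)) u) r) \<subseteq> X"
    if "Poly_Mapping.keys u \<subseteq> X" "Poly_Mapping.keys r \<subseteq> carrier G" for u r
    using that by (intro keys_frag_extend_subset) (auto intro!: act_closed)
  moreover have "frag_extend (\<lambda>x. frag_of (act \<one> x)) u = u" if "Poly_Mapping.keys u \<subseteq> X" for u
    using that frag_extend_eq[of u "\<lambda>x. frag_of (act \<one> x)" frag_of]
    by (auto simp: act_one frag_extend_frag_of subset_iff)
  moreover have "frag_extend (\<lambda>g. frag_extend (\<lambda>x. frag_of (act g x)) u)
        (frag_extend (\<lambda>g. frag_extend (\<lambda>h. frag_of (g \<otimes> h)) s) r) =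
      frag_extend (\<lambda>g. frag_extend (\<lambda>x. frag_of (act g x)) (frag_extend (\<lambda>h. frag_extend (\<lambda>x. frag_of (act h x)) u) s)) r"
    if "Poly_Mapping.keys u \<subseteq> X" "Poly_Mapping.keys r \<subseteq> carrier G" "Poly_Mapping.keys s \<subseteq> carrier G" for u r s
    using that by (intro frag_extend_bilinear_assoc) (auto intro!: act_mult)
  ultimately show ?thesis
    by (intro left_module.intro left_module_axioms.intro ring_group_ring is_group)
      (auto simp: frag_extend_add frag_extend_add_fun)
qed

lemma fg_module_perm: "fg_module (group_ring G) (perm_module X act)"
proof (rule fg_moduleI[OF left_module_perm])
  show "fg_additive (perm_module X act)"
    unfolding fg_additive_def
  proof (intro exI[of _ "frag_of ` X \<union> (\<lambda>x. - frag_of x) ` X"] conjI allI impI; (elim conjE)?)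
    fix A assume A: "\<zero>\<^bsub>perm_module X act\<^esub> \<in> A"
      "\<forall>x\<in>frag_of ` X \<union> (\<lambda>x. - frag_of x) ` X. \<forall>y\<in>A \<inter> carrier (perm_module X act). x \<oplus>\<^bsub>perm_module X act\<^esub> y \<in> A"
    have keys: "Poly_Mapping.keys (u + y) \<subseteq> X" if "Poly_Mapping.keys u \<subseteq> X" "Poly_Mapping.keys y \<subseteq> X" for u y
      using that keys_add[of u y] by blast
    have *: "Poly_Mapping.keys u \<subseteq> X \<and> (\<forall>y\<in>A. Poly_Mapping.keys y \<subseteq> X \<longrightarrow> u + y \<in> A \<and> - u + y \<in> A)"
      if "Poly_Mapping.keys u \<subseteq> X" for u
      using that
    proof (induction u rule: frag_induction)
      case (one x)
      have "frag_of x + y \<in> A" "- frag_of x + y \<in> A" if "y \<in> A" "Poly_Mapping.keys y \<subseteq> X" for y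
        using bspec[OF bspec[OF A(2)], of "frag_of x" y] bspec[OF bspec[OF A(2)], of "- frag_of x" y] one that
        by simp_all
      then show ?case using one by simp
    next
      case (diff a b)
      have "(a - b) + y \<in> A \<and> - (a - b) + y \<in> A" if y: "y \<in> A" "Poly_Mapping.keys y \<subseteq> X" for y
      proof -
        have "- b + y \<in> A" "b + y \<in> A" "Poly_Mapping.keys (- b + y) \<subseteq> X" "Poly_Mapping.keys (b + y) \<subseteq> X"
          using diff y keys[of "- b" y] keys[of b y] by auto
        then have "a + (- b + y) \<in> A" "- a + (b + y) \<in> A" using diff by auto
        then show ?thesis by (simp add: algebra_simps)
      qed
      moreover have "Poly_Mapping.keys (a - b) \<subseteq> X" using diff keys_diff[of a b] by blast
      ultimately show ?case by blast
    qed auto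
    show "carrier (perm_module X act) \<subseteq> A"
    proof
      fix u assume "u \<in> carrier (perm_module X act)"
      then have "\<forall>y\<in>A. Poly_Mapping.keys y \<subseteq> X \<longrightarrow> u + y \<in> A \<and> - u + y \<in> A"
        using *[of u] by simp
      from bspec[OF this A(1)] show "u \<in> A" by simp
    qed
  qed (use finite_X in auto)
qed

end

lemma (in finite_action) finite_action_subset:
  assumes "Y \<subseteq> X" "\<And>g y. g \<in> carrier G \<Longrightarrow> y \<in> Y \<Longrightarrow> act g y \<in> Y"
  shows "finite_action G Y act"
  using assms finite_X finite_carrier act_one act_mult
  by unfold_locales (auto intro: finite_subset)

lemma (in finite_action) invariant_complement:
  assumes "Y \<subseteq> X" "\<And>g y. g \<in> carrier G \<Longrightarrow> y \<in> Y \<Longrightarrow> act g y \<in> Y"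
    and "g \<in> carrier G" "x \<in> X - Y"
  shows "act g x \<in> X - Y"
proof -
  have "act g x \<notin> Y"
    using assms(2)[of "inv g" "act g x"] act_inv[of g x] assms(3,4) by auto
  then show ?thesis using act_closed assms by simp
qed

text \<open>The sequence Z[Y], Z[X], Z[X - Y] is exact, where the projection \<open>p\<close> kills
  the basis elements in \<open>Y\<close>. It is equivariant because the complement of an invariant
  set is again invariant.\<close>

lemma (in finite_action) perm_module_split:
  assumes Y: "Y \<subseteq> X" "\<And>g y. g \<in> carrier G \<Longrightarrow> y \<in> Y \<Longrightarrow> act g y \<in> Y"
  shows "frag_of (nat_copy (group_ring G) (perm_module X act)) -
      frag_of (nat_copy (group_ring G) (perm_module Y act)) -
      frag_of (nat_copy (group_ring G) (perm_module (X - Y) act)) \<in> G_relations (group_ring G)"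
proof -
  interpret Y: finite_action G Y act by (rule finite_action_subset[OF Y])
  interpret Z: finite_action G "X - Y" act
    by (rule finite_action_subset) (auto intro!: invariant_complement[OF Y, simplified])
  define p where "p = frag_extend (\<lambda>x. if x \<in> X - Y then frag_of x else (0 :: 'x \<Rightarrow>\<^sub>0 int))"
  have lookup_p: "Poly_Mapping.lookup (p u) k = (if k \<in> X - Y then Poly_Mapping.lookup u k else 0)" for u k
    unfolding p_def by (rule lookup_frag_extend_if)
  have keys_p: "Poly_Mapping.keys (p u) \<subseteq> X - Y" for u
    by (auto simp: in_keys_iff lookup_p split: if_splits)
  have p_smult: "p (frag_extend (\<lambda>g. frag_extend (\<lambda>x. frag_of (act g x)) u) r) =
      frag_extend (\<lambda>g. frag_extend (\<lambda>x. frag_of (act g x)) (p u)) r"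
    if r: "Poly_Mapping.keys r \<subseteq> carrier G" and u: "Poly_Mapping.keys u \<subseteq> X" for r u
  proof -
    have g: "p (frag_extend (\<lambda>x. frag_of (act g x)) u) = frag_extend (\<lambda>x. frag_of (act g x)) (p u)"
      if g: "g \<in> carrier G" for g
      using u
    proof (induction u rule: frag_induction)
      case (one x)
      then show ?case
        using invariant_complement[OF Y g, of x] Y(2)[OF g, of x] by (auto simp: p_def)
    qed (auto simp: p_def frag_extend_diff)
    show ?thesis
      using r
      by (induction r rule: frag_induction) (auto simp: g frag_extend_diff, auto simp: p_def frag_extend_diff)
  qed
  have "short_exact (group_ring G) (perm_module Y act) (perm_module X act) (perm_module (X - Y) act)"
    unfolding short_exact_def
  proof (rule bexI[of _ "\<lambda>u. u"], rule bexI[of _ p], intro conjI)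
    show "(\<lambda>u. u) ` carrier (perm_module Y act) =
        {u \<in> carrier (perm_module X act). p u = \<zero>\<^bsub>perm_module (X - Y) act\<^esub>}"
    proof (intro equalityI subsetI)
      fix u assume "u \<in> (\<lambda>u. u) ` carrier (perm_module Y act)"
      then have u: "Poly_Mapping.keys u \<subseteq> Y" by auto
      have "p u = 0" using u by (intro poly_mapping_eqI) (auto simp: lookup_p in_keys_iff subset_iff)
      then show "u \<in> {u \<in> carrier (perm_module X act). p u = \<zero>\<^bsub>perm_module (X - Y) act\<^esub>}"
        using u Y(1) by auto
    next
      fix u assume "u \<in> {u \<in> carrier (perm_module X act). p u = \<zero>\<^bsub>perm_module (X - Y) act\<^esub>}"
      then have u: "Poly_Mapping.keys u \<subseteq> X" "p u = 0" by auto
      have "k \<in> Y" if "k \<in> Poly_Mapping.keys u" for k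
        using lookup_p[of u k] u that by (auto simp: in_keys_iff split: if_splits)
      then show "u \<in> (\<lambda>u. u) ` carrier (perm_module Y act)" by auto
    qed
    show "p ` carrier (perm_module X act) = carrier (perm_module (X - Y) act)"
    proof (intro equalityI subsetI)
      fix u assume "u \<in> carrier (perm_module (X - Y) act)"
      then have u: "Poly_Mapping.keys u \<subseteq> X - Y" by auto
      then have "p u = u" by (intro poly_mapping_eqI) (auto simp: lookup_p in_keys_iff)
      then show "u \<in> p ` carrier (perm_module X act)" using u by (intro image_eqI[of _ _ u]) auto
    qed (use keys_p in auto)
    show "p \<in> module_hom (group_ring G) (perm_module X act) (perm_module (X - Y) act)"
      using keys_p by (auto simp: module_hom_def p_smult) (simp add: p_def frag_extend_add)
    show "(\<lambda>u. u) \<in> module_hom (group_ring G) (perm_module Y act) (perm_module X act)"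
      using Y(1) by (auto simp: module_hom_def)
  qed auto
  then show ?thesis
    by (intro nat_copy_short_exact Y.fg_module_perm Z.fg_module_perm fg_module_perm
        countable_group_ring finite_carrier)
qed

lemma frag_extend_image_inverse:
  assumes "\<And>x. x \<in> X \<Longrightarrow> \<tau> (\<sigma> x) = x" "Poly_Mapping.keys u \<subseteq> X"
  shows "frag_extend (\<lambda>y. frag_of (\<tau> y)) (frag_extend (\<lambda>x. frag_of (\<sigma> x)) u) = u"
proof -
  have "frag_extend (\<lambda>y. frag_of (\<tau> y)) (frag_extend (\<lambda>x. frag_of (\<sigma> x)) u) = frag_extend (\<lambda>x. frag_of (\<tau> (\<sigma> x))) u"
    using frag_extend_compose[of "\<lambda>y. frag_of (\<tau> y)" \<sigma> u] by (simp add: o_def)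
  also have "\<dots> = frag_extend frag_of u"
    using assms by (intro frag_extend_eq) (auto simp: subset_iff)
  finally show ?thesis by (simp add: frag_extend_frag_of)
qed

lemma module_iso_perm:
  assumes "finite_action G X act"
    and \<sigma>: "bij_betw \<sigma> X Y" "\<And>g x. g \<in> carrier G \<Longrightarrow> x \<in> X \<Longrightarrow> \<sigma> (act g x) = act' g (\<sigma> x)"
  shows "module_iso (group_ring G) (perm_module X act) (perm_module Y act')"
proof -
  interpret finite_action G X act by fact
  define f where "f = frag_extend (\<lambda>x. frag_of (\<sigma> x))"
  define \<tau> where "\<tau> = inv_into X \<sigma>"
  have \<tau>: "\<tau> (\<sigma> x) = x" if "x \<in> X" for x using \<sigma>(1) that by (simp add: \<tau>_def bij_betw_def)
  have \<tau>': "\<sigma> (\<tau> y) = y" "\<tau> y \<in> X" if "y \<in> Y" for y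
    using \<sigma>(1) that by (auto simp: \<tau>_def bij_betw_def f_inv_into_f inv_into_into)
  have \<sigma>Y: "\<sigma> x \<in> Y" if "x \<in> X" for x using \<sigma>(1) that by (auto simp: bij_betw_def)
  have g: "f (frag_extend (\<lambda>x. frag_of (act g x)) u) = frag_extend (\<lambda>y. frag_of (act' g y)) (f u)"
    if "g \<in> carrier G" "Poly_Mapping.keys u \<subseteq> X" for g u
    using that(2) by (induction u rule: frag_induction) (auto simp: f_def frag_extend_diff \<sigma>(2) that(1))
  have smult: "f (frag_extend (\<lambda>g. frag_extend (\<lambda>x. frag_of (act g x)) u) r) =
      frag_extend (\<lambda>g. frag_extend (\<lambda>y. frag_of (act' g y)) (f u)) r"
    if r: "Poly_Mapping.keys r \<subseteq> carrier G" and u: "Poly_Mapping.keys u \<subseteq> X" for r u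
    using r
    by (induction r rule: frag_induction) (auto simp: g u frag_extend_diff, auto simp: f_def frag_extend_diff)
  have keys_f: "Poly_Mapping.keys (f u) \<subseteq> Y" if "Poly_Mapping.keys u \<subseteq> X" for u
    using that \<sigma>Y unfolding f_def by (intro keys_frag_extend_subset) auto
  show ?thesis unfolding module_iso_def
  proof (intro bexI[of _ f])
    show "f \<in> module_hom (group_ring G) (perm_module X act) (perm_module Y act')"
      by (auto simp: module_hom_def smult keys_f subsetD[OF keys_f]) (simp add: f_def frag_extend_add)
    show "bij_betw f (carrier (perm_module X act)) (carrier (perm_module Y act'))"
    proof (rule bij_betwI[where g = "frag_extend (\<lambda>y. frag_of (\<tau> y))"])
      show "frag_extend (\<lambda>y. frag_of (\<tau> y)) \<in> carrier (perm_module Y act') \<rightarrow> carrier (perm_module X act)"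
      proof
        fix u assume "u \<in> carrier (perm_module Y act')"
        then have "Poly_Mapping.keys (frag_extend (\<lambda>y. frag_of (\<tau> y)) u) \<subseteq> X"
          using \<tau>' by (intro keys_frag_extend_subset) auto
        then show "frag_extend (\<lambda>y. frag_of (\<tau> y)) u \<in> carrier (perm_module X act)" by simp
      qed
      show "frag_extend (\<lambda>y. frag_of (\<tau> y)) (f u) = u" if "u \<in> carrier (perm_module X act)" for u
        using that \<tau> unfolding f_def by (intro frag_extend_image_inverse[of X]) auto
      show "f (frag_extend (\<lambda>y. frag_of (\<tau> y)) u) = u" if "u \<in> carrier (perm_module Y act')" for u
        using that \<tau>' unfolding f_def by (intro frag_extend_image_inverse[of Y]) auto
    qed (use keys_f in auto)
  qed
qed

text \<open>On a transitive set an invariant functional takes one value on all basis elements, so it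
  is a multiple of the sum of coefficients.\<close>

lemma inv_rank_transitive:
  assumes "finite_action G X act" and x: "x \<in> X" and trans: "\<And>y. y \<in> X \<Longrightarrow> \<exists>g\<in>carrier G. y = act g x"
  shows "inv_rank G (perm_module X act) = 1"
proof -
  interpret finite_action G X act by fact
  let ?M = "perm_module X act"
  interpret V: vectorspace "class_ring :: rat ring" "inv_functionals G ?M"
    by (rule vectorspace_inv_functionals)
  \<comment> \<open>The augmentation, cut off outside the carrier; it will span the space of
    invariant functionals.\<close>
  define v where "v u = (if Poly_Mapping.keys u \<subseteq> X then rat_extend (\<lambda>_. 1) u else 0)" for u :: "'c \<Rightarrow>\<^sub>0 int"
  have keys: "Poly_Mapping.keys (u + w) \<subseteq> X" if "Poly_Mapping.keys u \<subseteq> X" "Poly_Mapping.keys w \<subseteq> X" for u w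
    using that keys_add[of u w] by blast
  have keys_act: "Poly_Mapping.keys (frag_extend (\<lambda>x. frag_of (act g x)) u) \<subseteq> X"
    if "g \<in> carrier G" "Poly_Mapping.keys u \<subseteq> X" for g u
    using that act_closed by (intro keys_frag_extend_subset) auto
  have v: "v \<in> carrier (inv_functionals G ?M)"
    by (auto simp: mem_inv_functionals v_def keys keys_act rat_extend_add rat_extend_frag_extend)
  have vx: "v (frag_of x) = 1" using x by (simp add: v_def)
  have "f = (\<lambda>u. f (frag_of x) * v u)" if f: "f \<in> carrier (inv_functionals G ?M)" for f
  proof
    fix u
    have f_add: "f (u + w) = f u + f w" if "Poly_Mapping.keys u \<subseteq> X" "Poly_Mapping.keys w \<subseteq> X" for u w
      using f that by (simp add: mem_inv_functionals)
    have f0: "f 0 = 0" using f_add[of 0 0] by simp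
    have f_diff: "f (u - w) = f u - f w" if "Poly_Mapping.keys u \<subseteq> X" "Poly_Mapping.keys w \<subseteq> X" for u w
    proof -
      have "Poly_Mapping.keys (u - w) \<subseteq> X" using that keys_diff[of u w] by blast
      then show ?thesis using f_add[of "u - w" w] that by simp
    qed
    have fy: "f (frag_of y) = f (frag_of x)" if "y \<in> X" for y
    proof -
      obtain g where g: "g \<in> carrier G" "y = act g x" using trans[OF \<open>y \<in> X\<close>] by blast
      have "\<forall>g\<in>carrier G. \<forall>u\<in>carrier ?M. f (frag_of g \<odot>\<^bsub>?M\<^esub> u) = f u"
        using f unfolding mem_inv_functionals by (elim conjE)
      from bspec[OF bspec[OF this g(1)], of "frag_of x"] show ?thesis using x g by simp
    qed
    have "Poly_Mapping.keys u \<subseteq> X \<and> f u = f (frag_of x) * v u" if "Poly_Mapping.keys u \<subseteq> X"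
      using that
    proof (induction u rule: frag_induction)
      case (one y)
      then show ?case by (simp add: fy v_def)
    next
      case (diff a b)
      moreover from this have "Poly_Mapping.keys (a - b) \<subseteq> X" using keys_diff[of a b] by blast
      ultimately show ?case by (simp add: f_diff v_def rat_extend_diff algebra_simps)
    qed (simp add: f0 v_def)
    moreover have "f u = 0 \<and> v u = 0" if "\<not> Poly_Mapping.keys u \<subseteq> X"
      using f that by (simp add: mem_inv_functionals v_def)
    ultimately show "f u = f (frag_of x) * v u" by fastforce
  qed
  then have span: "f \<in> V.span {v}" if "f \<in> carrier (inv_functionals G ?M)" for f
    using that v V.finite_span[of "{v}"] unfolding V.lincomb_def
    by (auto simp: fun_eq_iff intro!: exI[of _ "\<lambda>_. f (frag_of x)"])
  have "V.gen_set {v}"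
    using span V.span_is_subset2[of "{v}"] v by auto
  moreover have "v \<noteq> \<zero>\<^bsub>inv_functionals G ?M\<^esub>"
  proof
    assume "v = \<zero>\<^bsub>inv_functionals G ?M\<^esub>"
    then have "v (frag_of x) = 0" by simp
    then show False using vx by simp
  qed
  ultimately show ?thesis
    unfolding inv_rank_def by (rule V.dim1I) (rule v)
qed

section \<open>Decomposition into orbits\<close>

definition stab :: "('a, 'b) monoid_scheme \<Rightarrow> ('a \<Rightarrow> 'x \<Rightarrow> 'x) \<Rightarrow> 'x \<Rightarrow> 'a set" where
  "stab G act x = {g \<in> carrier G. act g x = x}"

definition coset_space :: "('a, 'b) monoid_scheme \<Rightarrow> 'a set \<Rightarrow> 'a set set" where
  "coset_space G D = (\<lambda>g. g <#\<^bsub>G\<^esub> D) ` carrier G"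

definition perm_class ::
  "('a, 'b) monoid_scheme \<Rightarrow> 'x set \<Rightarrow> ('a \<Rightarrow> 'x \<Rightarrow> 'x) \<Rightarrow> (('a \<Rightarrow>\<^sub>0 int, nat) module \<Rightarrow>\<^sub>0 int)" where
  "perm_class G X act = frag_of (nat_copy (group_ring G) (perm_module X act))"

definition coset_class ::
  "('a, 'b) monoid_scheme \<Rightarrow> 'a set \<Rightarrow> (('a \<Rightarrow>\<^sub>0 int, nat) module \<Rightarrow>\<^sub>0 int)" where
  "coset_class G D = perm_class G (coset_space G D) (l_coset G)"

lemma finite_action_coset_space:
  assumes "group G" "finite (carrier G)" "subgroup D G"
  shows "finite_action G (coset_space G D) (l_coset G)"
proof -
  interpret group G by fact
  note D = subgroup.subset[OF assms(3)]
  have sub: "Y \<subseteq> carrier G" if "Y \<in> coset_space G D" for Y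
    using that l_coset_subset_G[OF D] by (auto simp: coset_space_def)
  show ?thesis
  proof unfold_locales
    fix g Y assume "g \<in> carrier G" "Y \<in> coset_space G D"
    then show "g <#\<^bsub>G\<^esub> Y \<in> coset_space G D"
      using lcos_m_assoc[OF D] by (auto simp: coset_space_def)
  next
    fix Y assume "Y \<in> coset_space G D"
    then show "\<one>\<^bsub>G\<^esub> <#\<^bsub>G\<^esub> Y = Y" by (intro lcos_mult_one sub)
  next
    fix g h Y assume "g \<in> carrier G" "h \<in> carrier G" "Y \<in> coset_space G D"
    then show "g \<otimes>\<^bsub>G\<^esub> h <#\<^bsub>G\<^esub> Y = g <#\<^bsub>G\<^esub> (h <#\<^bsub>G\<^esub> Y)" by (simp add: lcos_m_assoc sub)
  qed (use assms(2) in \<open>auto simp: coset_space_def\<close>)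
qed

lemma frag_cmul_diff_distrib2: "frag_cmul c (a - b) = frag_cmul c a - frag_cmul c b"
  by (intro poly_mapping_eqI) (simp add: lookup_minus right_diff_distrib)

lemma frag_cmul_sum_left: "frag_cmul (\<Sum>i\<in>I. f i) a = (\<Sum>i\<in>I. frag_cmul (f i) a)"
  by (induction I rule: infinite_finite_induct) (auto simp: frag_cmul_distrib)

lemma card_eq_card_image_times_fibre:
  assumes "finite A" "\<And>a. a \<in> A \<Longrightarrow> card {b \<in> A. f b = f a} = k"
  shows "card A = card (f ` A) * k"
proof -
  have "card A = (\<Sum>a\<in>A. 1)" by simp
  also have "\<dots> = (\<Sum>y\<in>f ` A. \<Sum>a\<in>{a. a \<in> A \<and> f a = y}. 1)"
    by (rule sum.image_gen[OF assms(1)])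
  also have "\<dots> = (\<Sum>y\<in>f ` A. k)"
    using assms(2) by (intro sum.cong) auto
  finally show ?thesis by simp
qed

context finite_action
begin

lemma stab_subset: "stab G act x \<subseteq> carrier G"
  by (auto simp: stab_def)

lemma subgroup_stab: assumes x: "x \<in> X" shows "subgroup (stab G act x) G"
proof (rule subgroupI)
  show "stab G act x \<noteq> {}" using act_one x by (auto simp: stab_def)
  fix g assume "g \<in> stab G act x"
  then show "inv g \<in> stab G act x" using act_inv[of g x] x by (auto simp: stab_def)
  fix h assume "h \<in> stab G act x"
  then show "g \<otimes> h \<in> stab G act x"
    using \<open>g \<in> stab G act x\<close> x by (auto simp: stab_def act_mult)
qed (rule stab_subset)

lemma act_eq_iff:
  assumes "g \<in> carrier G" "h \<in> carrier G" "x \<in> X"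
  shows "act g x = act h x \<longleftrightarrow> inv h \<otimes> g \<in> stab G act x"
proof
  assume "act g x = act h x"
  then show "inv h \<otimes> g \<in> stab G act x"
    using assms by (simp add: stab_def act_mult act_inv)
next
  assume "inv h \<otimes> g \<in> stab G act x"
  then have "act (inv h) (act g x) = x" using assms by (simp add: stab_def act_mult)
  then have "act h (act (inv h) (act g x)) = act h x" by simp
  then show "act g x = act h x" using assms act_closed by (simp add: act_inv')
qed

lemma fibre_eq_coset:
  assumes "h \<in> carrier G" "x \<in> X"
  shows "{g \<in> carrier G. act g x = act h x} = h <# stab G act x"
proof (intro equalityI subsetI)
  fix g assume g: "g \<in> {g \<in> carrier G. act g x = act h x}"
  then have "inv h \<otimes> g \<in> stab G act x" using act_eq_iff[of g h x] assms by simp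
  moreover have "g = h \<otimes> (inv h \<otimes> g)" using g assms by (simp add: m_assoc[symmetric])
  ultimately show "g \<in> h <# stab G act x" unfolding l_coset_def by blast
next
  fix g assume "g \<in> h <# stab G act x"
  then obtain s where s: "s \<in> stab G act x" "g = h \<otimes> s" by (auto simp: l_coset_def)
  then show "g \<in> {g \<in> carrier G. act g x = act h x}"
    using assms by (auto simp: stab_def act_mult)
qed

lemma card_orbit:
  assumes "x \<in> X"
  shows "card (carrier G) = card ((\<lambda>g. act g x) ` carrier G) * card (stab G act x)"
proof (rule card_eq_card_image_times_fibre[OF finite_carrier])
  fix h assume h: "h \<in> carrier G"
  have "inj_on (\<lambda>s. h \<otimes> s) (stab G act x)"
    using h by (auto simp: inj_on_def stab_def)
  moreover have "h <# stab G act x = (\<lambda>s. h \<otimes> s) ` stab G act x"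
    by (auto simp: l_coset_def)
  ultimately show "card {g \<in> carrier G. act g x = act h x} = card (stab G act x)"
    using fibre_eq_coset[OF h assms] by (simp add: card_image)
qed

lemma orbit_subset: "x \<in> X \<Longrightarrow> (\<lambda>g. act g x) ` carrier G \<subseteq> X"
  by (auto intro: act_closed)

lemma orbit_invariant:
  "x \<in> X \<Longrightarrow> g \<in> carrier G \<Longrightarrow> y \<in> (\<lambda>g. act g x) ` carrier G \<Longrightarrow> act g y \<in> (\<lambda>g. act g x) ` carrier G"
  by (auto simp: act_mult[symmetric])

lemma orbit_eq:
  assumes "x \<in> X" "y \<in> (\<lambda>g. act g x) ` carrier G"
  shows "(\<lambda>g. act g y) ` carrier G = (\<lambda>g. act g x) ` carrier G"
proof -
  obtain h where h: "h \<in> carrier G" "y = act h x" using assms(2) by blast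
  have y: "y \<in> X" using h assms act_closed by simp
  have "x = act (inv h) y" using h assms act_inv by simp
  then have "x \<in> (\<lambda>g. act g y) ` carrier G" using h by blast
  then show ?thesis
    using orbit_invariant[OF assms(1)] orbit_invariant[OF y] assms(2) by blast
qed

text \<open>The isomorphism sends a point to the set of group elements carrying \<open>x\<close> to
  it. This is a left coset of the stabiliser by \<open>fibre_eq_coset\<close>, so no
  well-definedness on cosets has to be checked.\<close>

lemma perm_class_orbit:
  assumes x: "x \<in> X"
  shows "perm_class G ((\<lambda>g. act g x) ` carrier G) act - coset_class G (stab G act x) \<in> G_relations (group_ring G)"
proof -
  let ?O = "(\<lambda>g. act g x) ` carrier G" and ?D = "stab G act x"
  interpret O: finite_action G ?O act
    by (rule finite_action_subset[OF orbit_subset[OF x] orbit_invariant[OF x]])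
  interpret C: finite_action G "coset_space G ?D" "l_coset G"
    by (rule finite_action_coset_space[OF is_group finite_carrier subgroup_stab[OF x]])
  let ?\<sigma> = "\<lambda>y. {g \<in> carrier G. act g x = y}"
  have \<sigma>: "?\<sigma> (act h x) = h <# ?D" if "h \<in> carrier G" for h
    using fibre_eq_coset[OF that x] .
  have bij: "bij_betw ?\<sigma> ?O (coset_space G ?D)"
  proof (rule bij_betw_imageI)
    show "inj_on ?\<sigma> ?O"
    proof (rule inj_onI)
      fix y z assume yz: "y \<in> ?O" "?\<sigma> y = ?\<sigma> z"
      then obtain h where h: "h \<in> carrier G" "y = act h x" by blast
      then have "h \<in> ?\<sigma> z" unfolding yz(2)[symmetric] by simp
      then show "y = z" using h by simp
    qed
    have "?\<sigma> ` ?O = (\<lambda>h. ?\<sigma> (act h x)) ` carrier G" by (rule image_image)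
    also have "\<dots> = coset_space G ?D" unfolding coset_space_def by (rule image_cong[OF refl \<sigma>])
    finally show "?\<sigma> ` ?O = coset_space G ?D" .
  qed
  have equiv: "?\<sigma> (act k y) = k <# ?\<sigma> y" if k: "k \<in> carrier G" and y: "y \<in> ?O" for k y
  proof -
    obtain h where h: "h \<in> carrier G" "y = act h x" using y by (rule imageE)
    have "?\<sigma> (act k y) = ?\<sigma> (act (k \<otimes> h) x)" using h that x by (simp add: act_mult)
    also have "\<dots> = k \<otimes> h <# ?D" using h that by (intro \<sigma>) simp
    also have "\<dots> = k <# (h <# ?D)" using h that by (simp add: lcos_m_assoc[OF stab_subset])
    also have "h <# ?D = ?\<sigma> y" using \<sigma>[OF h(1)] h(2) by simp
    finally show ?thesis .
  qed
  have "module_iso (group_ring G) (perm_module ?O act) (perm_module (coset_space G ?D) (l_coset G))"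
    by (rule module_iso_perm[OF O.finite_action_axioms bij equiv])
  then show ?thesis
    unfolding coset_class_def perm_class_def
    by (intro nat_copy_cong O.fg_module_perm C.fg_module_perm countable_group_ring finite_carrier)
qed

end

text \<open>For an orbit B, every y in B has [G/G_y] = [B] and |G_y| = |G|/|B|, so the points of B
  together contribute |G| [B]. The factor |G| thus allows a sum over all points in place of one over
  orbit representatives. The induction removes one orbit at a time.\<close>

theorem perm_class_decomposition:
  assumes "finite_action G X act"
  shows "frag_cmul (int (card (carrier G))) (perm_class G X act) -
     (\<Sum>x\<in>X. frag_cmul (int (card (stab G act x))) (coset_class G (stab G act x))) \<in> G_relations (group_ring G)"
  using assms
proof (induction "card X" arbitrary: X rule: less_induct)
  case less
  interpret finite_action G X act by (rule less.prems)
  let ?N = "G_relations (group_ring G)" and ?n = "int (card (carrier G))"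
  let ?t = "\<lambda>x. frag_cmul (int (card (stab G act x))) (coset_class G (stab G act x))"
  show ?case
  proof (cases "X = {}")
    case True
    \<comment> \<open>Splitting the empty set into two empty sets shows that its class is
      zero.\<close>
    have "perm_class G {} act - perm_class G {} act - perm_class G {} act \<in> ?N"
      using perm_module_split[of "{}"] True unfolding perm_class_def by simp
    then have "- perm_class G {} act \<in> ?N" by simp
    from G_relations.minus_mem[OF this] have "perm_class G {} act \<in> ?N" by simp
    then show ?thesis using True by (simp add: G_relations.cmul_mem)
  next
    case False
    then obtain x where x: "x \<in> X" by blast
    define B where "B = (\<lambda>g. act g x) ` carrier G"
    have B1: "B \<subseteq> X" unfolding B_def by (rule orbit_subset[OF x])
    have B2: "act g y \<in> B" if "g \<in> carrier G" "y \<in> B" for g y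
      using that(2) unfolding B_def by (rule orbit_invariant[OF x that(1)])
    have B3: "x \<in> B"
      unfolding B_def using act_one[OF x] by (intro image_eqI[where x = "\<one>\<^bsub>G\<^esub>"]) auto
    note B = B1 B2 B3
    have finB: "finite B" using B(1) finite_X finite_subset by blast
    have "card (X - B) < card X"
      using B(1,3) x finite_X by (intro psubset_card_mono) auto
    moreover have "finite_action G (X - B) act"
      by (rule finite_action_subset) (auto intro!: invariant_complement[OF B(1,2), simplified])
    ultimately have rest: "frag_cmul ?n (perm_class G (X - B) act) - (\<Sum>x\<in>X - B. ?t x) \<in> ?N"
      by (rule less.hyps)
    have split: "perm_class G X act - perm_class G B act - perm_class G (X - B) act \<in> ?N"
      using perm_module_split[OF B(1,2)] unfolding perm_class_def by simp
    have orb: "perm_class G B act - coset_class G (stab G act y) \<in> ?N"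
      "card (carrier G) = card B * card (stab G act y)" if "y \<in> B" for y
      using perm_class_orbit[of y] card_orbit[of y] orbit_eq[OF x, of y] that B(1) unfolding B_def by auto
    have "card (stab G act y) = card (stab G act x)" if "y \<in> B" for y
    proof -
      have eq: "card B * card (stab G act y) = card B * card (stab G act x)"
        unfolding orb(2)[OF that, symmetric] by (rule orb(2)[OF B(3)])
      have nz: "card B \<noteq> 0" using finB B(3) by auto
      show ?thesis using eq by (simp only: mult_left_cancel[OF nz])
    qed
    \<comment> \<open>Stabilisers along the orbit have equal order, so their orders add up to the
      group order. This distributes the weight |G| of [B] over the points of
      \<open>B\<close>.\<close>
    then have "(\<Sum>y\<in>B. int (card (stab G act y))) = (\<Sum>y\<in>B. int (card (stab G act x)))"
      by (intro sum.cong) auto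
    also have "\<dots> = ?n" using orb(2)[OF B(3)] by simp
    finally have n: "(\<Sum>y\<in>B. int (card (stab G act y))) = ?n" .
    have "frag_cmul ?n (perm_class G B act) = (\<Sum>y\<in>B. frag_cmul (int (card (stab G act y))) (perm_class G B act))"
      unfolding n[symmetric] by (rule frag_cmul_sum_left)
    then have "frag_cmul ?n (perm_class G B act) - (\<Sum>y\<in>B. ?t y) =
        (\<Sum>y\<in>B. frag_cmul (int (card (stab G act y))) (perm_class G B act - coset_class G (stab G act y)))"
      by (simp add: sum_subtractf frag_cmul_diff_distrib2)
    then have "frag_cmul ?n (perm_class G B act) - (\<Sum>y\<in>B. ?t y) \<in> ?N"
      using orb(1) by (simp add: G_relations.sum_mem G_relations.cmul_mem)
    moreover have "frag_cmul ?n (perm_class G X act) - (\<Sum>x\<in>X. ?t x) =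
        frag_cmul ?n (perm_class G X act - perm_class G B act - perm_class G (X - B) act) +
        (frag_cmul ?n (perm_class G B act) - (\<Sum>y\<in>B. ?t y)) +
        (frag_cmul ?n (perm_class G (X - B) act) - (\<Sum>x\<in>X - B. ?t x))"
      using sum.subset_diff[OF B(1) finite_X, of ?t] by (simp add: frag_cmul_diff_distrib2)
    ultimately show ?thesis
      using G_relations.cmul_mem[OF split] rest by (simp only:) (intro G_relations.add_mem)
  qed
qed

section \<open>Compatible families with prescribed marks\<close>

text \<open>The system is triangular with respect to inclusion and has unit diagonal, so it is
  solvable over the integers. For a minimal \<open>m\<close> the unknown \<open>u m\<close> occurs
  only in the equation at \<open>m\<close>, which can therefore be solved last.\<close>

lemma inclusion_inversion_exists:
  fixes t :: "'a set \<Rightarrow> int"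
  assumes "finite S"
  shows "\<exists>u. \<forall>E\<in>S. (\<Sum>D | D \<in> S \<and> E \<subseteq> D. u D) = t E"
  using assms
proof (induction "card S" arbitrary: S)
  case 0
  then show ?case by simp
next
  case (Suc n)
  then have "S \<noteq> {}" by auto
  then obtain m where m: "m \<in> S" "\<forall>x\<in>S. x \<le> m \<longrightarrow> m = x"
    using finite_has_minimal[OF Suc.prems] by blast
  have "n = card (S - {m})" using Suc.hyps(2) m(1) Suc.prems by simp
  then obtain u where u: "\<forall>E\<in>S - {m}. (\<Sum>D | D \<in> S - {m} \<and> E \<subseteq> D. u D) = t E"
    using Suc.hyps(1)[of "S - {m}"] Suc.prems by auto
  define v where "v = u(m := t m - (\<Sum>D | D \<in> S - {m} \<and> m \<subseteq> D. u D))"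
  have "(\<Sum>D | D \<in> S \<and> E \<subseteq> D. v D) = t E" if E: "E \<in> S" for E
  proof (cases "E = m")
    case True
    have "{D. D \<in> S \<and> E \<subseteq> D} = insert m {D. D \<in> S - {m} \<and> m \<subseteq> D}"
      using m(1) True by auto
    then have "(\<Sum>D | D \<in> S \<and> E \<subseteq> D. v D) = v m + (\<Sum>D | D \<in> S - {m} \<and> m \<subseteq> D. v D)"
      using Suc.prems by simp
    also have "(\<Sum>D | D \<in> S - {m} \<and> m \<subseteq> D. v D) = (\<Sum>D | D \<in> S - {m} \<and> m \<subseteq> D. u D)"
      by (intro sum.cong) (auto simp: v_def)
    finally show ?thesis using True by (simp add: v_def)
  next
    case False
    then have "{D. D \<in> S \<and> E \<subseteq> D} = {D. D \<in> S - {m} \<and> E \<subseteq> D}"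
      using m(2) E by auto
    moreover have "(\<Sum>D | D \<in> S - {m} \<and> E \<subseteq> D. v D) = (\<Sum>D | D \<in> S - {m} \<and> E \<subseteq> D. u D)"
      by (intro sum.cong) (auto simp: v_def)
    ultimately show ?thesis using u E False by simp
  qed
  then show ?case by blast
qed

text \<open>Downward induction from the largest sets: the equation at \<open>E\<close> contains
  \<open>u E\<close> and otherwise only unknowns at strictly larger sets. This is the form in which
  marks determine the coefficients of a combination.\<close>

lemma inclusion_inversion_unique:
  fixes u v :: "'a set \<Rightarrow> int"
  assumes S: "finite S"
    and eq: "\<And>E. E \<in> S \<Longrightarrow> (\<Sum>D | D \<in> S \<and> E \<subseteq> D. u D) = (\<Sum>D | D \<in> S \<and> E \<subseteq> D. v D)"
    and E: "E \<in> S"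
  shows "u E = v E"
  using E
proof (induction "card {D \<in> S. E \<subset> D}" arbitrary: E rule: less_induct)
  case less
  have "u D = v D" if D: "D \<in> S" "E \<subset> D" for D
  proof (rule less.hyps)
    show "card {D' \<in> S. D \<subset> D'} < card {D \<in> S. E \<subset> D}"
      using S D by (intro psubset_card_mono) auto
  qed (rule D)
  then have "(\<Sum>D | D \<in> S \<and> E \<subset> D. u D) = (\<Sum>D | D \<in> S \<and> E \<subset> D. v D)"
    by (intro sum.cong) auto
  moreover have "{D. D \<in> S \<and> E \<subseteq> D} = insert E {D. D \<in> S \<and> E \<subset> D}"
    using less.prems by auto
  then have "(\<Sum>D | D \<in> S \<and> E \<subseteq> D. f D) = f E + (\<Sum>D | D \<in> S \<and> E \<subset> D. f D)" for f :: "'a set \<Rightarrow> int"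
    using S by simp
  ultimately show ?case using eq[OF less.prems] by simp
qed

definition subgroups :: "('a, 'b) monoid_scheme \<Rightarrow> 'a set set" where
  "subgroups G = {D. subgroup D G}"

lemma finite_subgroups_of_finite:
  assumes "finite (carrier G)" shows "finite (subgroups G)"
proof (rule finite_subset)
  show "subgroups G \<subseteq> Pow (carrier G)" by (auto simp: subgroups_def dest: subgroup.subset)
qed (use assms in simp)

text \<open>On subgroups this is Moebius inversion in the subgroup lattice: the value at D is the
  sum of mu(D,E) t(E) over the subgroups E containing D.\<close>

definition inversion :: "('a, 'b) monoid_scheme \<Rightarrow> ('a set \<Rightarrow> int) \<Rightarrow> 'a set \<Rightarrow> int" where
  "inversion G t = (SOME u. \<forall>E\<in>subgroups G. (\<Sum>D | D \<in> subgroups G \<and> E \<subseteq> D. u D) = t E)"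

lemma inversion:
  assumes "finite (carrier G)" "subgroup E G"
  shows "(\<Sum>D | D \<in> subgroups G \<and> E \<subseteq> D. inversion G t D) = t E"
proof -
  have "\<forall>E\<in>subgroups G. (\<Sum>D | D \<in> subgroups G \<and> E \<subseteq> D. inversion G t D) = t E"
    unfolding inversion_def
    by (rule someI_ex[OF inclusion_inversion_exists[OF finite_subgroups_of_finite[OF assms(1)]]])
  then show ?thesis using assms(2) by (simp add: subgroups_def)
qed

text \<open>In the Burnside ring, the combination of the \<open>G/D\<close> below is \<open>N\<close> times an element whose mark
  (number of fixed points) at each subgroup \<open>E\<close> is \<open>N \<cdot> t(E)\<close>. Marks are compatible with restriction
  and conjugation, and the extra factor \<open>N\<close> makes the orbit decomposition integral.\<close>

definition mark_class ::
  "('a, 'b) monoid_scheme \<Rightarrow> nat \<Rightarrow> ('a set \<Rightarrow> int) \<Rightarrow> (('a \<Rightarrow>\<^sub>0 int, nat) module \<Rightarrow>\<^sub>0 int)" where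
  "mark_class G N t = (\<Sum>D\<in>subgroups G.
     frag_cmul (int N * (int (N div card (carrier G)) * (int (card D) * inversion G t D))) (coset_class G D))"

lemma coset_class_fg:
  assumes "group G" "finite (carrier G)" "subgroup D G"
  shows "Poly_Mapping.keys (coset_class G D) \<subseteq> fg_modules (group_ring G)"
proof -
  interpret finite_action G "coset_space G D" "l_coset G"
    by (rule finite_action_coset_space[OF assms])
  show ?thesis
    using nat_copy(1)[OF fg_module_perm countable_group_ring[OF finite_carrier]]
    by (simp add: coset_class_def perm_class_def)
qed

lemma mark_class_fg:
  assumes "group G" "finite (carrier G)"
  shows "Poly_Mapping.keys (mark_class G N t) \<subseteq> fg_modules (group_ring G)"
proof -
  have "mark_class G N t \<in> carrier (free_Abelian_group (fg_modules (group_ring G)))"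
    unfolding mark_class_def
  proof (rule sum_closed_free_Abelian_group)
    fix D assume "D \<in> subgroups G"
    then show "frag_cmul c (coset_class G D) \<in> carrier (free_Abelian_group (fg_modules (group_ring G)))" for c
      using coset_class_fg[OF assms, of D] keys_cmul[of c "coset_class G D"] by (auto simp: subgroups_def)
  qed
  then show ?thesis by simp
qed

text \<open>The group acts transitively on its cosets, and the rank survives the passage to the copy
  on the naturals.\<close>

lemma inv_rank_coset_class:
  assumes "group G" "finite (carrier G)" "subgroup D G"
  shows "rat_extend (\<lambda>M. of_nat (inv_rank G M)) (coset_class G D) = 1"
proof -
  interpret finite_action G "coset_space G D" "l_coset G"
    by (rule finite_action_coset_space[OF assms])
  note cp = nat_copy[OF fg_module_perm countable_group_ring[OF finite_carrier]]
  have D: "D \<in> coset_space G D"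
    unfolding coset_space_def
    by (intro image_eqI[where x = "\<one>\<^bsub>G\<^esub>"]) (simp_all add: lcos_mult_one subgroup.subset[OF assms(3)])
  have "inv_rank G (nat_copy (group_ring G) (perm_module (coset_space G D) (l_coset G))) =
      inv_rank G (perm_module (coset_space G D) (l_coset G))"
    using cp by (intro inv_rank_iso[symmetric] assms fg_module_perm) (auto simp: fg_modules_iff fg_module_def)
  also have "\<dots> = 1"
    by (rule inv_rank_transitive[OF finite_action_axioms D]) (auto simp: coset_space_def)
  finally show ?thesis by (simp add: coset_class_def perm_class_def)
qed

text \<open>Every coset class has rank 1, so the rank is the sum of the coefficients. Writing |D| as
  a sum over the elements of D and exchanging sums collects, for each g, the values of
  \<open>inversion\<close> over the subgroups containing g, which add up to t(<g>).\<close>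

theorem inv_rank_mark_class:
  assumes "group G" "finite (carrier G)"
  shows "rat_extend (\<lambda>M. of_nat (inv_rank G M)) (mark_class G N t) =
    of_int (int N * (int (N div card (carrier G)) * (\<Sum>g\<in>carrier G. t (generate G {g}))))"
proof -
  interpret group G by fact
  have fin: "finite (subgroups G)" by (rule finite_subgroups_of_finite[OF assms(2)])
  have "rat_extend (\<lambda>M. of_nat (inv_rank G M)) (mark_class G N t) =
      (\<Sum>D\<in>subgroups G. of_int (int N * (int (N div card (carrier G)) * (int (card D) * inversion G t D))))"
    unfolding mark_class_def rat_extend_sum rat_extend_cmul
    by (intro sum.cong) (auto simp: subgroups_def inv_rank_coset_class[OF assms])
  also have "\<dots> = of_int (int N * (int (N div card (carrier G)) * (\<Sum>D\<in>subgroups G. int (card D) * inversion G t D)))"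
    by (simp add: sum_distrib_left)
  also have "(\<Sum>D\<in>subgroups G. int (card D) * inversion G t D) =
      (\<Sum>D\<in>subgroups G. \<Sum>g | g \<in> carrier G \<and> g \<in> D. inversion G t D)"
  proof (rule sum.cong[OF refl])
    fix D assume "D \<in> subgroups G"
    then have "{g. g \<in> carrier G \<and> g \<in> D} = D" by (auto simp: subgroups_def dest: subgroup.subset)
    then show "int (card D) * inversion G t D = (\<Sum>g | g \<in> carrier G \<and> g \<in> D. inversion G t D)" by simp
  qed
  also have "\<dots> = (\<Sum>g\<in>carrier G. \<Sum>D | D \<in> subgroups G \<and> g \<in> D. inversion G t D)"
    by (rule sum.swap_restrict[OF fin assms(2)])
  also have "\<dots> = (\<Sum>g\<in>carrier G. t (generate G {g}))"
  proof (rule sum.cong[OF refl])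
    fix g assume g: "g \<in> carrier G"
    \<comment> \<open>A subgroup contains an element exactly when it contains the cyclic subgroup
      generated by it; this is what restricts the rank to cyclic values of \<open>t\<close>.\<close>
    have "g \<in> D \<longleftrightarrow> generate G {g} \<subseteq> D" if "D \<in> subgroups G" for D
      using generate_subgroup_incl[of "{g}" D] generate.incl[of g "{g}" G] that by (auto simp: subgroups_def)
    then have "{D. D \<in> subgroups G \<and> g \<in> D} = {D. D \<in> subgroups G \<and> generate G {g} \<subseteq> D}" by auto
    then show "(\<Sum>D | D \<in> subgroups G \<and> g \<in> D. inversion G t D) = t (generate G {g})"
      using inversion[OF assms(2) generate_is_subgroup[of "{g}"]] g by simp
  qed
  finally show ?thesis .
qed

section \<open>Prescribed marks under pullback\<close>

context finite_group_hom
begin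

lemma finite_action_pull:
  assumes D: "subgroup D K"
  shows "finite_action H (coset_space K D) (\<lambda>h. l_coset K (c h))"
proof -
  interpret A: finite_action K "coset_space K D" "l_coset K"
    by (rule finite_action_coset_space[OF K.is_group finite_K D])
  show ?thesis
    using A.act_closed A.act_one A.act_mult A.finite_X hom_in_carrier[OF c_hom] hom_mult[OF c_hom]
      hom_one[OF c_hom H.is_group K.is_group]
    by unfold_locales (auto simp: finite_H)
qed

lemma pull_coset_class:
  assumes D: "subgroup D K"
  shows "pull (coset_class K D) - perm_class H (coset_space K D) (\<lambda>h. l_coset K (c h)) \<in> G_relations (group_ring H)"
proof -
  interpret A: finite_action K "coset_space K D" "l_coset K"
    by (rule finite_action_coset_space[OF K.is_group finite_K D])
  show ?thesis
    using pull_nat_copy[OF A.fg_module_perm]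
    by (simp add: coset_class_def perm_class_def \<phi>_def restrict_scalars_perm_module)
qed

text \<open>Counting pairs \<open>(k, kD)\<close> with \<open>kD\<close> fixed by \<open>c(E)\<close>.\<close>

lemma card_fixed_cosets:
  assumes D: "subgroup D K" and E: "E \<subseteq> carrier H"
  shows "card D * card {Y \<in> coset_space K D. E \<subseteq> stab H (\<lambda>h. l_coset K (c h)) Y} =
    card {k \<in> carrier K. (\<lambda>x. inv\<^bsub>K\<^esub> k \<otimes>\<^bsub>K\<^esub> x \<otimes>\<^bsub>K\<^esub> k) ` c ` E \<subseteq> D}"
proof -
  note DK = subgroup.subset[OF D]
  have cK: "c e \<in> carrier K" if "e \<in> E" for e using that E hom_in_carrier[OF c_hom] by blast
  have coset_eq: "a <#\<^bsub>K\<^esub> D = b <#\<^bsub>K\<^esub> D \<longleftrightarrow> inv\<^bsub>K\<^esub> b \<otimes>\<^bsub>K\<^esub> a \<in> D" if ab: "a \<in> carrier K" "b \<in> carrier K" for a b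
  proof
    assume "a <#\<^bsub>K\<^esub> D = b <#\<^bsub>K\<^esub> D"
    moreover have "a \<in> a <#\<^bsub>K\<^esub> D"
      using subgroup.one_closed[OF D] ab unfolding l_coset_def by force
    ultimately obtain d where "d \<in> D" "a = b \<otimes>\<^bsub>K\<^esub> d" by (auto simp: l_coset_def)
    then show "inv\<^bsub>K\<^esub> b \<otimes>\<^bsub>K\<^esub> a \<in> D" using ab DK by (simp add: K.m_assoc[symmetric] subset_iff)
  next
    assume d: "inv\<^bsub>K\<^esub> b \<otimes>\<^bsub>K\<^esub> a \<in> D"
    have "a <#\<^bsub>K\<^esub> D = b <#\<^bsub>K\<^esub> ((inv\<^bsub>K\<^esub> b \<otimes>\<^bsub>K\<^esub> a) <#\<^bsub>K\<^esub> D)"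
      using ab by (simp add: K.lcos_m_assoc[OF DK] K.m_assoc[symmetric])
    also have "(inv\<^bsub>K\<^esub> b \<otimes>\<^bsub>K\<^esub> a) <#\<^bsub>K\<^esub> D = D"
      using d by (rule K.coset_join3[OF _ D, rotated]) (use ab in simp)
    finally show "a <#\<^bsub>K\<^esub> D = b <#\<^bsub>K\<^esub> D" .
  qed
  let ?A = "{k \<in> carrier K. (\<lambda>x. inv\<^bsub>K\<^esub> k \<otimes>\<^bsub>K\<^esub> x \<otimes>\<^bsub>K\<^esub> k) ` c ` E \<subseteq> D}"
  let ?f = "\<lambda>k. k <#\<^bsub>K\<^esub> D"
  have fixed: "E \<subseteq> stab H (\<lambda>h. l_coset K (c h)) (k <#\<^bsub>K\<^esub> D) \<longleftrightarrow> k \<in> ?A" if k: "k \<in> carrier K" for k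
  proof -
    have fix_iff: "c e <#\<^bsub>K\<^esub> (k <#\<^bsub>K\<^esub> D) = k <#\<^bsub>K\<^esub> D \<longleftrightarrow> inv\<^bsub>K\<^esub> k \<otimes>\<^bsub>K\<^esub> c e \<otimes>\<^bsub>K\<^esub> k \<in> D" if e: "e \<in> E" for e
      using coset_eq[of "c e \<otimes>\<^bsub>K\<^esub> k" k] k cK[OF e] by (simp add: K.lcos_m_assoc[OF DK] K.m_assoc)
    have "E \<subseteq> stab H (\<lambda>h. l_coset K (c h)) (k <#\<^bsub>K\<^esub> D) \<longleftrightarrow>
        (\<forall>e\<in>E. c e <#\<^bsub>K\<^esub> (k <#\<^bsub>K\<^esub> D) = k <#\<^bsub>K\<^esub> D)"
      unfolding stab_def using E by (simp add: subset_iff Ball_def)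
    also have "\<dots> \<longleftrightarrow> (\<forall>e\<in>E. inv\<^bsub>K\<^esub> k \<otimes>\<^bsub>K\<^esub> c e \<otimes>\<^bsub>K\<^esub> k \<in> D)"
      by (rule ball_cong[OF refl fix_iff])
    also have "\<dots> \<longleftrightarrow> k \<in> ?A" using k by (simp add: image_subset_iff)
    finally show ?thesis .
  qed
  have "?f ` ?A = {Y \<in> coset_space K D. E \<subseteq> stab H (\<lambda>h. l_coset K (c h)) Y}"
    using fixed by (auto simp: coset_space_def)
  moreover have "card ?A = card (?f ` ?A) * card D"
  proof (rule card_eq_card_image_times_fibre)
    show "finite ?A" using finite_K by simp
    fix a assume a: "a \<in> ?A"
    have "{b \<in> ?A. ?f b = ?f a} = (\<lambda>d. a \<otimes>\<^bsub>K\<^esub> d) ` D"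
    proof (intro equalityI subsetI)
      fix b assume b: "b \<in> {b \<in> ?A. ?f b = ?f a}"
      then have "inv\<^bsub>K\<^esub> a \<otimes>\<^bsub>K\<^esub> b \<in> D" using coset_eq[of b a] a by auto
      then show "b \<in> (\<lambda>d. a \<otimes>\<^bsub>K\<^esub> d) ` D"
        using a b by (intro image_eqI[where x = "inv\<^bsub>K\<^esub> a \<otimes>\<^bsub>K\<^esub> b"]) (auto simp: K.m_assoc[symmetric])
    next
      fix b assume "b \<in> (\<lambda>d. a \<otimes>\<^bsub>K\<^esub> d) ` D"
      then obtain d where d: "d \<in> D" "b = a \<otimes>\<^bsub>K\<^esub> d" by (rule imageE)
      have bK: "b \<in> carrier K" using d a DK by auto
      have eq: "?f b = ?f a" using coset_eq[OF bK, of a] d a DK by (simp add: K.m_assoc[symmetric] subset_iff)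
      have "E \<subseteq> stab H (\<lambda>h. l_coset K (c h)) (?f b)" unfolding eq using fixed[of a] a by simp
      then show "b \<in> {b \<in> ?A. ?f b = ?f a}" using fixed[OF bK] eq by simp
    qed
    moreover have "inj_on (\<lambda>d. a \<otimes>\<^bsub>K\<^esub> d) D" using a DK by (auto simp: inj_on_def subset_iff)
    ultimately show "card {b \<in> ?A. ?f b = ?f a} = card D" by (simp add: card_image)
  qed
  ultimately show ?thesis by (simp add: mult.commute)
qed

text \<open>Each K/D, viewed as an H-set, is decomposed into orbits, which turns both sides into
  combinations of the classes of H/E. The coefficients are then compared through
  \<open>inclusion_inversion_unique\<close>: summed over all E containing F they become marks at F,
  and both sides give N t(F).\<close>

theorem pull_mark_class:
  assumes N: "card (carrier H) dvd N" "card (carrier K) dvd N"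
    and t_conj: "\<And>k E. k \<in> carrier K \<Longrightarrow> subgroup E K \<Longrightarrow> t ((\<lambda>x. inv\<^bsub>K\<^esub> k \<otimes>\<^bsub>K\<^esub> x \<otimes>\<^bsub>K\<^esub> k) ` E) = t E"
    and t_hom: "\<And>E. subgroup E H \<Longrightarrow> t (c ` E) = t E"
  shows "pull (mark_class K N t) - mark_class H N t \<in> G_relations (group_ring H)"
proof -
  let ?N = "G_relations (group_ring H)" and ?h = "int (card (carrier H))" and ?n = "int (N div card (carrier H))"
  let ?act = "\<lambda>h. l_coset K (c h)"
  let ?P = "\<lambda>D. perm_class H (coset_space K D) ?act"
  define b where "b D = int (N div card (carrier K)) * (int (card D) * inversion K t D)" for D
  define s where "s D E = int (card {Y \<in> coset_space K D. stab H ?act Y = E})" for D E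
  have finSK: "finite (subgroups K)" and finSH: "finite (subgroups H)"
    using finite_subgroups_of_finite finite_H finite_K by auto
  have nh: "?h * ?n = int N"
    using N(1) by (simp flip: of_nat_mult)
  have nk: "int (card (carrier K)) * int (N div card (carrier K)) = int N"
    using N(2) by (simp flip: of_nat_mult)
  have fin_cs: "finite (coset_space K D)" for D
    using finite_K by (simp add: coset_space_def)
  have stab_sub: "stab H ?act Y \<in> subgroups H" if "D \<in> subgroups K" "Y \<in> coset_space K D" for D Y
    using finite_action.subgroup_stab[OF finite_action_pull] that by (simp add: subgroups_def)

  \<comment> \<open>The orbit formula carries the factor |H|; multiplication by N/|H| replaces it by
    N. This spends the extra factor N in \<open>mark_class\<close>. Points of K/D are grouped by
    their stabiliser E, and \<open>s D E\<close> counts them.\<close>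
  have decomp: "frag_cmul (int N) (pull (coset_class K D)) -
      (\<Sum>E\<in>subgroups H. frag_cmul (?n * (s D E * int (card E))) (coset_class H E)) \<in> ?N"
    if D: "D \<in> subgroups K" for D
  proof -
    have D': "subgroup D K" using D by (simp add: subgroups_def)
    have "(\<Sum>Y\<in>coset_space K D. frag_cmul (int (card (stab H ?act Y))) (coset_class H (stab H ?act Y))) =
        (\<Sum>E\<in>subgroups H. \<Sum>Y | Y \<in> coset_space K D \<and> stab H ?act Y = E.
           frag_cmul (int (card (stab H ?act Y))) (coset_class H (stab H ?act Y)))"
      using stab_sub[OF D] by (intro sum.group[symmetric] fin_cs finSH) auto
    also have "\<dots> = (\<Sum>E\<in>subgroups H. frag_cmul (s D E * int (card E)) (coset_class H E))"
    proof (rule sum.cong[OF refl])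
      fix E
      have "(\<Sum>Y | Y \<in> coset_space K D \<and> stab H ?act Y = E.
           frag_cmul (int (card (stab H ?act Y))) (coset_class H (stab H ?act Y))) =
          (\<Sum>Y | Y \<in> coset_space K D \<and> stab H ?act Y = E. frag_cmul (int (card E)) (coset_class H E))"
        by (intro sum.cong) auto
      also have "\<dots> = frag_cmul (s D E * int (card E)) (coset_class H E)"
        by (simp add: s_def flip: frag_cmul_sum_left)
      finally show "(\<Sum>Y | Y \<in> coset_space K D \<and> stab H ?act Y = E.
           frag_cmul (int (card (stab H ?act Y))) (coset_class H (stab H ?act Y))) =
          frag_cmul (s D E * int (card E)) (coset_class H E)" .
    qed
    finally have "frag_cmul ?h (?P D) - (\<Sum>E\<in>subgroups H. frag_cmul (s D E * int (card E)) (coset_class H E)) \<in> ?N"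
      using perm_class_decomposition[OF finite_action_pull[OF D']] by simp
    from G_relations.cmul_mem[OF this, of ?n]
    have "frag_cmul (int N) (?P D) -
        (\<Sum>E\<in>subgroups H. frag_cmul (?n * (s D E * int (card E))) (coset_class H E)) \<in> ?N"
      by (simp add: frag_cmul_diff_distrib2 frag_cmul_sum nh[symmetric] mult.commute)
    moreover have "frag_cmul (int N) (pull (coset_class K D)) - frag_cmul (int N) (?P D) \<in> ?N"
      using G_relations.cmul_mem[OF pull_coset_class[OF D'], of "int N"] by (simp add: frag_cmul_diff_distrib2)
    ultimately show ?thesis using G_relations.add_mem by fastforce
  qed

  \<comment> \<open>By uniqueness of inversion it suffices to sum over the subgroups E containing F.
    On the left this turns \<open>s D E\<close> into the number of cosets fixed by F, to which
    \<open>card_fixed_cosets\<close> applies.\<close>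
  have coeff: "(\<Sum>D\<in>subgroups K. b D * s D E) = int N * inversion H t E" if E: "E \<in> subgroups H" for E
  proof (rule inclusion_inversion_unique[OF finSH _ E])
    fix F assume F: "F \<in> subgroups H"
    then have F': "subgroup F H" by (simp add: subgroups_def)
    have FH: "F \<subseteq> carrier H" by (rule subgroup.subset[OF F'])
    have sF: "(\<Sum>E | E \<in> subgroups H \<and> F \<subseteq> E. s D E) = int (card {Y \<in> coset_space K D. F \<subseteq> stab H ?act Y})"
      if D: "D \<in> subgroups K" for D
    proof -
      have "(\<Sum>Y\<in>{Y \<in> coset_space K D. F \<subseteq> stab H ?act Y}. (1::int)) =
          (\<Sum>E | E \<in> subgroups H \<and> F \<subseteq> E. \<Sum>Y | Y \<in> {Y \<in> coset_space K D. F \<subseteq> stab H ?act Y} \<and> stab H ?act Y = E. 1)"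
        using stab_sub[OF D] fin_cs finSH by (intro sum.group[symmetric]) auto
      also have "\<dots> = (\<Sum>E | E \<in> subgroups H \<and> F \<subseteq> E. s D E)"
        by (intro sum.cong) (auto simp: s_def intro!: arg_cong[where f = card])
      finally show ?thesis by simp
    qed
    have conj_sub: "subgroup ((\<lambda>x. inv\<^bsub>K\<^esub> k \<otimes>\<^bsub>K\<^esub> x \<otimes>\<^bsub>K\<^esub> k) ` c ` F) K" if k: "k \<in> carrier K" for k
    proof -
      have "(\<lambda>h. inv\<^bsub>K\<^esub> k \<otimes>\<^bsub>K\<^esub> c h \<otimes>\<^bsub>K\<^esub> k) \<in> hom H K"
        using k hom_in_carrier[OF c_hom] hom_mult[OF c_hom]
        by (auto simp: hom_def K.m_assoc) (simp add: K.m_assoc[symmetric])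
      then interpret g: group_hom H K "\<lambda>h. inv\<^bsub>K\<^esub> k \<otimes>\<^bsub>K\<^esub> c h \<otimes>\<^bsub>K\<^esub> k"
        by unfold_locales
      show ?thesis using g.subgroup_img_is_subgroup[OF F'] by (simp add: image_image)
    qed
    have cF: "subgroup (c ` F) K"
    proof -
      interpret g: group_hom H K c using c_hom by unfold_locales
      show ?thesis by (rule g.subgroup_img_is_subgroup[OF F'])
    qed
    have "(\<Sum>E | E \<in> subgroups H \<and> F \<subseteq> E. \<Sum>D\<in>subgroups K. b D * s D E) =
        (\<Sum>D\<in>subgroups K. b D * (\<Sum>E | E \<in> subgroups H \<and> F \<subseteq> E. s D E))"
      by (subst sum.swap) (simp add: sum_distrib_left)
    also have "\<dots> = (\<Sum>D\<in>subgroups K. int (N div card (carrier K)) *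
        (\<Sum>k | k \<in> carrier K \<and> (\<lambda>x. inv\<^bsub>K\<^esub> k \<otimes>\<^bsub>K\<^esub> x \<otimes>\<^bsub>K\<^esub> k) ` c ` F \<subseteq> D. inversion K t D))"
    proof (rule sum.cong[OF refl])
      fix D assume D: "D \<in> subgroups K"
      then have D': "subgroup D K" by (simp add: subgroups_def)
      show "b D * (\<Sum>E | E \<in> subgroups H \<and> F \<subseteq> E. s D E) = int (N div card (carrier K)) *
        (\<Sum>k | k \<in> carrier K \<and> (\<lambda>x. inv\<^bsub>K\<^esub> k \<otimes>\<^bsub>K\<^esub> x \<otimes>\<^bsub>K\<^esub> k) ` c ` F \<subseteq> D. inversion K t D)"
        unfolding sF[OF D] b_def
        by (simp add: card_fixed_cosets[OF D' FH, symmetric] mult.assoc mult.left_commute mult.commute)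
    qed
    also have "\<dots> = int (N div card (carrier K)) * (\<Sum>k\<in>carrier K.
        \<Sum>D | D \<in> subgroups K \<and> (\<lambda>x. inv\<^bsub>K\<^esub> k \<otimes>\<^bsub>K\<^esub> x \<otimes>\<^bsub>K\<^esub> k) ` c ` F \<subseteq> D. inversion K t D)"
      unfolding sum_distrib_left[symmetric] by (subst sum.swap_restrict[OF finSK finite_K]) (rule refl)
    \<comment> \<open>The inner sum is the value of \<open>t\<close> at the conjugate of c(F) by the
      inverse of k, which equals t(F) by the two invariance hypotheses.\<close>
    also have "\<dots> = int (N div card (carrier K)) * (\<Sum>k\<in>carrier K. t F)"
      by (intro arg_cong2[where f = "(*)"] sum.cong refl)
        (simp add: inversion[OF finite_K conj_sub] t_conj[OF _ cF] t_hom[OF F'])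
    also have "\<dots> = int N * t F" using nk by (simp add: mult.assoc mult.left_commute mult.commute)
    also have "\<dots> = (\<Sum>E | E \<in> subgroups H \<and> F \<subseteq> E. int N * inversion H t E)"
      using inversion[OF finite_H F'] by (simp flip: sum_distrib_left)
    finally show "(\<Sum>E | E \<in> subgroups H \<and> F \<subseteq> E. \<Sum>D\<in>subgroups K. b D * s D E) =
        (\<Sum>E | E \<in> subgroups H \<and> F \<subseteq> E. int N * inversion H t E)" .
  qed

  have "pull (mark_class K N t) = (\<Sum>D\<in>subgroups K. frag_cmul (b D) (frag_cmul (int N) (pull (coset_class K D))))"
    unfolding mark_class_def pull_def frag_extend_sum[OF finSK] by (simp add: o_def frag_extend_cmul b_def mult.commute)
  moreover have "mark_class H N t = (\<Sum>D\<in>subgroups K. frag_cmul (b D)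
      (\<Sum>E\<in>subgroups H. frag_cmul (?n * (s D E * int (card E))) (coset_class H E)))"
  proof -
    have "mark_class H N t = (\<Sum>E\<in>subgroups H. frag_cmul (?n * int (card E) * (\<Sum>D\<in>subgroups K. b D * s D E)) (coset_class H E))"
      unfolding mark_class_def by (intro sum.cong refl) (simp add: coeff mult.assoc mult.left_commute mult.commute)
    also have "\<dots> = (\<Sum>E\<in>subgroups H. \<Sum>D\<in>subgroups K. frag_cmul (b D * (?n * (s D E * int (card E)))) (coset_class H E))"
      by (simp add: sum_distrib_left frag_cmul_sum_left mult.assoc mult.left_commute mult.commute)
    also have "\<dots> = (\<Sum>D\<in>subgroups K. \<Sum>E\<in>subgroups H. frag_cmul (b D * (?n * (s D E * int (card E)))) (coset_class H E))"
      by (rule sum.swap)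
    finally show ?thesis by (simp add: frag_cmul_sum)
  qed
  ultimately have "pull (mark_class K N t) - mark_class H N t = (\<Sum>D\<in>subgroups K. frag_cmul (b D)
      (frag_cmul (int N) (pull (coset_class K D)) -
       (\<Sum>E\<in>subgroups H. frag_cmul (?n * (s D E * int (card E))) (coset_class H E))))"
    by (simp add: sum_subtractf frag_cmul_diff_distrib2)
  also have "\<dots> \<in> ?N"
    by (intro G_relations.sum_mem G_relations.cmul_mem decomp)
  finally show ?thesis .
qed

end

section \<open>Independent elements of the inverse limit\<close>

context group
begin

lemma conj_by_closed: "\<gamma> \<in> carrier G \<Longrightarrow> x \<in> carrier G \<Longrightarrow> conj_by G \<gamma> x \<in> carrier G"
  by (simp add: conj_by_def)

lemma conj_by_mult:
  "\<gamma> \<in> carrier G \<Longrightarrow> x \<in> carrier G \<Longrightarrow> y \<in> carrier G \<Longrightarrow>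
    conj_by G \<gamma> (x \<otimes> y) = conj_by G \<gamma> x \<otimes> conj_by G \<gamma> y"
  by (simp add: conj_by_def m_assoc) (simp add: m_assoc[symmetric])

lemma conj_by_conj_by:
  "\<gamma> \<in> carrier G \<Longrightarrow> \<delta> \<in> carrier G \<Longrightarrow> x \<in> carrier G \<Longrightarrow>
    conj_by G \<gamma> (conj_by G \<delta> x) = conj_by G (\<gamma> \<otimes> \<delta>) x"
  by (simp add: conj_by_def m_assoc inv_mult_group)

lemma conj_by_one: "x \<in> carrier G \<Longrightarrow> conj_by G \<one> x = x"
  by (simp add: conj_by_def)

lemma conj_by_image_conj_by:
  assumes "\<gamma> \<in> carrier G" "\<delta> \<in> carrier G" "H \<subseteq> carrier G"
  shows "conj_by G \<gamma> ` conj_by G \<delta> ` H = conj_by G (\<gamma> \<otimes> \<delta>) ` H"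
  unfolding image_image using assms by (intro image_cong) (auto simp: conj_by_conj_by)

lemma conj_by_image_inv:
  assumes "\<gamma> \<in> carrier G" "H \<subseteq> carrier G"
  shows "conj_by G (inv \<gamma>) ` conj_by G \<gamma> ` H = H"
proof -
  have "conj_by G (inv \<gamma>) ` conj_by G \<gamma> ` H = conj_by G \<one> ` H"
    using assms by (simp add: conj_by_image_conj_by)
  also have "\<dots> = id ` H" using assms by (intro image_cong) (auto simp: conj_by_one)
  finally show ?thesis by simp
qed

lemma conj_class_self: "H \<subseteq> carrier G \<Longrightarrow> H \<in> conj_class G H"
  using conj_by_image_inv[of \<one> H] by (auto simp: conj_class_def conj_by_image_conj_by intro!: exI[of _ \<one>])

lemma conj_class_image_subset:
  assumes "\<gamma> \<in> carrier G" "H \<subseteq> carrier G"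
  shows "conj_class G (conj_by G \<gamma> ` H) \<subseteq> conj_class G H"
proof
  fix E assume "E \<in> conj_class G (conj_by G \<gamma> ` H)"
  then obtain \<delta> where "\<delta> \<in> carrier G" "E = conj_by G \<delta> ` conj_by G \<gamma> ` H"
    by (auto simp: conj_class_def)
  then have "E = conj_by G (\<delta> \<otimes> \<gamma>) ` H" "\<delta> \<otimes> \<gamma> \<in> carrier G"
    using assms by (simp_all add: conj_by_image_conj_by)
  then show "E \<in> conj_class G H" unfolding conj_class_def by blast
qed

lemma conj_class_image:
  assumes "\<gamma> \<in> carrier G" "H \<subseteq> carrier G"
  shows "conj_class G (conj_by G \<gamma> ` H) = conj_class G H"
proof
  show "conj_class G (conj_by G \<gamma> ` H) \<subseteq> conj_class G H"
    by (rule conj_class_image_subset[OF assms])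
  have "conj_by G \<gamma> ` H \<subseteq> carrier G" using assms by (auto intro: conj_by_closed)
  from conj_class_image_subset[OF inv_closed[OF assms(1)] this]
  show "conj_class G H \<subseteq> conj_class G (conj_by G \<gamma> ` H)"
    by (simp add: conj_by_image_inv[OF assms])
qed

lemma conj_class_eq_card:
  assumes "H \<subseteq> carrier G" "E \<subseteq> carrier G" "conj_class G E = conj_class G H"
  shows "card E = card H"
proof -
  have "E \<in> conj_class G H" using conj_class_self[OF assms(2)] assms(3) by simp
  then obtain \<gamma> where \<gamma>: "\<gamma> \<in> carrier G" "E = conj_by G \<gamma> ` H"
    by (auto simp: conj_class_def)
  have "inj_on (conj_by G \<gamma>) H"
    by (rule inj_on_inverseI[where g = "conj_by G (inv \<gamma>)"])
      (use \<gamma>(1) assms(1) in \<open>auto simp: conj_by_conj_by conj_by_one\<close>)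
  then show ?thesis unfolding \<gamma>(2) by (rule card_image)
qed

end

lemma G_pullback_coset:
  assumes "finite_group_hom (\<Gamma>\<lparr>carrier := H\<rparr>) (\<Gamma>\<lparr>carrier := K\<rparr>) c"
  shows "G_pullback \<Gamma> H c (G_relations (sub_group_ring \<Gamma> K) #>\<^bsub>free_Abelian_group (fg_modules (sub_group_ring \<Gamma> K))\<^esub> u)
     = G_relations (sub_group_ring \<Gamma> H) #>\<^bsub>free_Abelian_group (fg_modules (sub_group_ring \<Gamma> H))\<^esub>
         finite_group_hom.pull c u"
proof -
  interpret finite_group_hom "\<Gamma>\<lparr>carrier := H\<rparr>" "\<Gamma>\<lparr>carrier := K\<rparr>" c by fact
  show ?thesis
    using G_restrict_coset[of u] unfolding G_pullback_def \<phi>_def .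
qed

text \<open>One common multiple \<open>N\<close> of all orders is fixed for the whole family: the
  scaling must be the same at every member for the components to match under restriction.\<close>

locale finite_subgroup_family = group \<Gamma> for \<Gamma> :: "'a monoid" (structure) +
  fixes \<F> :: "'a set set" and N :: nat
  assumes family: "subgroup_family \<Gamma> \<F>" and N_pos: "N > 0"
    and N_dvd: "H \<in> \<F> \<Longrightarrow> card H dvd N"
begin

abbreviation "sub H \<equiv> \<Gamma>\<lparr>carrier := H\<rparr>"

abbreviation "coset H u \<equiv>
  G_relations (sub_group_ring \<Gamma> H) #>\<^bsub>free_Abelian_group (fg_modules (sub_group_ring \<Gamma> H))\<^esub> u"

lemma
  assumes "H \<in> \<F>"
  shows subgroup_mem: "subgroup H \<Gamma>" and finite_mem: "finite H" and mem_subset: "H \<subseteq> carrier \<Gamma>"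
proof -
  have "\<F> \<subseteq> finite_subgroups \<Gamma>" using family by (simp add: subgroup_family_def)
  then have "H \<in> finite_subgroups \<Gamma>" using assms by (rule subsetD)
  then show "subgroup H \<Gamma>" "finite H" "H \<subseteq> carrier \<Gamma>"
    by (auto simp: finite_subgroups_def dest: subgroup.subset)
qed

lemma group_sub: "H \<in> \<F> \<Longrightarrow> group (sub H)"
  by (simp add: subgroup_mem subgroup_imp_group)

lemma hom_inclusion:
  assumes "H \<in> \<F>" "K \<in> \<F>" "H \<subseteq> K"
  shows "finite_group_hom (sub H) (sub K) (\<lambda>h. h)"
  using assms by (intro finite_group_hom.intro finite_group_hom_axioms.intro group_sub)
    (auto simp: finite_mem hom_def)

lemma hom_conj:
  assumes "H \<in> \<F>" "conj_by \<Gamma> \<gamma> ` H \<in> \<F>" "\<gamma> \<in> carrier \<Gamma>"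
  shows "finite_group_hom (sub H) (sub (conj_by \<Gamma> \<gamma> ` H)) (conj_by \<Gamma> \<gamma>)"
  using assms mem_subset[OF assms(1)] conj_by_mult[OF assms(3)]
  by (intro finite_group_hom.intro finite_group_hom_axioms.intro group_sub)
    (auto simp: finite_mem hom_def subset_iff)

text \<open>Conjugacy is taken in \<Gamma>, not in a member of the family. The value at
  \<open>E\<close> then does not depend on the group in which \<open>E\<close> is considered, and
  conjugation in \<Gamma> preserves it.\<close>

definition marks :: "'a set \<Rightarrow> 'a set \<Rightarrow> int" where
  "marks C E = (if conj_class \<Gamma> E = conj_class \<Gamma> C then 1 else 0)"

lemma marks_conj: "\<gamma> \<in> carrier \<Gamma> \<Longrightarrow> E \<subseteq> carrier \<Gamma> \<Longrightarrow> marks C (conj_by \<Gamma> \<gamma> ` E) = marks C E"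
  by (simp add: marks_def conj_class_image)

lemma pull_marks:
  assumes H: "H \<in> \<F>" and K: "K \<in> \<F>" and hom: "finite_group_hom (sub H) (sub K) c"
    and c: "\<And>E. E \<subseteq> H \<Longrightarrow> marks C (c ` E) = marks C E"
  shows "finite_group_hom.pull c (mark_class (sub K) N (marks C)) - mark_class (sub H) N (marks C)
    \<in> G_relations (sub_group_ring \<Gamma> H)"
proof -
  interpret h: finite_group_hom "sub H" "sub K" c by fact
  show ?thesis
  proof (rule h.pull_mark_class)
    show "card (carrier (sub H)) dvd N" "card (carrier (sub K)) dvd N"
      using N_dvd H K by simp_all
    fix E assume "subgroup E (sub H)"
    then show "marks C (c ` E) = marks C E" using subgroup.subset[of E "sub H"] by (intro c) simp
  next
    fix k E assume k: "k \<in> carrier (sub K)" and E: "subgroup E (sub K)"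
    have EK: "E \<subseteq> K" using subgroup.subset[OF E] by simp
    have kK: "k \<in> K" "k \<in> carrier \<Gamma>" using k mem_subset[OF K] by auto
    have "(\<lambda>x. inv\<^bsub>sub K\<^esub> k \<otimes>\<^bsub>sub K\<^esub> x \<otimes>\<^bsub>sub K\<^esub> k) ` E = conj_by \<Gamma> (inv k) ` E"
      using kK by (simp add: conj_by_def m_inv_consistent[OF subgroup_mem[OF K] kK(1)])
    then show "marks C ((\<lambda>x. inv\<^bsub>sub K\<^esub> k \<otimes>\<^bsub>sub K\<^esub> x \<otimes>\<^bsub>sub K\<^esub> k) ` E) = marks C E"
      using kK EK mem_subset[OF K] by (simp add: marks_conj)
  qed
qed

definition elt :: "'a set \<Rightarrow> 'a set \<Rightarrow> (('a \<Rightarrow>\<^sub>0 int, nat) module \<Rightarrow>\<^sub>0 int) set" where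
  "elt C = (\<lambda>H\<in>\<F>. coset H (mark_class (sub H) N (marks C)))"

lemma carrier_G_group:
  "carrier (G_group (sub_group_ring \<Gamma> H)) = coset H ` {u. Poly_Mapping.keys u \<subseteq> fg_modules (sub_group_ring \<Gamma> H)}"
  by (auto simp: G_group_def FactGroup_def RCOSETS_def)

lemma mult_G_group: "coset H u \<otimes>\<^bsub>G_group (sub_group_ring \<Gamma> H)\<^esub> coset H v = coset H (u + v)"
  by (simp add: G_group_def FactGroup_def G_relations.coset_mult)

lemma mem_G_family:
  "x \<in> carrier (G_family \<Gamma> \<F>) \<longleftrightarrow> x \<in> (\<Pi>\<^sub>E H\<in>\<F>. carrier (G_group (sub_group_ring \<Gamma> H))) \<and>
     (\<forall>H\<in>\<F>. \<forall>K\<in>\<F>. H \<subseteq> K \<longrightarrow> G_pullback \<Gamma> H (\<lambda>h. h) (x K) = x H) \<and>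
     (\<forall>H\<in>\<F>. \<forall>K\<in>\<F>. \<forall>\<gamma>\<in>carrier \<Gamma>. K = conj_by \<Gamma> \<gamma> ` H \<longrightarrow> G_pullback \<Gamma> H (conj_by \<Gamma> \<gamma>) (x K) = x H)"
  by (simp add: G_family_def Let_def)

lemma mult_G_family:
  "x \<otimes>\<^bsub>G_family \<Gamma> \<F>\<^esub> y = (\<lambda>H\<in>\<F>. x H \<otimes>\<^bsub>G_group (sub_group_ring \<Gamma> H)\<^esub> y H)"
  by (simp add: G_family_def Let_def)

lemma G_family_component:
  assumes "x \<in> carrier (G_family \<Gamma> \<F>)" "H \<in> \<F>"
  obtains u where "Poly_Mapping.keys u \<subseteq> fg_modules (sub_group_ring \<Gamma> H)" "x H = coset H u"
proof -
  have "x H \<in> carrier (G_group (sub_group_ring \<Gamma> H))"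
    using assms by (auto simp: mem_G_family)
  then show thesis using that unfolding carrier_G_group by auto
qed

lemma elt_mem: "elt C \<in> carrier (G_family \<Gamma> \<F>)"
  unfolding mem_G_family
proof (intro conjI ballI impI)
  have "coset H (mark_class (sub H) N (marks C)) \<in> carrier (G_group (sub_group_ring \<Gamma> H))" if "H \<in> \<F>" for H
    using mark_class_fg[OF group_sub[OF that], of N "marks C"] finite_mem[OF that]
    unfolding carrier_G_group by (intro imageI) simp
  then show "elt C \<in> (\<Pi>\<^sub>E H\<in>\<F>. carrier (G_group (sub_group_ring \<Gamma> H)))"
    by (auto simp: elt_def)
next
  fix H K assume HK: "H \<in> \<F>" "K \<in> \<F>" "H \<subseteq> K"
  note hom = hom_inclusion[OF HK]
  show "G_pullback \<Gamma> H (\<lambda>h. h) (elt C K) = elt C H"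
    using HK pull_marks[OF HK(1,2) hom, of C]
    by (simp add: elt_def G_pullback_coset[OF hom] G_relations.coset_eq_iff)
next
  fix H K \<gamma> assume HK: "H \<in> \<F>" "K \<in> \<F>" and \<gamma>: "\<gamma> \<in> carrier \<Gamma>" "K = conj_by \<Gamma> \<gamma> ` H"
  have hom: "finite_group_hom (sub H) (sub K) (conj_by \<Gamma> \<gamma>)"
    using hom_conj[OF HK(1) _ \<gamma>(1)] HK(2) \<gamma>(2) by simp
  have "marks C (conj_by \<Gamma> \<gamma> ` E) = marks C E" if "E \<subseteq> H" for E
    using that mem_subset[OF HK(1)] \<gamma>(1) by (intro marks_conj) auto
  then show "G_pullback \<Gamma> H (conj_by \<Gamma> \<gamma>) (elt C K) = elt C H"
    using HK pull_marks[OF HK hom, of C]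
    by (simp add: elt_def G_pullback_coset[OF hom] G_relations.coset_eq_iff)
qed

lemma G_family_mult_closed:
  assumes x: "x \<in> carrier (G_family \<Gamma> \<F>)" and y: "y \<in> carrier (G_family \<Gamma> \<F>)"
  shows "x \<otimes>\<^bsub>G_family \<Gamma> \<F>\<^esub> y \<in> carrier (G_family \<Gamma> \<F>)"
proof -
  have pull: "G_pullback \<Gamma> H c (x K \<otimes>\<^bsub>G_group (sub_group_ring \<Gamma> K)\<^esub> y K) = x H \<otimes>\<^bsub>G_group (sub_group_ring \<Gamma> H)\<^esub> y H"
    if K: "K \<in> \<F>" and hom: "finite_group_hom (sub H) (sub K) c"
      and c: "G_pullback \<Gamma> H c (x K) = x H" "G_pullback \<Gamma> H c (y K) = y H" for H K c
  proof -
    interpret h: finite_group_hom "sub H" "sub K" c by fact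
    obtain u where u: "x K = coset K u" using G_family_component[OF x K] by metis
    obtain v where v: "y K = coset K v" using G_family_component[OF y K] by metis
    show ?thesis
      unfolding c[symmetric] u v
      by (simp add: mult_G_group G_pullback_coset[OF hom] h.pull_add)
  qed
  have "x H \<otimes>\<^bsub>G_group (sub_group_ring \<Gamma> H)\<^esub> y H \<in> carrier (G_group (sub_group_ring \<Gamma> H))" if H: "H \<in> \<F>" for H
  proof -
    obtain u where u: "Poly_Mapping.keys u \<subseteq> fg_modules (sub_group_ring \<Gamma> H)" "x H = coset H u"
      by (rule G_family_component[OF x H])
    obtain v where v: "Poly_Mapping.keys v \<subseteq> fg_modules (sub_group_ring \<Gamma> H)" "y H = coset H v"
      by (rule G_family_component[OF y H])
    have "Poly_Mapping.keys (u + v) \<subseteq> fg_modules (sub_group_ring \<Gamma> H)"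
      using keys_add[of u v] u(1) v(1) by blast
    then show ?thesis unfolding u(2) v(2) mult_G_group carrier_G_group by (intro imageI) simp
  qed
  then have 1: "(\<lambda>H\<in>\<F>. x H \<otimes>\<^bsub>G_group (sub_group_ring \<Gamma> H)\<^esub> y H) \<in>
      (\<Pi>\<^sub>E H\<in>\<F>. carrier (G_group (sub_group_ring \<Gamma> H)))" by auto
  have 2: "G_pullback \<Gamma> H (\<lambda>h. h) (x K \<otimes>\<^bsub>G_group (sub_group_ring \<Gamma> K)\<^esub> y K) =
      x H \<otimes>\<^bsub>G_group (sub_group_ring \<Gamma> H)\<^esub> y H" if "H \<in> \<F>" "K \<in> \<F>" "H \<subseteq> K" for H K
    using x y that by (intro pull hom_inclusion) (simp_all add: mem_G_family)
  have 3: "G_pullback \<Gamma> H (conj_by \<Gamma> \<gamma>) (x K \<otimes>\<^bsub>G_group (sub_group_ring \<Gamma> K)\<^esub> y K) =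
      x H \<otimes>\<^bsub>G_group (sub_group_ring \<Gamma> H)\<^esub> y H"
    if "H \<in> \<F>" "K \<in> \<F>" "\<gamma> \<in> carrier \<Gamma>" "K = conj_by \<Gamma> \<gamma> ` H" for H K \<gamma>
    using x y that hom_conj[of H \<gamma>] by (intro pull) (simp_all add: mem_G_family)
  show ?thesis
    unfolding mem_G_family mult_G_family
    by (intro conjI ballI impI 1) (simp_all only: restrict_apply' 2 3)
qed

text \<open>These are the functionals fed into the dimension bound. Any representative may be picked
  since the rank vanishes on relations, see \<open>rank_at_coset\<close>.\<close>

definition rank_at :: "'a set \<Rightarrow> ('a set \<Rightarrow> (('a \<Rightarrow>\<^sub>0 int, nat) module \<Rightarrow>\<^sub>0 int) set) \<Rightarrow> rat" where
  "rank_at H x = rat_extend (\<lambda>M. of_nat (inv_rank (sub H) M)) (SOME u. u \<in> x H)"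

lemma rank_at_coset:
  assumes H: "H \<in> \<F>" and x: "x H = coset H u"
  shows "rank_at H x = rat_extend (\<lambda>M. of_nat (inv_rank (sub H) M)) u"
proof -
  have "u \<in> x H" by (simp add: x G_relations.mem_coset_iff)
  then have "(SOME v. v \<in> x H) \<in> x H" by (rule someI)
  then have "(SOME v. v \<in> x H) - u \<in> G_relations (sub_group_ring \<Gamma> H)"
    unfolding x by (simp only: G_relations.mem_coset_iff)
  from rat_extend_inv_rank_relations[OF group_sub[OF H] _ this] finite_mem[OF H]
  show ?thesis by (simp add: rank_at_def rat_extend_diff)
qed

lemma rank_at_mult:
  assumes H: "H \<in> \<F>" and x: "x \<in> carrier (G_family \<Gamma> \<F>)" and y: "y \<in> carrier (G_family \<Gamma> \<F>)"
  shows "rank_at H (x \<otimes>\<^bsub>G_family \<Gamma> \<F>\<^esub> y) = rank_at H x + rank_at H y"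
proof -
  obtain u where u: "Poly_Mapping.keys u \<subseteq> fg_modules (sub_group_ring \<Gamma> H)" "x H = coset H u"
    by (rule G_family_component[OF x H])
  obtain v where v: "Poly_Mapping.keys v \<subseteq> fg_modules (sub_group_ring \<Gamma> H)" "y H = coset H v"
    by (rule G_family_component[OF y H])
  have "(x \<otimes>\<^bsub>G_family \<Gamma> \<F>\<^esub> y) H = coset H (u + v)"
    using H by (simp add: mult_G_family u v mult_G_group)
  then show ?thesis
    using rank_at_coset[of H x u, OF H u(2)] rank_at_coset[of H y v, OF H v(2)]
      rank_at_coset[of H "x \<otimes>\<^bsub>G_family \<Gamma> \<F>\<^esub> y" "u + v", OF H]
    by (simp add: rat_extend_add)
qed

lemma rank_at_elt:
  assumes H: "H \<in> \<F>"
  shows "rank_at H (elt C) =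
    of_int (int N * (int (N div card H) * (\<Sum>g\<in>H. marks C (generate \<Gamma> {g}))))"
proof -
  have "elt C H = coset H (mark_class (sub H) N (marks C))" using H by (simp add: elt_def)
  from rank_at_coset[of H "elt C" "mark_class (sub H) N (marks C)", OF H this] inv_rank_mark_class[OF group_sub[OF H], of N "marks C"] finite_mem[OF H]
  have "rank_at H (elt C) = of_int (int N * (int (N div card H) * (\<Sum>g\<in>H. marks C (generate (sub H) {g}))))"
    by simp
  also have "(\<Sum>g\<in>H. marks C (generate (sub H) {g})) = (\<Sum>g\<in>H. marks C (generate \<Gamma> {g}))"
    using generate_consistent[OF _ subgroup_mem[OF H]] by (intro sum.cong) auto
  finally show ?thesis .
qed

text \<open>All terms of the sum are 0 or 1, and a generator of \<open>H\<close> contributes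
  1.\<close>

lemma rank_at_elt_self:
  assumes H: "H \<in> \<F>" and cyc: "cyclic_group (sub H)"
  shows "rank_at H (elt H) \<noteq> 0"
proof -
  obtain g where g: "g \<in> H" "subgroup_generated (sub H) {g} = sub H"
    using cyc by (auto simp: cyclic_group_def)
  have "generate (sub H) {g} = H"
    using arg_cong[OF g(2), of carrier] g(1) by (simp add: carrier_subgroup_generated)
  then have "generate \<Gamma> {g} = H"
    using generate_consistent[OF _ subgroup_mem[OF H], of "{g}"] g(1) by simp
  then have "1 \<le> (\<Sum>g\<in>{g}. marks H (generate \<Gamma> {g}))" by (simp add: marks_def)
  also have "\<dots> \<le> (\<Sum>g\<in>H. marks H (generate \<Gamma> {g}))"
    using g(1) by (intro sum_mono2 finite_mem[OF H]) (auto simp: marks_def)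
  finally have "(\<Sum>g\<in>H. marks H (generate \<Gamma> {g})) \<noteq> 0" by simp
  moreover have "N div card H \<noteq> 0"
    using N_pos N_dvd[OF H] by auto
  ultimately show ?thesis
    using N_pos unfolding rank_at_elt[OF H] of_int_eq_0_iff by simp
qed

text \<open>A cyclic subgroup of \<open>H\<close> conjugate to \<open>C\<close> has order
  \<open>card C\<close>, which is at least \<open>card H\<close>; so it is all of \<open>H\<close>,
  contrary to the classes being different.\<close>

lemma rank_at_elt_other:
  assumes H: "H \<in> \<F>" and C: "C \<in> \<F>" and card: "card H \<le> card C"
    and ne: "conj_class \<Gamma> H \<noteq> conj_class \<Gamma> C"
  shows "rank_at H (elt C) = 0"
proof -
  have "marks C (generate \<Gamma> {g}) = 0" if g: "g \<in> H" for g
  proof (rule ccontr)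
    assume "marks C (generate \<Gamma> {g}) \<noteq> 0"
    then have eq: "conj_class \<Gamma> (generate \<Gamma> {g}) = conj_class \<Gamma> C"
      by (simp add: marks_def split: if_splits)
    have sub: "generate \<Gamma> {g} \<subseteq> H"
      using g generate_subgroup_incl[OF _ subgroup_mem[OF H]] by simp
    have "card (generate \<Gamma> {g}) = card C"
      using sub mem_subset[OF H] mem_subset[OF C] eq by (intro conj_class_eq_card) auto
    then have "generate \<Gamma> {g} = H"
      using sub card card_mono[OF finite_mem[OF H] sub] by (intro card_subset_eq finite_mem[OF H]) simp_all
    then show False using eq ne by simp
  qed
  then show ?thesis by (simp add: rank_at_elt[OF H])
qed

text \<open>One cyclic representative is picked per class. It indexes both an element and a
  functional, and its order serves as the rank for triangularity.\<close>

lemma ext_dim_G_family: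
  assumes fin: "finite (conj_class \<Gamma> ` \<F>)"
  shows "ext_dim (class_ring :: rat ring) (tensor_rat (G_family \<Gamma> \<F>)) \<ge> enat (num_cyclic_classes \<Gamma> \<F>)"
proof -
  let ?Cyc = "{C \<in> \<F>. cyclic_group (sub C)}"
  let ?I = "conj_class \<Gamma> ` ?Cyc"
  define rep where "rep = inv_into ?Cyc (conj_class \<Gamma>)"
  have rep: "rep i \<in> \<F>" "cyclic_group (sub (rep i))" "conj_class \<Gamma> (rep i) = i" if "i \<in> ?I" for i
    using inv_into_into[OF that] f_inv_into_f[OF that] by (simp_all add: rep_def)
  have "ext_dim (class_ring :: rat ring) (tensor_rat (G_family \<Gamma> \<F>)) \<ge> enat (card ?I)"
  proof (rule ext_dim_tensor_rat_ge[where b = "\<lambda>i. elt (rep i)" and \<psi> = "\<lambda>i. rank_at (rep i)" and rk = "\<lambda>i. card (rep i)"])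
    show "finite ?I" using fin by (rule rev_finite_subset) auto
    show "rank_at (rep i) (elt (rep i)) \<noteq> 0" if "i \<in> ?I" for i
      using rep[OF that] by (intro rank_at_elt_self)
    show "rank_at (rep i) (elt (rep j)) = 0" if "i \<in> ?I" "j \<in> ?I" "i \<noteq> j" "card (rep i) \<le> card (rep j)" for i j
      using rep[OF that(1)] rep[OF that(2)] that by (intro rank_at_elt_other) auto
    show "rank_at (rep i) (x \<otimes>\<^bsub>G_family \<Gamma> \<F>\<^esub> y) = rank_at (rep i) x + rank_at (rep i) y"
      if "i \<in> ?I" "x \<in> carrier (G_family \<Gamma> \<F>)" "y \<in> carrier (G_family \<Gamma> \<F>)" for i x y
      using rep(1)[OF that(1)] that(2,3) by (rule rank_at_mult)
  qed (auto intro: elt_mem G_family_mult_closed)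
  then show ?thesis by (simp add: num_cyclic_classes_def)
qed

end

theorem proposition2p8:
  fixes \<Gamma> :: "'a monoid" and \<F> :: "'a set set"
  assumes "group \<Gamma>"
    and "finite (conj_class \<Gamma> ` finite_subgroups \<Gamma>)"
    and "subgroup_family \<Gamma> \<F>"
  shows "ext_dim (class_ring :: rat ring) (tensor_rat (G_family \<Gamma> \<F>))
           \<ge> enat (num_cyclic_classes \<Gamma> \<F>)"
proof -
  interpret group \<Gamma> by fact
  have F: "\<F> \<subseteq> finite_subgroups \<Gamma>" using assms(3) by (simp add: subgroup_family_def)
  then have fin: "finite (conj_class \<Gamma> ` \<F>)"
    using assms(2) by (meson finite_subset image_mono)
  have sub: "H \<subseteq> carrier \<Gamma>" "finite H" "H \<noteq> {}" if "H \<in> \<F>" for H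
    using that F by (auto simp: finite_subgroups_def dest: subgroup.subset subgroup.one_closed)
  \<comment> \<open>Conjugate subgroups have equal order, so finitely many classes leave only
    finitely many orders, although the family itself may be infinite.\<close>
  have "card ` \<F> \<subseteq> (\<lambda>c. card (SOME H. H \<in> \<F> \<and> conj_class \<Gamma> H = c)) ` (conj_class \<Gamma> ` \<F>)"
  proof
    fix n assume "n \<in> card ` \<F>"
    then obtain H where H: "H \<in> \<F>" "n = card H" by blast
    let ?H = "SOME K. K \<in> \<F> \<and> conj_class \<Gamma> K = conj_class \<Gamma> H"
    have "?H \<in> \<F> \<and> conj_class \<Gamma> ?H = conj_class \<Gamma> H"
      by (rule someI[of _ H]) (simp add: H)
    then have "card ?H = card H" using sub H by (intro conj_class_eq_card) auto
    then show "n \<in> (\<lambda>c. card (SOME H. H \<in> \<F> \<and> conj_class \<Gamma> H = c)) ` (conj_class \<Gamma> ` \<F>)"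
      using H by (intro image_eqI[where x = "conj_class \<Gamma> H"] imageI) simp_all
  qed
  then have fin_card: "finite (card ` \<F>)"
    using fin by (meson finite_imageI finite_subset)
  \<comment> \<open>The product runs over the finite set of distinct orders; each order divides it,
    and it is positive because members are finite and nonempty.\<close>
  define N where "N = \<Prod> (card ` \<F>)"
  interpret finite_subgroup_family \<Gamma> \<F> N
  proof unfold_locales
    show "N > 0" using fin_card sub unfolding N_def by (intro prod_pos) (auto simp: card_gt_0_iff)
    show "card H dvd N" if "H \<in> \<F>" for H
      unfolding N_def using dvd_prodI[OF fin_card, of "card H" "\<lambda>x. x"] that by simp
  qed (rule assms)
  show ?thesis by (rule ext_dim_G_family[OF fin])
qed

end
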